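(* Let $f$ be a complete end of a CMC-1 face in de Sitter 3-space $S^3_1$. Then the end is not hyperbolic; hence it is either elliptic or parabolic. Moreover, the total curvature of the induced metric $ds^2$ over a (sufficiently small) punctured neighborhood of the end is finite.
   Context: $\mathbb R^4_1$ is Lorentz–Minkowski 4-space with signature $(-,+,+,+)$, identified with the $2\times2$ Hermitian matrices by $(x_0,x_1,x_2,x_3)\leftrightarrow\begin{pmatrix} x_0+x_3 & x_1+ix_2 \\ x_1-ix_2 & x_0-x_3 \end{pmatrix}$, so $\langle X,X\rangle=-\det X$. De Sitter 3-space is $S^3_1=\{X=X^*:\det X=-1\}=\{Fe_3F^*:F\in SL_2\mathbb C\}$, with $e_3=\mathrm{diag}(1,-1)$, $X^*={}^t\overline X$. $SU_{1,1}=\{S\in SL_2\mathbb C: Se_3S^*=e_3\}$. CMC-1 face: a $C^\infty$ map $f:M^2\to S^3_1$ from a 2-manifold such that (1) on an open dense set $W$, $f$ is a spacelike immersion of constant mean curvature one; (2) near any singular point $p$ (a point where the induced metric $ds^2=f^*\langle\,,\rangle$ degenerates) there are a neighborhood $U$ and a $C^1$ function $\lambda:U\cap W\to(0,\infty)$ such that $\lambda\,ds^2$ extends to a $C^1$ Riemannian metric on $U$; (3) $df(p)\neq0$ for all $p$. $M^2$ is regarded as a Riemann surface, with $f$ conformal away from its singular points. Known representation: on the universal cover $\widetilde M^2$ there are a meromorphic function $g$ (secondary Gauss map, $|g|\not\equiv1$), a holomorphic 1-form $\omega$ with $(1+|g|^2)^2|\omega|^2$ positive definite, and a holomorphic immersion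 (holomorphic null lift) $F:\widetilde M^2\to SL_2\mathbb C$ with $F^{-1}dF=\begin{pmatrix} g & -g^2 \\ 1 & -g \end{pmatrix}\omega$ and $f=Fe_3F^*$; then $ds^2=(1-|g|^2)^2|\omega|^2$ and the singular set is $\{|g|=1\}$. $F$ is unique up to $F\mapsto FA^{-1}$, $A\in SU_{1,1}$. Complete end: a CMC-1 face $f:\Delta^*=\{0<|z|<1\}\to S^3_1$ such that the singular set does not accumulate at $0$ and every path in $\Delta^*$ tending to $0$ has infinite $ds^2$-length. (A CMC-1 face on $M^2$ is called complete if there is a symmetric 2-tensor $T$ vanishing outside a compact subset of $M^2$ such that $T+ds^2$ is a complete Riemannian metric; every end of a complete CMC-1 face is conformally a punctured disk and is a complete end in this sense.) Type of an end: let $\tau$ be the deck transformation corresponding to the counterclockwise loop about $0$; then $F\circ\tau=F\tilde\rho(\tau)$ with $\tilde\rho(\tau)\in SU_{1,1}$. The end is elliptic, parabolic or hyperbolic if $\tilde\rho(\tau)$ is conjugate in $SU_{1,1}$, respectively, to $\Lambda_e(t)=\mathrm{diag}(e^{it},e^{-it})$ for some $t\in(-\pi,\pi]$; to $\pm\Lambda_p(t)$, $\Lambda_p(t)=\begin{pmatrix} 1+it & -it \\ it & 1-it \end{pmatrix}$, for some $t\in\mathbb R\setminus\{0\}$; to $\pm\Lambda_h(t)$, $\Lambda_h(t)=\begin{pmatrix} \cosh t & \sinh t \\ \sinh t & \cosh t \end{pmatrix}$, for some $t>0$. Every element of $SU_{1,1}$ is of exactly one of these types. Total curvature: the integral of the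 Gaussian curvature $K_{ds^2}$ ($\ge0$) against the area element of $ds^2$. *)

theory Defs
  imports "HOL-Complex_Analysis.Complex_Analysis"
begin

section \<open>Lorentz--Minkowski space and Hermitian matrices\<close>

text \<open>The coordinates \<open>(x\<^sub>0, x\<^sub>1, x\<^sub>2, x\<^sub>3)\<close> are the components \<open>x $ 1, x $ 2, x $ 3, x $ 4\<close>.\<close>

definition lorentz :: "real^4 \<Rightarrow> real^4 \<Rightarrow> real" where
  "lorentz x y = - (x $ 1 * y $ 1) + x $ 2 * y $ 2 + x $ 3 * y $ 3 + x $ 4 * y $ 4"

definition herm :: "real^4 \<Rightarrow> complex^2^2" where
  "herm x = vector
     [vector [of_real (x $ 1 + x $ 4), of_real (x $ 2) + \<i> * of_real (x $ 3)],
      vector [of_real (x $ 2) - \<i> * of_real (x $ 3), of_real (x $ 1 - x $ 4)]]"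

definition hconj :: "complex^2^2 \<Rightarrow> complex^2^2" where
  "hconj A = (\<chi> i j. cnj (A $ j $ i))"

definition e3 :: "complex^2^2" where
  "e3 = vector [vector [1, 0], vector [0, -1]]"

definition de_sitter :: "(real^4) set" where
  "de_sitter = {x. det (herm x) = -1}"

definition SL2C :: "(complex^2^2) set" where
  "SL2C = {A. det A = 1}"

definition SU11 :: "(complex^2^2) set" where
  "SU11 = {S \<in> SL2C. S ** e3 ** hconj S = e3}"


section \<open>Calculus in the coordinate \<open>z = x + \<i> y\<close>\<close>

definition coord_vec :: "2 \<Rightarrow> complex" where
  "coord_vec i = (if i = 1 then 1 else \<i>)"

definition pd :: "2 \<Rightarrow> (complex \<Rightarrow> 'a::real_normed_vector) \<Rightarrow> complex \<Rightarrow> 'a" where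
  "pd i f z = frechet_derivative f (at z) (coord_vec i)"

text \<open>Only meaningful for open sets, since derivatives are taken in the whole plane.\<close>

primrec Ck_on :: "nat \<Rightarrow> complex set \<Rightarrow> (complex \<Rightarrow> 'a::real_normed_vector) \<Rightarrow> bool" where
  "Ck_on 0 S f \<longleftrightarrow> continuous_on S f"
| "Ck_on (Suc k) S f \<longleftrightarrow> (\<forall>z\<in>S. f differentiable (at z)) \<and> (\<forall>i. Ck_on k S (pd i f))"

definition smooth_map_on :: "complex set \<Rightarrow> (complex \<Rightarrow> 'a::real_normed_vector) \<Rightarrow> bool" where
  "smooth_map_on S f \<longleftrightarrow> (\<forall>k. Ck_on k S f)"

definition pos_def :: "real^2^2 \<Rightarrow> bool" where
  "pos_def A \<longleftrightarrow> transpose A = A \<and> (\<forall>v. v \<noteq> 0 \<longrightarrow> v \<bullet> (A *v v) > 0)"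

definition riemannian_C1_on :: "complex set \<Rightarrow> (complex \<Rightarrow> real^2^2) \<Rightarrow> bool" where
  "riemannian_C1_on U h \<longleftrightarrow> Ck_on 1 U h \<and> (\<forall>z\<in>U. pos_def (h z))"


section \<open>Gaussian curvature of a metric on a plane domain\<close>

text \<open>\<open>christoffel h k i j\<close> is \<open>\<Gamma>\<^sup>k\<^sub>i\<^sub>j\<close>, and \<open>riemann h l k i j\<close> is the \<open>\<partial>\<^sub>l\<close>-component of
  \<open>R(\<partial>\<^sub>i, \<partial>\<^sub>j) \<partial>\<^sub>k\<close>.\<close>

definition christoffel :: "(complex \<Rightarrow> real^2^2) \<Rightarrow> 2 \<Rightarrow> 2 \<Rightarrow> 2 \<Rightarrow> complex \<Rightarrow> real" where
  "christoffel h k i j z = (\<Sum>l\<in>UNIV. matrix_inv (h z) $ k $ l *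
     (pd i (\<lambda>w. h w $ j $ l) z + pd j (\<lambda>w. h w $ i $ l) z - pd l (\<lambda>w. h w $ i $ j) z)) / 2"

definition riemann :: "(complex \<Rightarrow> real^2^2) \<Rightarrow> 2 \<Rightarrow> 2 \<Rightarrow> 2 \<Rightarrow> 2 \<Rightarrow> complex \<Rightarrow> real" where
  "riemann h l k i j z =
     pd i (christoffel h l j k) z - pd j (christoffel h l i k) z
     + (\<Sum>m\<in>UNIV. christoffel h l i m z * christoffel h m j k z
                 - christoffel h l j m z * christoffel h m i k z)"

definition gauss_curvature :: "(complex \<Rightarrow> real^2^2) \<Rightarrow> complex \<Rightarrow> real" where
  "gauss_curvature h z = (\<Sum>l\<in>UNIV. h z $ 1 $ l * riemann h l 2 1 2 z) / det (h z)"


section \<open>CMC-1 faces\<close>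

definition induced :: "(complex \<Rightarrow> real^4) \<Rightarrow> complex \<Rightarrow> complex \<Rightarrow> complex \<Rightarrow> real" where
  "induced f z u v = lorentz (frechet_derivative f (at z) u) (frechet_derivative f (at z) v)"

definition ds2 :: "(complex \<Rightarrow> real^4) \<Rightarrow> complex \<Rightarrow> real^2^2" where
  "ds2 f z = (\<chi> i j. induced f z (coord_vec i) (coord_vec j))"

definition singular_set :: "complex set \<Rightarrow> (complex \<Rightarrow> real^4) \<Rightarrow> complex set" where
  "singular_set M f = {z \<in> M. det (ds2 f z) = 0}"

text \<open>
  The unit normal is the one compatible with the orientation of the Riemann surface.  The
  orientation of de Sitter space is the one for which the surfaces \<open>F e\<^sub>3 F\<^sup>*\<close> with \<open>F\<close> holomorphic
  and null have mean curvature \<open>1\<close> rather than \<open>-1\<close>: for \<open>F(z) = (1, 0; z, 1)\<close> at \<open>z = 0\<close> one has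
  \<open>f\<^sub>x = (0,1,0,0)\<close>, \<open>f\<^sub>y = (0,0,-1,0)\<close>, \<open>f = (0,0,0,1)\<close> and \<open>\<nu> = (-1,0,0,0)\<close>.
\<close>

definition unit_normal :: "(complex \<Rightarrow> real^4) \<Rightarrow> complex \<Rightarrow> real^4 \<Rightarrow> bool" where
  "unit_normal f z \<nu> \<longleftrightarrow>
     lorentz \<nu> \<nu> = -1 \<and> lorentz \<nu> (f z) = 0 \<and> (\<forall>i. lorentz \<nu> (pd i f z) = 0) \<and>
     det (vector [pd 1 f z, pd 2 f z, \<nu>, f z] :: real^4^4) > 0"

definition second_form :: "(complex \<Rightarrow> real^4) \<Rightarrow> complex \<Rightarrow> real^4 \<Rightarrow> real^2^2" where
  "second_form f z \<nu> = (\<chi> i j. lorentz (pd i (pd j f) z) \<nu>)"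

definition mean_curvature :: "(complex \<Rightarrow> real^4) \<Rightarrow> complex \<Rightarrow> real^4 \<Rightarrow> real" where
  "mean_curvature f z \<nu> = trace (matrix_inv (ds2 f z) ** second_form f z \<nu>) / 2"

definition spacelike_cmc1_on :: "complex set \<Rightarrow> (complex \<Rightarrow> real^4) \<Rightarrow> bool" where
  "spacelike_cmc1_on W f \<longleftrightarrow>
     (\<forall>z\<in>W. pos_def (ds2 f z) \<and> (\<exists>\<nu>. unit_normal f z \<nu> \<and> mean_curvature f z \<nu> = 1))"

text \<open>Here the Riemann surface \<open>M\<close> is an open subset of the complex plane.\<close>

definition cmc1_face :: "complex set \<Rightarrow> (complex \<Rightarrow> real^4) \<Rightarrow> bool" where
  "cmc1_face M f \<longleftrightarrow>
     open M \<and> smooth_map_on M f \<and> f ` M \<subseteq> de_sitter \<and>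
     (\<exists>W. open W \<and> W \<subseteq> M \<and> M \<subseteq> closure W \<and> spacelike_cmc1_on W f \<and>
        (\<forall>p \<in> singular_set M f. \<exists>U \<mu> h.
            open U \<and> p \<in> U \<and> U \<subseteq> M \<and>
            Ck_on 1 (U \<inter> W) \<mu> \<and> (\<forall>z \<in> U \<inter> W. \<mu> z > (0::real)) \<and>
            riemannian_C1_on U h \<and> (\<forall>z \<in> U \<inter> W. h z = \<mu> z *\<^sub>R ds2 f z))) \<and>
     (\<forall>p\<in>M. frechet_derivative f (at p) \<noteq> (\<lambda>_. 0)) \<and>
     (\<forall>z \<in> M - singular_set M f. \<exists>c>0. ds2 f z = mat c)"


section \<open>Complete ends\<close>

definition punctured_disk :: "real \<Rightarrow> complex set" where
  "punctured_disk r = {z. 0 < cmod z \<and> cmod z < r}"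

definition path_to_puncture :: "(real \<Rightarrow> complex) \<Rightarrow> bool" where
  "path_to_puncture \<gamma> \<longleftrightarrow>
     (\<forall>b. 0 < b \<and> b < 1 \<longrightarrow> \<gamma> piecewise_C1_differentiable_on {0..b}) \<and>
     \<gamma> ` {0..<1} \<subseteq> punctured_disk 1 \<and> (\<gamma> \<longlongrightarrow> 0) (at_left 1)"

definition ds_length :: "(complex \<Rightarrow> real^4) \<Rightarrow> (real \<Rightarrow> complex) \<Rightarrow> ennreal" where
  "ds_length f \<gamma> = (\<integral>\<^sup>+ t \<in> {0..<1}.
     ennreal (sqrt (induced f (\<gamma> t) (vector_derivative \<gamma> (at t)) (vector_derivative \<gamma> (at t))))
     \<partial>lborel)"

definition complete_end :: "(complex \<Rightarrow> real^4) \<Rightarrow> bool" where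
  "complete_end f \<longleftrightarrow>
     cmc1_face (punctured_disk 1) f \<and>
     \<not> 0 islimpt singular_set (punctured_disk 1) f \<and>
     (\<forall>\<gamma>. path_to_puncture \<gamma> \<longrightarrow> ds_length f \<gamma> = \<infinity>)"


section \<open>Holomorphic null lifts and the type of an end\<close>

text \<open>
  The universal cover of the punctured unit disk is \<open>exp\<close> on the left half-plane, and the deck
  transformation of the counterclockwise loop about \<open>0\<close> is translation by \<open>2 \<pi> \<i>\<close>.
\<close>

definition left_half_plane :: "complex set" where
  "left_half_plane = {w. Re w < 0}"

definition matrix_deriv :: "(complex \<Rightarrow> complex^2^2) \<Rightarrow> complex \<Rightarrow> complex^2^2" where
  "matrix_deriv F w = (\<chi> i j. deriv (\<lambda>u. F u $ i $ j) w)"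

text \<open>
  The one-form is \<open>\<omega> dw\<close>.  At a pole of \<open>g\<close> the metric \<open>(1 + |g|\<^sup>2)\<^sup>2 |\<omega>|\<^sup>2\<close> and the
  right-hand side of the equation for \<open>F\<close> are meant as limits; the equation at the poles then
  follows by continuity.
\<close>

definition null_lift_data ::
  "(complex \<Rightarrow> complex^2^2) \<Rightarrow> (complex \<Rightarrow> complex) \<Rightarrow> (complex \<Rightarrow> complex) \<Rightarrow> bool" where
  "null_lift_data F g \<omega> \<longleftrightarrow>
     g nicely_meromorphic_on left_half_plane \<and>
     (\<exists>w\<in>left_half_plane. \<not> is_pole g w \<and> cmod (g w) \<noteq> 1) \<and>
     \<omega> holomorphic_on left_half_plane \<and>
     (\<forall>p\<in>left_half_plane. \<exists>l>0.
        ((\<lambda>w. (1 + (cmod (g w))\<^sup>2)\<^sup>2 * (cmod (\<omega> w))\<^sup>2) \<longlongrightarrow> l) (at p)) \<and>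
     (\<forall>i j. (\<lambda>w. F w $ i $ j) holomorphic_on left_half_plane) \<and>
     F ` left_half_plane \<subseteq> SL2C \<and>
     (\<forall>w\<in>left_half_plane. matrix_deriv F w \<noteq> 0) \<and>
     (\<forall>w\<in>left_half_plane. \<not> is_pole g w \<longrightarrow>
        matrix_inv (F w) ** matrix_deriv F w =
        vector [vector [g w * \<omega> w, - (g w)\<^sup>2 * \<omega> w], vector [\<omega> w, - g w * \<omega> w]])"

definition null_lift :: "(complex \<Rightarrow> real^4) \<Rightarrow> (complex \<Rightarrow> complex^2^2) \<Rightarrow> bool" where
  "null_lift f F \<longleftrightarrow>
     (\<exists>g \<omega>. null_lift_data F g \<omega>) \<and>
     (\<forall>w\<in>left_half_plane. herm (f (exp w)) = F w ** e3 ** hconj (F w))"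

definition end_monodromy :: "(complex \<Rightarrow> real^4) \<Rightarrow> complex^2^2 \<Rightarrow> bool" where
  "end_monodromy f \<rho> \<longleftrightarrow> \<rho> \<in> SU11 \<and>
     (\<exists>F. null_lift f F \<and>
        (\<forall>w\<in>left_half_plane. F (w + 2 * of_real pi * \<i>) = F w ** \<rho>))"

definition conj_SU11 :: "complex^2^2 \<Rightarrow> complex^2^2 \<Rightarrow> bool" where
  "conj_SU11 A B \<longleftrightarrow> (\<exists>P\<in>SU11. A = P ** B ** matrix_inv P)"

definition Lambda_e :: "real \<Rightarrow> complex^2^2" where
  "Lambda_e t = vector [vector [cis t, 0], vector [0, cis (- t)]]"

definition Lambda_p :: "real \<Rightarrow> complex^2^2" where
  "Lambda_p t = vector [vector [1 + \<i> * of_real t, - \<i> * of_real t],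
                        vector [\<i> * of_real t, 1 - \<i> * of_real t]]"

definition Lambda_h :: "real \<Rightarrow> complex^2^2" where
  "Lambda_h t = vector [vector [of_real (cosh t), of_real (sinh t)],
                        vector [of_real (sinh t), of_real (cosh t)]]"

definition elliptic :: "complex^2^2 \<Rightarrow> bool" where
  "elliptic \<rho> \<longleftrightarrow> (\<exists>t. - pi < t \<and> t \<le> pi \<and> conj_SU11 \<rho> (Lambda_e t))"

definition parabolic :: "complex^2^2 \<Rightarrow> bool" where
  "parabolic \<rho> \<longleftrightarrow>
     (\<exists>t. t \<noteq> 0 \<and> (conj_SU11 \<rho> (Lambda_p t) \<or> conj_SU11 \<rho> (- Lambda_p t)))"

definition hyperbolic :: "complex^2^2 \<Rightarrow> bool" where
  "hyperbolic \<rho> \<longleftrightarrow>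
     (\<exists>t>0. conj_SU11 \<rho> (Lambda_h t) \<or> conj_SU11 \<rho> (- Lambda_h t))"

text \<open>
  A null lift is unique up to \<open>F \<mapsto> F A\<^sup>-\<^sup>1\<close> with \<open>A \<in> SU\<^sub>1\<^sub>,\<^sub>1\<close>, which conjugates the monodromy, so
  the choice of the lift does not affect the type.
\<close>

definition elliptic_end :: "(complex \<Rightarrow> real^4) \<Rightarrow> bool" where
  "elliptic_end f \<longleftrightarrow> (\<exists>\<rho>. end_monodromy f \<rho> \<and> elliptic \<rho>)"

definition parabolic_end :: "(complex \<Rightarrow> real^4) \<Rightarrow> bool" where
  "parabolic_end f \<longleftrightarrow> (\<exists>\<rho>. end_monodromy f \<rho> \<and> parabolic \<rho>)"

definition hyperbolic_end :: "(complex \<Rightarrow> real^4) \<Rightarrow> bool" where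
  "hyperbolic_end f \<longleftrightarrow> (\<exists>\<rho>. end_monodromy f \<rho> \<and> hyperbolic \<rho>)"


section \<open>Total curvature\<close>

definition finite_total_curvature :: "(complex \<Rightarrow> real^4) \<Rightarrow> complex set \<Rightarrow> bool" where
  "finite_total_curvature f S \<longleftrightarrow>
     set_integrable lborel S (\<lambda>z. gauss_curvature (ds2 f) z * sqrt (det (ds2 f z)))"

end

theory Submission
  imports Defs
begin

text \<open>
  Write \<open>X = herm \<circ> f\<close>.  In the conformal coordinate \<open>z\<close> the equation \<open>H = 1\<close> says that
  \<open>X\<^sub>z X\<^sup>-\<^sup>1\<close> is holomorphic; written without dividing by the metric it extends from the
  dense regular set across the singularities by continuity.  Solving the linear equation
  \<open>F' = X\<^sub>w X\<^sup>-\<^sup>1 F\<close> on the universal cover \<open>w = log z\<close> gives the null lift and its monodromy.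

  With \<open>N = F\<^sup>-\<^sup>1 F' = (a, b; c, -a)\<close>, \<open>a\<^sup>2 + b c = 0\<close>, the induced metric in the coordinate \<open>w\<close> is
  \<open>(|b| - |c|)\<^sup>2 |dw|\<^sup>2\<close>.  Near the end there are no singular points, so \<open>|b| - |c|\<close> has
  constant sign there and one of \<open>a / c\<close>, \<open>- a / b\<close> is a holomorphic map \<open>G\<close> from a half plane
  into the unit disk on which the monodromy acts by Moebius transformations of the disk.  As
  \<open>Re w\<close> tends to minus infinity the hyperbolic distance of \<open>w\<close> and \<open>w + 2 \<pi> \<i>\<close> tends to \<open>0\<close>,
  hence by Schwarz--Pick the monodromy has no positive translation length, that is, it is not
  hyperbolic.  The curvature form is the pullback under \<open>G\<close> of the area form of the disk, and
  Schwarz--Pick bounds it by the area form of the punctured disk, which is finite at the cusp.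
\<close>

text \<open>If \<open>X = F ** e3 ** hconj F\<close> with F holomorphic, then \<open>hconj F\<close>
  is antiholomorphic, so X_w X^-1 = F' F^-1. This logarithmic derivative is read off the surface, is
  single-valued around the puncture and determines F up to a constant right factor; hence the
  monodromy acts on the right. The other one, N = F^-1 F', carries the data of the representation: a
  = g \<omega>, b = - g^2 \<omega>, c = \<omega>. So |b| - |c| changes sign with |g| - 1, and G is g
  or 1/g, whichever lies in the unit disk. The obstacle is that the unit normal and the inverse of
  the metric exist only at regular points, which are merely dense. Each identity is therefore
  brought into a form that is polynomial in f and its derivatives before it is carried over to the
  singular points. Both conclusions rest on one length estimate: at distance s from the boundary
  line the hyperbolic metric of the half plane is |dw| / s, so the translation by 2 \<pi> i has
  length at most 2 \<pi> / s, and in the coordinate z the area density becomes 1 / (|z| ln (\<delta>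
  / |z|))^2.\<close>

no_notation fps_nth (infixl \<open>$\<close> 75)

section \<open>The Schwarz--Pick lemma on a half plane\<close>

text \<open>Reduction to the Schwarz lemma for a self-map of the unit disk fixing 0. Since
  \<open>2 * of_real c - cnj u\<close> is the mirror image of \<open>u\<close> in the boundary line,
  |v - u| / |v + cnj u - 2 c| is the pseudohyperbolic distance of the half plane; the
  cross-multiplied form needs no nonvanishing denominators.\<close>

lemma Schwarz_Pick_half_plane:
  fixes G :: "complex \<Rightarrow> complex" and c :: real
  assumes hol: "G holomorphic_on {w. Re w < c}"
    and bd: "\<And>w. Re w < c \<Longrightarrow> cmod (G w) < 1"
    and u: "Re u < c" and v: "Re v < c"
  shows "cmod (G v - G u) * cmod (v + cnj u - 2 * of_real c)
           \<le> cmod (1 - cnj (G u) * G v) * cmod (v - u)"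
proof -
  \<comment> \<open>Cayley map of the unit disk onto the half plane with 0 going to
    \<open>u\<close>. Its inverse, evaluated at \<open>v\<close>, is the point
    \<open>\<zeta>\<close> used below.\<close>
  define \<phi> where "\<phi> = (\<lambda>\<zeta>. (u - \<zeta> * (2 * of_real c - cnj u)) / (1 - \<zeta>))"
  have \<phi>: "Re (\<phi> \<zeta>) < c" if "cmod \<zeta> < 1" for \<zeta>
  proof -
    have ne: "1 - \<zeta> \<noteq> 0" using that by auto
    have "Re ((u - \<zeta> * (2 * of_real c - cnj u)) * cnj (1 - \<zeta>)) - c * (cmod (1 - \<zeta>))\<^sup>2
        = (Re u - c) * (1 - (cmod \<zeta>)\<^sup>2)"
      unfolding cmod_power2 by (simp add: algebra_simps power2_eq_square)
    moreover have "(Re u - c) * (1 - (cmod \<zeta>)\<^sup>2) < 0"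
      using u that by (intro mult_neg_pos) (auto simp: abs_square_less_1)
    ultimately have "Re ((u - \<zeta> * (2 * of_real c - cnj u)) * cnj (1 - \<zeta>)) < c * (cmod (1 - \<zeta>))\<^sup>2"
      by linarith
    moreover have "\<phi> \<zeta> = (u - \<zeta> * (2 * of_real c - cnj u)) * cnj (1 - \<zeta>) / of_real ((cmod (1
      - \<zeta>))\<^sup>2)"
      using ne unfolding \<phi>_def complex_norm_square by simp
    ultimately show ?thesis using ne
      by (simp only: Re_divide_of_real) (simp add: field_simps)
  qed
  define h where "h = (\<lambda>\<zeta>. (G (\<phi> \<zeta>) - G u) / (1 - cnj (G u) * G (\<phi> \<zeta>)))"
  have h_eq: "h = (\<lambda>\<zeta>. Moebius_function 0 (G u) (G (\<phi> \<zeta>)))"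
    unfolding h_def Moebius_function_simple ..
  have "\<phi> holomorphic_on ball 0 1"
    unfolding \<phi>_def by (intro holomorphic_intros) auto
  then have "G \<circ> \<phi> holomorphic_on ball 0 1"
    by (rule holomorphic_on_compose_gen[OF _ hol]) (use \<phi> in auto)
  then have "Moebius_function 0 (G u) \<circ> (G \<circ> \<phi>) holomorphic_on ball 0 1"
    by (rule holomorphic_on_compose_gen[OF _ Moebius_function_holomorphic]) (use \<phi> bd u in auto)
  then have holh: "h holomorphic_on ball 0 1" by (simp add: h_eq o_def)
  have "\<phi> 0 = u" by (simp add: \<phi>_def)
  then have h0: "h 0 = 0" by (simp add: h_def)
  have h1: "cmod (h \<zeta>) < 1" if "cmod \<zeta> < 1" for \<zeta>
    unfolding h_eq using Moebius_function_norm_lt_1 bd u \<phi>[OF that] by blast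
  define \<zeta> where "\<zeta> = (v - u) / (v + cnj u - 2 * of_real c)"
  have ne: "v + cnj u - 2 * of_real c \<noteq> 0"
    using u v by (auto simp: complex_eq_iff)
  have "(cmod (v - u))\<^sup>2 < (cmod (v + cnj u - 2 * of_real c))\<^sup>2"
  proof -
    have "(cmod (v + cnj u - 2 * of_real c))\<^sup>2 - (cmod (v - u))\<^sup>2 = 4 * ((c - Re u) * (c - Re v))"
      unfolding cmod_power2 by (simp add: algebra_simps power2_eq_square)
    moreover have "(c - Re u) * (c - Re v) > 0" using u v by simp
    ultimately show ?thesis by linarith
  qed
  then have lt: "cmod (v - u) < cmod (v + cnj u - 2 * of_real c)"
    using power2_less_imp_less norm_ge_zero by blast
  then have \<zeta>1: "cmod \<zeta> < 1"
    using ne by (simp add: \<zeta>_def norm_divide)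
  have "\<phi> \<zeta> = v"
  proof -
    have "1 - \<zeta> \<noteq> 0" using \<zeta>1 by auto
    moreover have "v * (1 - \<zeta>) = u - \<zeta> * (2 * of_real c - cnj u)"
    proof -
      have "\<zeta> * (v + cnj u - 2 * of_real c) = v - u" using ne by (simp add: \<zeta>_def)
      then show ?thesis by (simp add: algebra_simps)
    qed
    ultimately show ?thesis by (simp add: \<phi>_def field_simps)
  qed
  then have "cmod (h \<zeta>) = cmod (G v - G u) / cmod (1 - cnj (G u) * G v)"
    by (simp add: h_def norm_divide)
  moreover have "cmod (h \<zeta>) \<le> cmod \<zeta>"
    by (rule Schwarz_Lemma(1)[OF holh h0 h1 \<zeta>1])
  moreover have "1 - cnj (G u) * G v \<noteq> 0"
  proof
    assume "1 - cnj (G u) * G v = 0"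
    then have "cmod (cnj (G u) * G v) = 1" by (metis eq_iff_diff_eq_0 norm_one)
    moreover have "cmod (G u) * cmod (G v) < 1 * 1"
      using bd u v by (intro mult_strict_mono) auto
    ultimately show False by (simp add: norm_mult)
  qed
  ultimately have "cmod (G v - G u) / cmod (1 - cnj (G u) * G v)
      \<le> cmod (v - u) / cmod (v + cnj u - 2 * of_real c)" and "1 - cnj (G u) * G v \<noteq> 0"
    by (simp_all add: \<zeta>_def norm_divide)
  then show ?thesis
    using ne by (simp add: divide_simps mult.commute)
qed

text \<open>Divide the two-point inequality by |v - u| and let v tend to u; the factor 2 (c - Re u)
  is the limit of |v + cnj u - 2 c|.\<close>

lemma Schwarz_Pick_half_plane_deriv:
  fixes G :: "complex \<Rightarrow> complex" and c :: real
  assumes hol: "G holomorphic_on {w. Re w < c}"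
    and bd: "\<And>w. Re w < c \<Longrightarrow> cmod (G w) < 1"
    and u: "Re u < c"
  shows "cmod (deriv G u) * (2 * (c - Re u)) \<le> 1 - (cmod (G u))\<^sup>2"
proof -
  have op: "open {w. Re w < c}" by (rule open_halfspace_Re_lt)
  have "(G has_field_derivative deriv G u) (at u)"
    using holomorphic_derivI[OF hol op] u by auto
  then have *: "((\<lambda>v. (G v - G u) / (v - u)) \<longlongrightarrow> deriv G u) (at u)"
    by (simp add: has_field_derivative_iff)
  have cont: "isCont G u"
    using \<open>(G has_field_derivative deriv G u) (at u)\<close> DERIV_isCont by blast
  have G: "(G \<longlongrightarrow> G u) (at u)" using cont by (simp add: isCont_def)
  have lim1: "((\<lambda>v. cmod ((G v - G u) / (v - u)) * cmod (v + cnj u - 2 * of_real c))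
      \<longlongrightarrow> cmod (deriv G u) * cmod (u + cnj u - 2 * of_real c)) (at u)"
    by (intro tendsto_intros *)
  have lim2: "((\<lambda>v. cmod (1 - cnj (G u) * G v)) \<longlongrightarrow> cmod (1 - cnj (G u) * G u)) (at u)"
    by (intro tendsto_intros G)
  have "\<forall>\<^sub>F v in at u. v \<in> {w. Re w < c}"
    using op u by (intro eventually_at_in_open') auto
  moreover have "\<forall>\<^sub>F v in at u. v \<noteq> u" by (simp add: eventually_at_filter)
  ultimately have "\<forall>\<^sub>F v in at u. cmod ((G v - G u) / (v - u)) * cmod (v + cnj u - 2 * of_real c)
       \<le> cmod (1 - cnj (G u) * G v)"
  proof eventually_elim
    case (elim v)
    then show ?case
      using Schwarz_Pick_half_plane[OF hol bd u, of v] by (simp add: norm_divide field_simps)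
  qed
  from tendsto_le[OF _ lim2 lim1 this]
  have "cmod (deriv G u) * cmod (u + cnj u - 2 * of_real c) \<le> cmod (1 - cnj (G u) * G u)"
    by simp
  moreover have "u + cnj u - 2 * of_real c = of_real (- (2 * (c - Re u)))"
    by (simp add: complex_eq_iff)
  then have "cmod (u + cnj u - 2 * of_real c) = 2 * (c - Re u)"
    using u by (simp only: norm_of_real) simp
  moreover have "1 - cnj (G u) * G u = of_real (1 - (cmod (G u))\<^sup>2)"
    by (simp only: of_real_diff complex_norm_square) simp
  then have "cmod (1 - cnj (G u) * G u) = 1 - (cmod (G u))\<^sup>2"
    using bd[OF u] by (simp only: norm_of_real) (simp add: abs_square_le_1)
  ultimately show ?thesis by simp
qed

text \<open>
  A disk automorphism with coefficients \<open>p, q\<close> moves every point by a pseudohyperbolic distance \<open>d\<close>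
  with \<open>1 - d\<^sup>2 \<le> 1 / (Re p)\<^sup>2\<close>, whereas \<open>d\<close> tends to \<open>0\<close> by Schwarz--Pick.
\<close>

lemma moebius_monodromy_trace_bound:
  fixes G :: "complex \<Rightarrow> complex" and c :: real
  assumes hol: "G holomorphic_on {w. Re w < c}"
    and bd: "\<And>w. Re w < c \<Longrightarrow> cmod (G w) < 1"
    and det: "(cmod p)\<^sup>2 - (cmod q)\<^sup>2 = 1"
    and eq: "\<And>w. Re w < c \<Longrightarrow> G (w + 2 * of_real pi * \<i>) * (cnj q * G w + cnj p) = p * G w + q"
  shows "\<bar>Re p\<bar> \<le> 1"
proof -
  \<comment> \<open>\<open>s\<close> is the distance of the base point to the boundary line. The
    right side does not depend on it, so letting \<open>s\<close> grow forces 1 - 1 / (Re p)^2 to be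
    nonpositive.\<close>
  have key: "(1 - 1 / (Re p)\<^sup>2) * (4 * s\<^sup>2) \<le> (2 * pi)\<^sup>2" if s: "s > 0" and p0: "Re p \<noteq> 0" for s
  proof -
    define u where "u = complex_of_real (c - s)"
    define v where "v = u + 2 * of_real pi * \<i>"
    have uc: "Re u < c" and vc: "Re v < c" using s by (auto simp: u_def v_def)
    define a where "a = G u"
    define b where "b = G v"
    have a1: "cmod a < 1" and b1: "cmod b < 1" using bd uc vc by (auto simp: a_def b_def)
    have ab: "b * (cnj q * a + cnj p) = p * a + q"
      using eq[OF uc] by (simp add: a_def b_def v_def)
    define d where "d = cnj q * a + cnj p"
    have "(cmod q)\<^sup>2 < (cmod p)\<^sup>2" using det by linarith
    then have "cmod q < cmod p" by (rule power2_less_imp_less) simp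
    moreover have "cmod (cnj q * a) \<le> cmod q"
      using a1 by (simp add: norm_mult mult_left_le)
    ultimately have d0: "d \<noteq> 0" unfolding d_def
      by (metis add.commute add_eq_0_iff complex_mod_cnj norm_minus_cancel not_less)
    have det': "Re p * Re p + Im p * Im p - (Re q * Re q + Im q * Im q) = 1"
      using det unfolding cmod_power2 by (simp add: power2_eq_square)
    define D where "D = (1 - cnj a * b) * d"
    have D: "D = d - cnj a * (p * a + q)"
      unfolding D_def ab[folded d_def, symmetric] by (simp add: algebra_simps)
    have E: "(b - a) * d = p * a + q - a * d"
      unfolding ab[folded d_def, symmetric] by (simp add: algebra_simps)
    \<comment> \<open>Combination of |1 - cnj a b|^2 - |b - a|^2 = (1 - |a|^2) (1 - |b|^2) with
      |d|^2 (1 - |b|^2) = 1 - |a|^2; the latter is the invariance of the unit disk under the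
      automorphism.\<close>
    have m1: "(cmod D)\<^sup>2 - (cmod ((b - a) * d))\<^sup>2 = (1 - (cmod a)\<^sup>2)\<^sup>2"
    proof -
      have "(cmod D)\<^sup>2 - (cmod ((b - a) * d))\<^sup>2
        = (1 - (cmod a)\<^sup>2)\<^sup>2 * (Re p * Re p + Im p * Im p - (Re q * Re q + Im q * Im q))"
        unfolding D E unfolding d_def cmod_power2 by (simp add: power2_eq_square) algebra
      then show ?thesis using det' by simp
    qed
    \<comment> \<open>The trace enters here: the two terms of \<open>D\<close> that contain
      \<open>q\<close> add up to a purely imaginary number.\<close>
    have "Re D = Re p * (1 - (cmod a)\<^sup>2)"
      unfolding D d_def cmod_power2 by (simp add: algebra_simps power2_eq_square)
    then have "(Re p)\<^sup>2 * (1 - (cmod a)\<^sup>2)\<^sup>2 \<le> (cmod D)\<^sup>2"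
      by (simp add: cmod_power2 flip: power_mult_distrib)
    then have "(1 - (cmod a)\<^sup>2)\<^sup>2 \<le> (cmod D)\<^sup>2 / (Re p)\<^sup>2"
      using p0 by (simp add: field_simps)
    then have m2: "(1 - 1 / (Re p)\<^sup>2) * (cmod D)\<^sup>2 \<le> (cmod ((b - a) * d))\<^sup>2"
      using m1 unfolding left_diff_distrib[of 1] by simp
    have sp: "cmod (b - a) * cmod (v + cnj u - 2 * of_real c) \<le> cmod (1 - cnj a * b) * cmod (v - u)"
      unfolding a_def b_def by (rule Schwarz_Pick_half_plane[OF hol bd uc vc])
    have vu: "cmod (v - u) = 2 * pi" by (simp add: v_def norm_mult)
    have "2 * s \<le> cmod (v + cnj u - 2 * of_real c)"
      using abs_Re_le_cmod[of "v + cnj u - 2 * of_real c"] s by (simp add: v_def u_def)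
    then have "cmod (b - a) * (2 * s) \<le> cmod (1 - cnj a * b) * (2 * pi)"
      using sp vu by (smt (verit) mult_left_mono norm_ge_zero)
    then have "cmod (b - a) * (2 * s) * cmod d \<le> cmod (1 - cnj a * b) * (2 * pi) * cmod d"
      by (intro mult_right_mono) auto
    then have "cmod ((b - a) * d) * (2 * s) \<le> cmod D * (2 * pi)"
      by (simp add: D_def norm_mult mult_ac)
    then have "(cmod ((b - a) * d))\<^sup>2 * (2 * s)\<^sup>2 \<le> (cmod D)\<^sup>2 * (2 * pi)\<^sup>2"
      unfolding power_mult_distrib[symmetric] using s by (intro power_mono) auto
    then have m3: "(1 - 1 / (Re p)\<^sup>2) * (cmod D)\<^sup>2 * (2 * s)\<^sup>2 \<le> (cmod D)\<^sup>2 * (2 * pi)\<^sup>2"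
      using m2 by (smt (verit) mult_right_mono zero_le_power2)
    have "D \<noteq> 0"
    proof
      assume "D = 0"
      then have "(1 - (cmod a)\<^sup>2)\<^sup>2 \<le> 0" using m1
        by (smt (verit) norm_zero zero_le_power2 power_zero_numeral)
      moreover have "(cmod a)\<^sup>2 < 1" using a1 by (simp add: abs_square_less_1)
      ultimately show False by simp
    qed
    then have "(cmod D)\<^sup>2 > 0" by simp
    moreover have "(cmod D)\<^sup>2 * ((1 - 1 / (Re p)\<^sup>2) * (2 * s)\<^sup>2) \<le> (cmod D)\<^sup>2 * (2 * pi)\<^sup>2"
      using m3 by (simp only: mult_ac)
    ultimately have "(1 - 1 / (Re p)\<^sup>2) * (2 * s)\<^sup>2 \<le> (2 * pi)\<^sup>2"
      by (simp only: mult_le_cancel_left_pos)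
    then show ?thesis by (simp add: power_mult_distrib)
  qed
  show ?thesis
  proof (rule ccontr)
    assume "\<not> \<bar>Re p\<bar> \<le> 1"
    then have "(Re p)\<^sup>2 > 1" and p0: "Re p \<noteq> 0" by (auto simp: abs_square_le_1 simp flip: not_le)
    define e where "e = 1 - 1 / (Re p)\<^sup>2"
    have e: "e > 0" using \<open>(Re p)\<^sup>2 > 1\<close> by (simp add: e_def divide_less_eq)
    \<comment> \<open>Chosen so that the left side of \<open>key\<close> is four times the right
      side.\<close>
    define s where "s = (2 * pi) / sqrt e"
    have "s > 0" using e by (simp add: s_def)
    then have "e * (4 * s\<^sup>2) \<le> (2 * pi)\<^sup>2" using key p0 by (simp add: e_def)
    moreover have "e * (4 * s\<^sup>2) = 4 * (2 * pi)\<^sup>2"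
      using e by (simp add: s_def power_divide)
    ultimately show False by simp
  qed
qed

section \<open>Linear holomorphic differential equations\<close>

text \<open>Picard iteration written as a series: each term is the primitive, vanishing at
  \<open>w0\<close>, of \<open>A\<close> applied to the previous term. Linearity gives the majorant
  C (k M |w - w0|)^n / n!, so the series converges on all of \<open>S\<close> and not only near
  \<open>w0\<close>; convexity supplies the primitives and the segments along which the bound is
  integrated.\<close>

lemma holomorphic_linear_ode:
  fixes A :: "'n::finite \<Rightarrow> 'n \<Rightarrow> complex \<Rightarrow> complex" and y0 :: "'n \<Rightarrow> complex"
  assumes S: "open S" "convex S" and w0: "w0 \<in> S"
    and A: "\<And>i j. A i j holomorphic_on S"
  obtains y :: "'n \<Rightarrow> complex \<Rightarrow> complex" where
    "\<And>i w. w \<in> S \<Longrightarrow> (y i has_field_derivative (\<Sum>j\<in>UNIV. A i j w * y j w)) (at w)"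
    "\<And>i. y i w0 = y0 i"
proof -
  have prim: "\<exists>p. p w0 = 0 \<and> (\<forall>w\<in>S. (p has_field_derivative h w) (at w))"
    if h: "h holomorphic_on S" for h :: "complex \<Rightarrow> complex"
  proof -
    obtain q where q: "\<And>x. x \<in> S \<Longrightarrow> (q has_field_derivative h x) (at x within S)"
      using holomorphic_convex_primitive'[OF S(2,1) h] by blast
    have "((\<lambda>w. q w - q w0) has_field_derivative h x) (at x)" if "x \<in> S" for x
    proof -
      have "(q has_field_derivative h x) (at x)"
        using q[OF that] unfolding at_within_open[OF that S(1)] .
      from DERIV_diff[OF this DERIV_const[of "q w0"]] show ?thesis by simp
    qed
    then show ?thesis by (intro exI[of _ "\<lambda>w. q w - q w0"]) auto
  qed
  define I where "I = (\<lambda>h. SOME p. p w0 = 0 \<and> (\<forall>w\<in>S. (p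
    has_field_derivative (h w :: complex)) (at w)))"
  have I: "I h w0 = 0" "w \<in> S \<Longrightarrow> (I h has_field_derivative h w) (at w)"
    if "h holomorphic_on S" for h w
    using someI_ex[OF prim[OF that]] unfolding I_def by auto
  \<comment> \<open>\<open>Y n\<close> is the n-th increment of the iteration, not the n-th iterate;
    the solution is the sum over n.\<close>
  define Y where "Y = rec_nat (\<lambda>i w. y0 i) (\<lambda>n Yn i. I (\<lambda>w. \<Sum>j\<in>UNIV. A i j w * Yn j w))"
  have Y0: "Y 0 i w = y0 i" for i w by (simp add: Y_def)
  have YS: "Y (Suc n) i = I (\<lambda>w. \<Sum>j\<in>UNIV. A i j w * Y n j w)" for n i by (simp add: Y_def)
  have Yhol: "Y n i holomorphic_on S" for n i
  proof (induction n arbitrary: i)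
    case 0
    have "Y 0 i = (\<lambda>w. y0 i)" by (simp add: Y0 fun_eq_iff)
    then show ?case by simp
  next
    case (Suc n)
    have "(\<lambda>w. \<Sum>j\<in>UNIV. A i j w * Y n j w) holomorphic_on S"
      by (intro holomorphic_intros A Suc)
    then have "Y (Suc n) i field_differentiable at w" if "w \<in> S" for w
      unfolding YS using I(2) that field_differentiable_def by blast
    then show ?case
      using S(1) by (simp add: holomorphic_on_def field_differentiable_at_within)
  qed
  have hol: "(\<lambda>w. \<Sum>j\<in>UNIV. A i j w * Y n j w) holomorphic_on S" for n i
    by (intro holomorphic_intros A Yhol)
  define D where "D = (\<lambda>n i w. case n of 0 \<Rightarrow> 0 | Suc m \<Rightarrow> \<Sum>j\<in>UNIV. A i j w * Y m j w)"
  have YD: "(Y n i has_field_derivative D n i w) (at w)" if "w \<in> S" for n i w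
  proof (cases n)
    case 0
    have "Y 0 i = (\<lambda>w. y0 i)" by (simp add: Y0 fun_eq_iff)
    then show ?thesis by (simp add: 0 D_def)
  next
    case (Suc m)
    then show ?thesis using I(2)[OF hol that] by (simp add: D_def YS)
  qed
  have Yw0: "Y (Suc n) i w0 = 0" for n i
    unfolding YS by (rule I(1)[OF hol])
  define C where "C = (\<Sum>i\<in>UNIV. cmod (y0 i))"
  have C: "cmod (y0 i) \<le> C" for i
    unfolding C_def by (rule member_le_sum) auto
  have C0: "C \<ge> 0" unfolding C_def by (simp add: sum_nonneg)
  define k where "k = real CARD('n)"
  have loc: "\<exists>r>0. \<exists>d. ball w1 r \<subseteq> S \<and> (\<forall>w\<in>ball w1 r. \<forall>n i. cmod (Y n i w) \<le> C * d ^ n / fact n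
         \<and> cmod (D (Suc n) i w) \<le> d * (C * d ^ n / fact n))"
    if w1: "w1 \<in> S" for w1
  proof -
    obtain r where r: "r > 0" "cball w1 r \<subseteq> S" using S(1) w1 open_contains_cball by blast
    \<comment> \<open>Compact, so that \<open>A\<close> is bounded on it, and convex with
      \<open>w0\<close> inside, so that the segment from \<open>w0\<close> to any of its points
      stays where that bound holds.\<close>
    define K where "K = convex hull (insert w0 (cball w1 r))"
    have "compact K" unfolding K_def by (intro compact_convex_hull compact_insert) auto
    have "K \<subseteq> S" unfolding K_def using r w0 S(2) by (intro hull_minimal) auto
    have "\<exists>m. \<forall>w\<in>K. cmod (A i j w) \<le> m" for i j
    proof -
      have "continuous_on K (A i j)"
        using A[of i j] \<open>K \<subseteq> S\<close> holomorphic_on_imp_continuous_on continuous_on_subset by blast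
      then have "bounded (A i j ` K)" using \<open>compact K\<close>
        by (intro compact_imp_bounded compact_continuous_image)
      then show ?thesis by (auto simp: bounded_iff)
    qed
    then obtain m where m: "\<And>i j w. w \<in> K \<Longrightarrow> cmod (A i j w) \<le> m i j" by metis
    define M where "M = (\<Sum>i\<in>UNIV. \<Sum>j\<in>UNIV. \<bar>m i j\<bar>)"
    have M: "cmod (A i j w) \<le> M" if "w \<in> K" for i j w
    proof -
      have "cmod (A i j w) \<le> \<bar>m i j\<bar>" using m[OF that] abs_ge_self order_trans by blast
      also have "\<dots> \<le> (\<Sum>j\<in>UNIV. \<bar>m i j\<bar>)" by (rule member_le_sum) auto
      also have "\<dots> \<le> M" unfolding M_def by (rule member_le_sum) (auto intro: sum_nonneg)
      finally show ?thesis .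
    qed
    have M0: "M \<ge> 0" unfolding M_def by (intro sum_nonneg) auto
    have k0: "k \<ge> 0" by (simp add: k_def)
    have sumbd: "cmod (\<Sum>j\<in>UNIV. A i j w * Y n j w) \<le> k * M * b"
      if "w \<in> K" "\<And>j. cmod (Y n j w) \<le> b" for i w n b
    proof -
      have "cmod (\<Sum>j\<in>UNIV. A i j w * Y n j w) \<le> (\<Sum>j\<in>(UNIV::'n set). M * b)"
        using M[OF that(1)] that(2) M0
        by (intro sum_norm_le) (auto simp: norm_mult intro!: mult_mono)
      then show ?thesis by (simp add: k_def)
    qed
    have bound: "cmod (Y n i w) \<le> C * (k * M * cmod (w - w0)) ^ n / fact n" if "w \<in> K" for n i w
      using that
    proof (induction n arbitrary: i w)
      case 0
      then show ?case using C by (simp add: Y0)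
    next
      case (Suc n)
      define p where "p = (\<lambda>t. w0 + of_real t * (w - w0))"
      have pK: "p t \<in> K" if "0 \<le> t" "t \<le> 1" for t
      proof -
        have "p t = (1 - t) *\<^sub>R w0 + t *\<^sub>R w" by (simp add: p_def scaleR_conv_of_real algebra_simps)
        moreover have "w0 \<in> K" unfolding K_def by (intro hull_inc) auto
        moreover have "convex K" unfolding K_def by simp
        ultimately show ?thesis using Suc.prems that by (simp add: convex_alt)
      qed
      have der: "((\<lambda>t. Y (Suc n) i (p t)) has_vector_derivative (w
        - w0) * D (Suc n) i (p t)) (at t)"
        if "0 \<le> t" "t \<le> 1" for t
      proof -
        have "(p has_vector_derivative (w - w0)) (at t)"
          unfolding p_def by (auto intro!: derivative_eq_intros simp:
            has_vector_derivative_def scaleR_conv_of_real)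
        moreover have "(Y (Suc n) i has_field_derivative D (Suc n) i (p t)) (at (p t))"
          using YD pK[OF that] \<open>K \<subseteq> S\<close> by blast
        ultimately show ?thesis
          using field_vector_diff_chain_at[of p "w - w0" t "Y (Suc n) i" "D (Suc n) i (p t)"]
          by (simp add: o_def)
      qed
      \<comment> \<open>On the segment from \<open>w0\<close> to \<open>w\<close> the next term is
        compared with the real majorant B t^(n+1), whose derivative dominates by the induction
        hypothesis; at t = 1 this is the claim.\<close>
      define B where "B = C * (k * M * cmod (w - w0)) ^ Suc n / fact (Suc n)"
      have "norm (Y (Suc n) i (p 1) - Y (Suc n) i (p 0)) \<le> B * 1 ^ Suc n - B * 0 ^ Suc n"
      proof (rule differentiable_bound_general[where f = "\<lambda>t. Y (Suc n) i (p t)"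
            and \<phi> = "\<lambda>t. B * t ^ Suc n" and \<phi>' = "\<lambda>t. B * (real (Suc n) * t ^ n)"
            and f' = "\<lambda>t. (w - w0) * D (Suc n) i (p t)"])
        show "continuous_on {0..1} (\<lambda>t. Y (Suc n) i (p t))"
          by (intro continuous_at_imp_continuous_on ballI
            has_vector_derivative_continuous[OF der]) auto
        show "continuous_on {0..1} (\<lambda>t. B * t ^ Suc n)" by (intro continuous_intros)
        show "((\<lambda>t. B * t ^ Suc n) has_vector_derivative B * (real (Suc n) * t ^ n)) (at t)" for t
          unfolding has_real_derivative_iff_has_vector_derivative[symmetric]
          by (auto intro!: derivative_eq_intros simp del: power_Suc)
        fix t :: real assume t: "0 < t" "t < 1"
        have pt: "p t \<in> K" using pK t by simp
        have "cmod (p t - w0) = t * cmod (w - w0)" using t by (simp add: p_def norm_mult)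
        then have "cmod (Y n j (p t)) \<le> C * (k * M * (t * cmod (w - w0))) ^ n / fact n" for j
          using Suc.IH[OF pt, of j] by simp
        from sumbd[OF pt this] have "cmod (D (Suc n) i (p t))
          \<le> k * M * (C * (k * M * (t * cmod (w - w0))) ^ n / fact n)"
          by (simp add: D_def)
        then have "norm ((w - w0) * D (Suc n) i (p t))
            \<le> cmod (w - w0) * (k * M * (C * (k * M * (t * cmod (w - w0))) ^ n / fact n))"
          unfolding norm_mult by (intro mult_left_mono) auto
        also have "\<dots> = B * (real (Suc n) * t ^ n)"
          unfolding B_def fact_Suc power_Suc of_nat_mult
          by (simp add: power_mult_distrib divide_simps del: of_nat_Suc)
        finally show "norm ((w - w0) * D (Suc n) i (p t)) \<le> B * (real (Suc n) * t ^ n)" .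
      qed (use der in auto)
      moreover have "p 1 = w" "p 0 = w0" by (auto simp: p_def)
      ultimately show ?case using Yw0 by (simp add: B_def)
    qed
    obtain e where e: "\<And>w. w \<in> K \<Longrightarrow> cmod (w - w0) \<le> e"
    proof -
      have "bounded K" using \<open>compact K\<close> compact_imp_bounded by blast
      then obtain e where "\<And>x. x \<in> K \<Longrightarrow> dist w0 x \<le> e"
        using bounded_any_center[of K w0] by auto
      then show ?thesis using that by (metis dist_norm norm_minus_commute)
    qed
    have "w1 \<in> K" unfolding K_def using r by (intro hull_inc) auto
    then have e0: "e \<ge> 0" using e norm_ge_zero order_trans by blast
    \<comment> \<open>The factor \<open>max 1 e\<close> makes one constant serve twice: for the
      terms (k M e <= d) and for their derivatives (k M <= d).\<close>
    define d where "d = k * M * max 1 e"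
    have d: "k * M \<le> d" "k * M * e \<le> d" "d \<ge> 0"
      unfolding d_def using mult_left_mono[of 1 "max 1 e" "k * M"] mult_left_mono[of e "max 1 e"
        "k * M"] k0 M0
      by auto
    have Yb: "cmod (Y n i w) \<le> C * d ^ n / fact n" if "w \<in> K" for n i w
    proof -
      have "k * M * cmod (w - w0) \<le> d"
        using d e[OF that] k0 M0 by (meson mult_left_mono mult_nonneg_nonneg order_trans)
      then have "C * (k * M * cmod (w - w0)) ^ n / fact n \<le> C * d ^ n / fact n"
        using k0 M0 C0 by (intro divide_right_mono mult_left_mono power_mono) auto
      then show ?thesis using bound[OF that] order_trans by blast
    qed
    have Db: "cmod (D (Suc n) i w) \<le> d * (C * d ^ n / fact n)" if "w \<in> K" for n i w
    proof -
      have "cmod (D (Suc n) i w) \<le> k * M * (C * d ^ n / fact n)"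
        unfolding D_def using sumbd[OF that Yb[OF that]] by simp
      also have "\<dots> \<le> d * (C * d ^ n / fact n)"
        using d C0 by (intro mult_right_mono) auto
      finally show ?thesis .
    qed
    have "ball w1 r \<subseteq> K" unfolding K_def by (auto intro!: hull_inc)
    then show ?thesis using r Yb Db by (meson ball_subset_cball order_trans subsetD)
  qed
  have summ: "summable (\<lambda>n. C * d ^ n / fact n)" for d :: real
    using summable_mult[OF summable_exp[of d], of C] by (simp add: field_simps)
  define y where "y = (\<lambda>i w. \<Sum>n. Y n i w)"
  show thesis
  proof (rule that[of y])
    show "y i w0 = y0 i" for i
    proof -
      have "(\<lambda>n. Y n i w0) sums (\<Sum>n\<in>{0}. Y n i w0)"
        by (rule sums_finite) (use Yw0 in \<open>auto simp: gr0_conv_Suc elim: not0_implies_Suc dest!: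
          not0_implies_Suc\<close>)
      then show ?thesis by (simp add: y_def Y0 sums_iff)
    qed
    fix i w1 assume w1: "w1 \<in> S"
    obtain r d where r: "r > 0" "ball w1 r \<subseteq> S"
      and b: "\<And>w n i. w \<in> ball w1 r \<Longrightarrow> cmod (Y n i w) \<le> C * d ^ n / fact n"
        "\<And>w n i. w \<in> ball w1 r \<Longrightarrow> cmod (D (Suc n) i w) \<le> d * (C * d ^ n / fact n)"
      using loc[OF w1] by blast
    have sumY: "summable (\<lambda>n. Y n j w1)" for j
      by (rule summable_comparison_test'[OF summ[of d], of 0]) (use b(1) r in auto)
    have "uniformly_convergent_on (ball w1 r) (\<lambda>n w. \<Sum>m<n. D m i w)"
    proof (rule Weierstrass_m_test')
      show "norm (D n i w) \<le> (case n of 0 \<Rightarrow> 0 | Suc m \<Rightarrow> d * (C * d ^ m / fact m))"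
        if "w \<in> ball w1 r" for n w
        using b(2)[OF that] by (cases n) (auto simp: D_def)
      have "summable (\<lambda>m. d * (C * d ^ m / fact m))" by (intro summable_mult summ)
      then show "summable (\<lambda>n. case n of 0 \<Rightarrow> 0 | Suc m \<Rightarrow> d * (C * d ^ m / fact m))"
        by (subst summable_Suc_iff[symmetric]) simp
    qed
    then have "((\<lambda>x. \<Sum>n. Y n i x) has_field_derivative (\<Sum>n. D n i w1)) (at w1)"
    proof (rule has_field_derivative_series'(2)[rotated 2])
      show "summable (\<lambda>n. Y n i w1)" by (rule sumY)
      show "(Y n i has_field_derivative D n i x) (at x within ball w1 r)" if "x \<in> ball w1 r" for n x
        using YD r that by (meson has_field_derivative_at_within subsetD)
    qed (use r in auto)
    moreover have "(\<lambda>n. D (Suc n) i w1) sums (\<Sum>j\<in>UNIV. A i j w1 * y j w1)"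
      unfolding D_def y_def using sumY by (auto intro!: sums_sum sums_mult summable_sums)
    then have "(\<lambda>n. D n i w1) sums (\<Sum>j\<in>UNIV. A i j w1 * y j w1)"
      by (subst (asm) sums_Suc_iff) (simp add: D_def)
    ultimately show "(y i has_field_derivative (\<Sum>j\<in>UNIV. A i j w1 * y j w1)) (at w1)"
      unfolding y_def sums_iff by simp
  qed
qed

section \<open>Lorentzian and Hermitian algebra\<close>

lemma vector_4:
  "(vector [a, b, c, d] :: ('a::zero)^4) $ 1 = a"
  "(vector [a, b, c, d] :: ('a::zero)^4) $ 2 = b"
  "(vector [a, b, c, d] :: ('a::zero)^4) $ 3 = c"
  "(vector [a, b, c, d] :: ('a::zero)^4) $ 4 = d"
  unfolding vector_def by simp_all

lemma det_4:
  fixes A :: "'a::comm_ring_1^4^4"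
  shows "det A =
    A$1$1 * (A$2$2 * (A$3$3 * A$4$4 - A$3$4 * A$4$3) - A$2$3 * (A$3$2 * A$4$4 - A$3$4 * A$4$2)
             + A$2$4 * (A$3$2 * A$4$3 - A$3$3 * A$4$2)) -
    A$1$2 * (A$2$1 * (A$3$3 * A$4$4 - A$3$4 * A$4$3) - A$2$3 * (A$3$1 * A$4$4 - A$3$4 * A$4$1)
             + A$2$4 * (A$3$1 * A$4$3 - A$3$3 * A$4$1)) +
    A$1$3 * (A$2$1 * (A$3$2 * A$4$4 - A$3$4 * A$4$2) - A$2$2 * (A$3$1 * A$4$4 - A$3$4 * A$4$1)
             + A$2$4 * (A$3$1 * A$4$2 - A$3$2 * A$4$1)) -
    A$1$4 * (A$2$1 * (A$3$2 * A$4$3 - A$3$3 * A$4$2) - A$2$2 * (A$3$1 * A$4$3 - A$3$3 * A$4$1)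
             + A$2$3 * (A$3$1 * A$4$2 - A$3$2 * A$4$1))"
proof -
  have f1: "finite {2::4, 3, 4}" "1 \<notin> {2::4, 3, 4}" by auto
  have f2: "finite {3::4, 4}" "2 \<notin> {3::4, 4}" by auto
  have f3: "finite {4::4}" "3 \<notin> {4::4}" by auto
  show ?thesis
    unfolding det_def UNIV_4
    unfolding sum_over_permutations_insert[OF f1]
    unfolding sum_over_permutations_insert[OF f2]
    unfolding sum_over_permutations_insert[OF f3]
    unfolding permutes_sing
    by (simp add: sign_swap_id permutation_swap_id permutation_compose sign_compose sign_id
      swap_id_eq algebra_simps)
qed

text \<open>The triple cross product of Lorentz space. \<open>m i j k\<close> is the 3 by 3 minor of
  the rows \<open>u\<close>, \<open>v\<close>, \<open>x\<close> in the columns i, j, k; the signs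
  are the cofactor signs of a third row inserted between \<open>v\<close> and \<open>x\<close>, the
  first one flipped by the metric.\<close>

definition lorentz_cross :: "real^4 \<Rightarrow> real^4 \<Rightarrow> real^4 \<Rightarrow> real^4" where
  "lorentz_cross u v x =
    (let m = (\<lambda>i j k. u$i * (v$j * x$k - v$k * x$j) - u$j * (v$i * x$k - v$k * x$i)
                    + u$k * (v$i * x$j - v$j * x$i))
     in vector [- m 2 3 4, - m 1 3 4, m 1 2 4, - m 1 2 3])"

lemma lorentz_cross_det:
  "lorentz (lorentz_cross u v x) y = det (vector [u, v, y, x] :: real^4^4)"
  unfolding lorentz_def lorentz_cross_def Let_def det_4 vector_4 by (simp add: algebra_simps)

text \<open>Flipping the sign of the first coordinate of \<open>y\<close> turns Lorentz products
  into Euclidean ones, so the invertible matrix with rows \<open>u\<close>, \<open>v\<close>,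
  \<open>n\<close>, \<open>x\<close> annihilates the flipped vector. A vector can thus be identified
  by its products with a frame.\<close>

lemma lorentz_nondegenerate_frame:
  assumes d: "det (vector [u, v, n, x] :: real^4^4) \<noteq> 0"
    and 0: "lorentz y u = 0" "lorentz y v = 0" "lorentz y n = 0" "lorentz y x = 0"
  shows "y = 0"
proof -
  define A where "A = (vector [u, v, n, x] :: real^4^4)"
  define z where "z = (vector [- y$1, y$2, y$3, y$4] :: real^4)"
  have "A *v z = 0"
    using 0 unfolding A_def z_def lorentz_def
    by (simp add: vec_eq_iff forall_4 matrix_vector_mult_def sum_4 vector_4 algebra_simps)
  moreover obtain B where "B ** A = mat 1"
    using d invertible_det_nz[of A] unfolding A_def invertible_def by blast
  ultimately have "z = 0"
    by (metis matrix_vector_mul_assoc matrix_vector_mul_lid matrix_vector_mult_0_right)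
  then show ?thesis by (simp add: z_def vec_eq_iff forall_4 vector_4)
qed

text \<open>Determinant of the Gram matrix A J A^T, which is diagonal for an orthogonal frame; the
  minus sign is det J.\<close>

lemma lorentz_frame_det_square:
  assumes "lorentz u v = 0" "lorentz u n = 0" "lorentz u x = 0"
    "lorentz v n = 0" "lorentz v x = 0" "lorentz n x = 0"
  shows "(det (vector [u, v, n, x] :: real^4^4))\<^sup>2
     = - (lorentz u u * lorentz v v * lorentz n n * lorentz x x)"
proof -
  define A where "A = (vector [u, v, n, x] :: real^4^4)"
  define J where "J = (vector [vector [-1,0,0,0], vector [0,1,0,0], vector [0,0,1,0], vector
    [0,0,0,1]] :: real^4^4)"
  define G where "G = (vector [vector [lorentz u u,0,0,0], vector [0,lorentz v v,0,0],
     vector [0,0,lorentz n n,0], vector [0,0,0,lorentz x x]] :: real^4^4)"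
  have "A ** J ** transpose A = G"
    using assms unfolding A_def J_def G_def lorentz_def
    by (simp add: vec_eq_iff forall_4 matrix_matrix_mult_def sum_4 vector_4 transpose_def
      algebra_simps)
  then have "det A * det J * det A = det G"
    by (metis det_mul det_transpose)
  moreover have "det J = -1" unfolding J_def det_4 vector_4 by simp
  moreover have "det G = lorentz u u * lorentz v v * lorentz n n * lorentz x x"
    unfolding G_def det_4 vector_4 by simp
  ultimately show ?thesis by (simp add: A_def power2_eq_square)
qed

lemma lorentz_commute: "lorentz x y = lorentz y x"
  by (simp add: lorentz_def mult.commute)

lemma lorentz_simps:
  "lorentz (x + y) z = lorentz x z + lorentz y z"
  "lorentz (x - y) z = lorentz x z - lorentz y z"
  "lorentz (k *\<^sub>R x) z = k * lorentz x z"
  "lorentz z (x + y) = lorentz z x + lorentz z y"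
  "lorentz z (k *\<^sub>R x) = k * lorentz z x"
  by (simp_all add: lorentz_def algebra_simps)

text \<open>
  The unit normal \<open>n\<close> is eliminated in favour of the cross product, so that the resulting equation
  makes sense, and holds by continuity, also where the metric degenerates.
\<close>

lemma cmc1_laplacian:
  assumes n: "lorentz n n = -1" "lorentz n x = 0" "lorentz n u = 0" "lorentz n v = 0"
    and d: "det (vector [u, v, n, x] :: real^4^4) > 0"
    and x: "lorentz x x = 1" "lorentz u x = 0" "lorentz v x = 0"
    and c: "lorentz u u = c" "lorentz v v = c" "lorentz u v = 0" "c > 0"
    and L: "lorentz L u = 0" "lorentz L v = 0" "lorentz L x = - 2 * c" "lorentz L n = 2 * c"
  shows "L = (- 2 * c) *\<^sub>R x + 2 *\<^sub>R lorentz_cross u v x"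
proof -
  \<comment> \<open>The products of the frame vectors with themselves are c, c, -1, 1. The
    orientation condition then selects the root \<open>c\<close>, which fixes the sign of the cross
    product in the conclusion.\<close>
  have "(det (vector [u, v, n, x] :: real^4^4))\<^sup>2 = c\<^sup>2"
    using lorentz_frame_det_square[of u v n x] n x c by (simp add: lorentz_commute power2_eq_square)
  then have dc: "det (vector [u, v, n, x] :: real^4^4) = c"
    using d c by (simp add: power2_eq_iff)
  have "lorentz (lorentz_cross u v x) u = 0" "lorentz (lorentz_cross u v x) v = 0"
       "lorentz (lorentz_cross u v x) x = 0"
    unfolding lorentz_cross_det det_4 vector_4 by (simp_all add: algebra_simps)
  moreover have xs: "lorentz x u = 0" "lorentz x v = 0" "lorentz x n = 0"
    using x(2,3) n(2) lorentz_commute by metis+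
  ultimately have "L + (2 * c) *\<^sub>R x - 2 *\<^sub>R lorentz_cross u v x = 0"
    using n x c L dc lorentz_cross_det[of u v x n]
      xs by (intro lorentz_nondegenerate_frame[of u v n x]) (simp_all add: lorentz_simps)
  then show ?thesis by (simp add: algebra_simps)
qed

text \<open>For 2 by 2 matrices the adjugate is linear, unlike the inverse, so it can be
  differentiated and polarised termwise. It is the inverse when the determinant is 1, and minus the
  inverse on de Sitter space, where the determinant is -1.\<close>

definition adjugate :: "complex^2^2 \<Rightarrow> complex^2^2" where
  "adjugate A = vector [vector [A$2$2, - A$1$2], vector [- A$2$1, A$1$1]]"

definition cscale :: "complex \<Rightarrow> complex^2^2 \<Rightarrow> complex^2^2" where
  "cscale k A = (\<chi> i j. k * A$i$j)"

lemmas mat2_defs = vec_eq_iff forall_2 matrix_matrix_mult_def sum_2 vector_2 det_2 adjugate_def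
  cscale_def
  herm_def hconj_def e3_def mat_def

lemma adjugate_mult: "A ** adjugate A = mat (det A)" "adjugate A ** A = mat (det A)"
  by (simp_all add: mat2_defs algebra_simps)

lemma matrix_inv_adjugate: "det A = 1 \<Longrightarrow> matrix_inv A = adjugate A"
  using adjugate_mult[of A] unfolding matrix_inv_def
  by (intro some_equality) (metis matrix_mul_assoc matrix_mul_lid matrix_mul_rid)+

lemma det_herm: "det (herm x) = - of_real (lorentz x x)"
  unfolding lorentz_def by (simp add: mat2_defs complex_eq_iff algebra_simps)

lemma de_sitter_lorentz: "x \<in> de_sitter \<longleftrightarrow> lorentz x x = 1"
  unfolding de_sitter_def det_herm
  by (metis (mono_tags) mem_Collect_eq neg_equal_iff_equal of_real_1 of_real_eq_iff)

text \<open>Polarisation of X adj(X) = det X. For \<open>u\<close> tangent to de Sitter space at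
  \<open>x\<close> the right side vanishes, so adjugates can be moved from one factor to the other
  at the cost of a sign.\<close>

lemma herm_adjugate_polar: "herm u ** adjugate (herm x) + herm x ** adjugate (herm u)
  = mat (of_real (- 2 * lorentz u x))"
  unfolding lorentz_def by (simp add: mat2_defs complex_eq_iff algebra_simps)

text \<open>The matrix form of the cross product; through it the Laplace equation becomes an
  identity between 2 by 2 matrices.\<close>

lemma herm_lorentz_cross:
  "2 *\<^sub>R herm (lorentz_cross u v x) =
     cscale (-\<i>) (herm u ** adjugate (herm x) ** herm v - herm v ** adjugate (herm x) ** herm u)"
  unfolding lorentz_cross_def Let_def
  by (simp add: mat2_defs vector_4 complex_eq_iff algebra_simps)

lemma cscale_simps:
  "cscale k A ** B = cscale k (A ** B)" "A ** cscale k B = cscale k (A ** B)"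
  "cscale k (A + B) = cscale k A + cscale k B" "cscale k (A - B) = cscale k A - cscale k B"
  "cscale k (cscale l A) = cscale (k * l) A" "cscale 1 A = A" "cscale k (- A) = - cscale k A"
  "cscale (k + l) A = cscale k A + cscale l A" "cscale 0 A = 0" "cscale k 0 = 0" "cscale (- k) A
    = - cscale k A"
  by (simp_all add: mat2_defs algebra_simps)

lemma adjugate_simps:
  "adjugate (A + B) = adjugate A + adjugate B" "adjugate (A - B)
    = adjugate A - adjugate B" "adjugate (cscale k A) = cscale k (adjugate A)"
  "adjugate (A ** B) = adjugate B ** adjugate A" "adjugate (- A) = - adjugate A"
  by (simp_all add: mat2_defs algebra_simps)

lemma herm_simps:
  "herm (x + y) = herm x + herm y" "herm (x - y) = herm x - herm y" "herm (k *\<^sub>R x)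
    = cscale (of_real k) (herm x)"
  by (simp_all add: mat2_defs algebra_simps)

lemma hconj_simps:
  "hconj (A ** B) = hconj B ** hconj A" "hconj (A + B) = hconj A + hconj B"
  "hconj (cscale k A) = cscale (cnj k) (hconj A)" "hconj (hconj A) = A" "hconj (herm x)
    = herm x" "hconj e3 = e3"
  "hconj (- A) = - hconj A" "hconj (adjugate A) = adjugate (hconj A)" "det (hconj A) = cnj (det A)"
  by (simp_all add: mat2_defs algebra_simps)

lemma mat2_mult_simps:
  fixes A B C :: "complex^2^2"
  shows "(A + B) ** C = A ** C + B ** C" "(A - B) ** C = A ** C - B ** C" "(- A) ** C = - (A ** C)"
   "A ** (B + C) = A ** B + A ** C" "A ** (B - C) = A ** B - A ** C" "A ** (- C) = - (A ** C)"
   "(A ** B) ** C = A ** (B ** C)" "mat k ** A = cscale k A" "A ** mat k = cscale k A"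
  by (simp_all add: mat2_defs algebra_simps)

text \<open>With \<open>L\<close> the Laplacian of f and \<open>u\<close>, \<open>v\<close> its
  first derivatives, the left side is four times the derivative of X_z adj(X) with respect to cnj z.
  The position term of \<open>L\<close> cancels U adj(U) + V adj(V), and the cross product cancels
  the mixed products. For mean curvature H the cross product would carry the factor H, so this
  second cancellation is exactly where H = 1 is used.\<close>

lemma dbar_identity:
  assumes x: "lorentz x x = 1" "lorentz u x = 0" "lorentz v x = 0"
    and c: "lorentz u u = c" "lorentz v v = c"
    and L: "L = (- 2 * c) *\<^sub>R x + 2 *\<^sub>R lorentz_cross u v x"
  shows "herm L ** adjugate (herm x) + (herm u - cscale \<i> (herm v)) ** adjugate (herm u
    + cscale \<i> (herm v)) = 0"
proof -
  define X U V where "X = herm x" and "U = herm u" and "V = herm v"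
  have XX: "X ** adjugate X = cscale (-1) (mat 1)" "adjugate X ** X = cscale (-1) (mat 1)"
    unfolding adjugate_mult X_def det_herm x by (simp_all add: mat2_defs)
  have UX: "U ** adjugate X = - (X ** adjugate U)" and VX: "V ** adjugate X = - (X ** adjugate V)"
    using herm_adjugate_polar[of u x] herm_adjugate_polar[of v x] x
    by (auto simp: X_def U_def V_def eq_neg_iff_add_eq_0 mat_0)
  have UU: "U ** adjugate U = cscale (- of_real c) (mat 1)" "V ** adjugate V
    = cscale (- of_real c) (mat 1)"
    unfolding adjugate_mult U_def V_def det_herm c by (simp_all add: mat2_defs)
  \<comment> \<open>The right-hand \<open>adjugate X\<close> is moved past \<open>V\<close> by
    tangency; it then meets \<open>X\<close> and disappears because \<open>adjugate X ** X\<close>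
    is -1.\<close>
  have UXV: "U ** adjugate X ** V ** adjugate X = U ** adjugate V"
  proof -
    have "U ** adjugate X ** V ** adjugate X = U ** adjugate X ** (V ** adjugate X)"
      by (simp only: matrix_mul_assoc)
    also have "\<dots> = - (U ** (adjugate X ** X) ** adjugate V)" unfolding VX
      by (simp add: mat2_mult_simps)
    finally show ?thesis unfolding XX by (simp add: mat2_mult_simps cscale_simps)
  qed
  have VXU: "V ** adjugate X ** U ** adjugate X = V ** adjugate U"
  proof -
    have "V ** adjugate X ** U ** adjugate X = V ** adjugate X ** (U ** adjugate X)"
      by (simp only: matrix_mul_assoc)
    also have "\<dots> = - (V ** (adjugate X ** X) ** adjugate U)" unfolding UX
      by (simp add: mat2_mult_simps)
    finally show ?thesis unfolding XX by (simp add: mat2_mult_simps cscale_simps)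
  qed
  have "herm L = cscale (- 2 * of_real c) X + cscale (-\<i>) (U ** adjugate X ** V
    - V ** adjugate X ** U)"
    unfolding L herm_simps X_def U_def V_def
    using herm_lorentz_cross[of u v x] by (simp add: mat2_defs scaleR_conv_of_real)
  then have "herm L ** adjugate X = cscale (- 2 * of_real c) (X ** adjugate X)
      + cscale (-\<i>) (U ** adjugate X ** V ** adjugate X - V ** adjugate X ** U ** adjugate X)"
    by (simp add: mat2_mult_simps cscale_simps)
  then have 1: "herm L ** adjugate X = cscale (2 * of_real c) (mat 1)
    + cscale (-\<i>) (U ** adjugate V - V ** adjugate U)"
    unfolding UXV VXU XX by (simp add: cscale_simps)
  have 2: "(U - cscale \<i> V) ** adjugate (U + cscale \<i> V)
    = U ** adjugate U + V ** adjugate V + cscale \<i> (U ** adjugate V - V ** adjugate U)"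
    by (simp add: mat2_mult_simps cscale_simps adjugate_simps)
  show ?thesis unfolding X_def[symmetric] U_def[symmetric] V_def[symmetric] 1 2 UU
    by (simp add: mat2_defs)
qed

section \<open>Holomorphy of the logarithmic derivative\<close>

lemma has_derivative_vecI:
  fixes F :: "'a::real_normed_vector \<Rightarrow> 'b::euclidean_space^'n"
  assumes "\<And>i. ((\<lambda>w. F w $ i) has_derivative (\<lambda>h. D h $ i)) (at x within S)"
  shows "(F has_derivative D) (at x within S)"
  unfolding has_derivative_componentwise_within[of F]
proof
  fix b :: "'b^'n" assume "b \<in> Basis"
  then obtain i u where b: "b = axis i u" by (auto simp: Basis_vec_def)
  show "((\<lambda>x. F x \<bullet> b) has_derivative (\<lambda>x. D x \<bullet> b)) (at x within S)"
    unfolding b inner_axis by (intro has_derivative_inner_left assms)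
qed

lemma bounded_bilinear_matrix_mult2:
  "bounded_bilinear ((**) :: complex^2^2 \<Rightarrow> complex^2^2 \<Rightarrow> complex^2^2)"
  unfolding bilinear_conv_bounded_bilinear[symmetric] bilinear_def
  by (auto intro!: linearI simp: mat2_defs algebra_simps)

lemmas has_derivative_matrix_mult2 = bounded_bilinear.FDERIV[OF bounded_bilinear_matrix_mult2]

lemma bounded_linear_mat2_maps:
  "bounded_linear herm" "bounded_linear (cscale k)" "bounded_linear adjugate" "bounded_linear hconj"
  "bounded_linear (\<lambda>h. cscale h A)"
  unfolding linear_conv_bounded_linear[symmetric]
  by (auto intro!: linearI simp: mat2_defs distrib_left distrib_right)
     (auto simp: scaleR_conv_of_real algebra_simps)

lemmas has_derivative_mat2 [derivative_intros] =
  bounded_linear_mat2_maps[THEN bounded_linear.has_derivative]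

lemma bounded_bilinear_lorentz: "bounded_bilinear lorentz"
  unfolding bilinear_conv_bounded_bilinear[symmetric] bilinear_def
  by (auto intro!: linearI simp: lorentz_simps)

lemmas has_derivative_lorentz = bounded_bilinear.FDERIV[OF bounded_bilinear_lorentz]

lemma has_derivative_pd:
  assumes "f differentiable (at z)"
  shows "(f has_derivative (\<lambda>h. Re h *\<^sub>R pd 1 f z + Im h *\<^sub>R pd 2 f z)) (at z)"
proof -
  have lin: "linear (frechet_derivative f (at z))" using assms linear_frechet_derivative by blast
  have "frechet_derivative f (at z) h = Re h *\<^sub>R pd 1 f z + Im h *\<^sub>R pd 2 f z" for h
  proof -
    have "h = Re h *\<^sub>R 1 + Im h *\<^sub>R \<i>" by (simp add: complex_eq_iff)
    then have "frechet_derivative f (at z) h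
      = frechet_derivative f (at z) (Re h *\<^sub>R 1 + Im h *\<^sub>R \<i>)"
      by simp
    then show ?thesis using lin by (simp add: linear_add linear_scale pd_def coord_vec_def)
  qed
  then show ?thesis using assms frechet_derivative_works by (metis (no_types, lifting) ext)
qed

text \<open>Used to differentiate orthogonality relations that hold on an open set.\<close>

lemma has_derivative_const_open_zero:
  assumes "open S" "z \<in> S" "\<And>w. w \<in> S \<Longrightarrow> \<phi> w = k" "(\<phi> has_derivative D) (at z)"
  shows "D h = 0"
proof -
  have "(\<phi> has_derivative (\<lambda>_. 0)) (at z)"
    by (rule has_derivative_transform_within_open[of "\<lambda>_. k" _ _ _ S]) (use assms in auto)
  then have "D = (\<lambda>_. 0)" using assms(4) has_derivative_unique by blast
  then show ?thesis by simp
qed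

text \<open>The mixed second difference over a square of side h is h^2 times the second derivative
  up to o(h^2). Only differentiability at \<open>z\<close> of the derivative in direction
  \<open>a\<close> is used: it gives the first order expansion of that derivative, and the mean
  value inequality along \<open>a\<close> does the rest.\<close>

lemma second_difference_bound:
  fixes f :: "complex \<Rightarrow> 'a::real_normed_vector"
  assumes M: "open M" "z \<in> M" and f: "\<And>w. w \<in> M \<Longrightarrow> f differentiable (at w)"
    and G: "((\<lambda>w. frechet_derivative f (at w) a) has_derivative G) (at z)"
    and ab: "cmod a = 1" "cmod b = 1" and e: "e > 0"
  shows "\<exists>\<delta>>0. \<forall>h. 0 < h \<and> h < \<delta> \<longrightarrow>
     norm (f (z + of_real h * a + of_real h * b) - f (z + of_real h * a) - f (z + of_real h * b)
       + f z
           - (h * h) *\<^sub>R G b) \<le> e * (h * h)"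
proof -
  define g where "g = (\<lambda>w. frechet_derivative f (at w) a)"
  have lin: "linear G" using G has_derivative_linear by blast
  obtain d1 where d1: "d1 > 0"
    "\<And>y. norm (y - z) < d1 \<Longrightarrow> norm (g y - g z - G (y - z)) \<le> e / 3 * norm (y - z)"
    using G e unfolding has_derivative_at_alt g_def by (metis divide_pos_pos zero_less_numeral)
  obtain d2 where d2: "d2 > 0" "ball z d2 \<subseteq> M" using M open_contains_ball by blast
  \<comment> \<open>Half of the smaller radius, because the corners of the square lie within 2 h of
    \<open>z\<close>.\<close>
  define \<delta> where "\<delta> = min d1 d2 / 2"
  have "\<delta> > 0" using d1 d2 by (simp add: \<delta>_def)
  moreover have "norm (f (z + of_real h * a + of_real h * b) - f (z + of_real h * a) - f (z
    + of_real h * b) + f z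
           - (h * h) *\<^sub>R G b) \<le> e * (h * h)" if h: "0 < h" "h < \<delta>" for h
  proof -
    \<comment> \<open>The difference in direction \<open>b\<close>, followed along \<open>a\<close>
      and corrected by its expected linear growth. Its derivative is at most (e / 3) (2 h) + (e / 3)
      h = e h.\<close>
    define \<phi> where "\<phi> = (\<lambda>s::real. f (z + of_real s * a + of_real h * b) - f (z + of_real s * a)
      - s *\<^sub>R (h *\<^sub>R G b))"
    have n1: "cmod (of_real s * a + of_real h * b) \<le> 2 * h" if "0 \<le> s" "s \<le> h" for s
      using norm_triangle_ineq[of "of_real s * a" "of_real h * b"] that h ab
        by (simp add: norm_mult)
    have n2: "cmod (of_real s * a) \<le> h" if "0 \<le> s" "s \<le> h" for s
      using that ab by (simp add: norm_mult)
    have in1: "z + of_real s * a + of_real h * b \<in> M" "z + of_real s * a \<in> M" if "0 \<le> s" "s \<le> h"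
      for s
    proof -
      have "dist (z + (of_real s * a + of_real h * b)) z < d2" "dist (z + of_real s * a) z < d2"
        using n1[OF that] n2[OF that] h by (auto simp: \<delta>_def dist_norm)
      then show "z + of_real s * a + of_real h * b \<in> M" "z + of_real s * a \<in> M"
        using d2(2) by (auto simp: add.assoc dist_commute)
    qed
    have fd: "((\<lambda>s::real. f (z + of_real s * a + k))
      has_vector_derivative g (z + of_real s * a + k)) (at s)"
      if "z + of_real s * a + k \<in> M" for s k
    proof -
      have 1: "((\<lambda>s::real. z + of_real s * a + k) has_derivative (\<lambda>t. of_real t * a)) (at s)"
        by (auto intro!: derivative_eq_intros)
      have 2: "(f has_derivative frechet_derivative f (at (z + of_real s * a + k))) (at (z
        + of_real s * a + k))"
        using f[OF that] frechet_derivative_works by blast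
      have "((\<lambda>s::real. f (z + of_real s * a + k)) has_derivative
          (\<lambda>t. frechet_derivative f (at (z + of_real s * a + k)) (of_real t * a))) (at s)"
        using diff_chain_at[OF 1 2] by (simp add: o_def)
      moreover have "frechet_derivative f (at w) (of_real t * a) = t *\<^sub>R g w" if "w \<in> M" for w t
        using linear_scale[OF linear_frechet_derivative[OF f[OF that]], of t a]
        by (simp add: g_def scaleR_conv_of_real)
      ultimately show ?thesis using that by (simp add: has_vector_derivative_def)
    qed
    have der: "(\<phi> has_vector_derivative
        g (z + of_real s * a + of_real h * b) - g (z + of_real s * a) - h *\<^sub>R G b) (at s)"
      if "0 \<le> s" "s \<le> h" for s
      unfolding \<phi>_def using fd[OF in1(1)[OF that]] fd[of s 0] in1(2)[OF that]
      by (auto intro!: has_vector_derivative_diff) (auto intro!: derivative_eq_intros simp: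
        has_vector_derivative_def)
    have "norm (\<phi> h - \<phi> 0) \<le> (e * h) * h - (e * h) * 0"
    proof (rule differentiable_bound_general[where \<phi>' = "\<lambda>_. e * h"])
      show "continuous_on {0..h} \<phi>"
        by (intro continuous_at_imp_continuous_on ballI
          has_vector_derivative_continuous[OF der]) auto
      show "(\<phi> has_vector_derivative g (z + of_real s * a + of_real h * b) - g (z + of_real s * a)
        - h *\<^sub>R G b) (at s)"
        if "0 < s" "s < h" for s using der that by simp
      show "((*) (e * h) has_vector_derivative e * h) (at s)" for s
        by (auto intro!: derivative_eq_intros simp: has_vector_derivative_def)
      fix s assume s: "0 < s" "s < h"
      let ?k1 = "of_real s * a + of_real h * b" and ?k2 = "of_real s * a"
      have b1: "norm (g (z + ?k1) - g z - G ?k1) \<le> e / 3 * cmod ?k1"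
        using d1(2)[of "z + ?k1"] n1[of s] s h d1 by (simp add: \<delta>_def)
      have b2: "norm (g (z + ?k2) - g z - G ?k2) \<le> e / 3 * cmod ?k2"
        using d1(2)[of "z + ?k2"] n2[of s] s h d1 by (simp add: \<delta>_def)
      have "G ?k1 - G ?k2 = h *\<^sub>R G b"
      proof -
        have "G ?k1 = G ?k2 + G (of_real h * b)" by (rule linear_add[OF lin])
        also have "G (of_real h * b) = h *\<^sub>R G b"
          using linear_scale[OF lin, of h b] by (simp add: scaleR_conv_of_real)
        finally show ?thesis by simp
      qed
      then have "g (z + ?k1) - g (z + ?k2) - h *\<^sub>R G b
          = (g (z + ?k1) - g z - G ?k1) - (g (z + ?k2) - g z - G ?k2)" by (simp add: algebra_simps)
      then have "norm (g (z + ?k1) - g (z + ?k2) - h *\<^sub>R G b) \<le> e / 3 * cmod ?k1 + e / 3 * cmod ?k2"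
        using b1 b2 norm_triangle_ineq4 by (smt (verit))
      also have "\<dots> \<le> e / 3 * (2 * h) + e / 3 * h"
        using n1[of s] n2[of s] s e by (intro add_mono mult_left_mono) auto
      also have "\<dots> = e * h" by simp
      finally show "norm (g (z + of_real s * a + of_real h * b) - g (z + of_real s * a)
        - h *\<^sub>R G b) \<le> e * h"
        by (simp add: add.assoc)
    qed (use h in \<open>auto intro!: continuous_intros\<close>)
    moreover have "\<phi> h - \<phi> 0 = f (z + of_real h * a + of_real h * b) - f (z + of_real h * a)
      - f (z + of_real h * b) + f z
           - (h * h) *\<^sub>R G b"
      by (simp add: \<phi>_def algebra_simps)
    ultimately show ?thesis by (simp add: mult.assoc)
  qed
  ultimately show ?thesis by blast
qed

text \<open>Both mixed derivatives approximate the same second difference \<open>P\<close>, since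
  \<open>P\<close> is symmetric in the two directions. With \<open>e\<close> a quarter of their
  distance, they would be at most 2 \<open>e\<close> apart instead of 4 \<open>e\<close>.\<close>

lemma pd_commute:
  fixes f :: "complex \<Rightarrow> 'a::real_normed_vector"
  assumes M: "open M" "z \<in> M" and f: "\<And>w. w \<in> M \<Longrightarrow> f differentiable (at w)"
    and pf: "\<And>i. pd i f differentiable (at z)"
  shows "pd 1 (pd 2 f) z = pd 2 (pd 1 f) z"
proof (rule ccontr)
  assume ne: "pd 1 (pd 2 f) z \<noteq> pd 2 (pd 1 f) z"
  define e where "e = norm (pd 1 (pd 2 f) z - pd 2 (pd 1 f) z) / 4"
  have e: "e > 0" using ne by (simp add: e_def)
  have D: "((\<lambda>w. frechet_derivative f (at w) (coord_vec i))
    has_derivative frechet_derivative (pd i f) (at z)) (at z)" for i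
    using pf[of i] unfolding frechet_derivative_works by (simp add: pd_def[abs_def])
  obtain d1 where d1: "d1 > 0" "\<And>h. 0 < h \<and> h < d1 \<Longrightarrow>
     norm (f (z + of_real h * 1 + of_real h * \<i>) - f (z + of_real h * 1) - f (z + of_real h * \<i>)
       + f z
           - (h * h) *\<^sub>R pd 2 (pd 1 f) z) \<le> e * (h * h)"
    using second_difference_bound[OF M f D[of 1], of \<i> e] e by (auto simp: coord_vec_def pd_def)
  obtain d2 where d2: "d2 > 0" "\<And>h. 0 < h \<and> h < d2 \<Longrightarrow>
     norm (f (z + of_real h * \<i> + of_real h * 1) - f (z + of_real h * \<i>) - f (z + of_real h * 1)
       + f z
           - (h * h) *\<^sub>R pd 1 (pd 2 f) z) \<le> e * (h * h)"
    using second_difference_bound[OF M f D[of 2], of 1 e] e by (auto simp: coord_vec_def pd_def)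
  define h where "h = min d1 d2 / 2"
  have h: "0 < h" "h < d1" "h < d2" using d1(1) d2(1) by (auto simp: h_def)
  define P where "P = f (z + of_real h * 1 + of_real h * \<i>) - f (z + of_real h * 1) - f (z
    + of_real h * \<i>) + f z"
  have "norm (P - (h * h) *\<^sub>R pd 2 (pd 1 f) z) \<le> e * (h * h)" using d1(2)[of h] h
    by (simp add: P_def)
  moreover have "norm (P - (h * h) *\<^sub>R pd 1 (pd 2 f) z) \<le> e * (h * h)"
    using d2(2)[of h] h by (simp add: P_def algebra_simps)
  ultimately have "norm ((P - (h * h) *\<^sub>R pd 2 (pd 1 f) z) - (P - (h * h) *\<^sub>R pd 1 (pd 2 f) z))
    \<le> e * (h * h) + e * (h * h)"
    using norm_triangle_ineq4 by (smt (verit))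
  moreover have "(P - (h * h) *\<^sub>R pd 2 (pd 1 f) z) - (P - (h * h) *\<^sub>R pd 1 (pd 2 f) z)
      = (h * h) *\<^sub>R (pd 1 (pd 2 f) z - pd 2 (pd 1 f) z)" by (simp add: algebra_simps)
  ultimately have "norm ((h * h) *\<^sub>R (pd 1 (pd 2 f) z - pd 2 (pd 1 f) z))
    \<le> e * (h * h) + e * (h * h)"
    by simp
  then have "(h * h) * norm (pd 1 (pd 2 f) z - pd 2 (pd 1 f) z) \<le> (h * h) * (2 * e)"
    using h by (simp only: norm_scaleR) (simp add: mult_ac)
  then have "norm (pd 1 (pd 2 f) z - pd 2 (pd 1 f) z) \<le> 2 * e"
    using h by (simp add: mult_le_cancel_left)
  then show False using e by (simp add: e_def)
qed

text \<open>Carries identities from the regular points across the singular ones.\<close>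

lemma continuous_on_dense_eq:
  fixes \<phi> \<psi> :: "'a::metric_space \<Rightarrow> 'b::t2_space"
  assumes c: "continuous_on M \<phi>" "continuous_on M \<psi>" and W: "W \<subseteq> M" "M \<subseteq> closure W"
    and eq: "\<And>w. w \<in> W \<Longrightarrow> \<phi> w = \<psi> w" and z: "z \<in> M"
  shows "\<phi> z = \<psi> z"
proof -
  obtain s where s: "\<And>n. s n \<in> W" "s \<longlonglongrightarrow> z" using z W(2) closure_sequential by blast
  have "(\<lambda>n. \<phi> (s n)) \<longlonglongrightarrow> \<phi> z" "(\<lambda>n. \<psi> (s n)) \<longlonglongrightarrow> \<psi> z"
    using continuous_on_tendsto_compose[OF c(1) s(2) z] continuous_on_tendsto_compose[OF c(2) s(2)
      z] s(1) W(1)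
    by (auto simp: eventually_sequentiallyI subset_iff)
  moreover have "(\<lambda>n. \<phi> (s n)) = (\<lambda>n. \<psi> (s n))" using eq s(1) by auto
  ultimately show ?thesis using LIMSEQ_unique by metis
qed

section \<open>Differential equations satisfied by a CMC-1 face\<close>

lemma cmc1_face_smooth:
  assumes "cmc1_face M f"
  shows "open M" "z \<in> M \<Longrightarrow> f differentiable (at z)" "z \<in> M \<Longrightarrow> pd i f differentiable (at z)"
    "continuous_on M f" "continuous_on M (pd i f)" "continuous_on M (pd i (pd j f))"
    "z \<in> M \<Longrightarrow> lorentz (f z) (f z) = 1" "z \<in> M \<Longrightarrow> pd 1 (pd 2 f) z = pd 2 (pd 1 f) z"
proof -
  show op: "open M" using assms by (simp add: cmc1_face_def)
  have "smooth_map_on M f" using assms by (simp add: cmc1_face_def)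
  then have *: "Ck_on (Suc 0) M f" "Ck_on (Suc (Suc 0)) M f" "Ck_on 0 M f"
    unfolding smooth_map_on_def by blast+
  show d: "f differentiable (at z)" if "z \<in> M" for z using * that by simp
  show d2: "pd i f differentiable (at z)" if "z \<in> M" for z i using * that by simp
  show "continuous_on M f" using * by simp
  show "continuous_on M (pd i f)" using *(1) by simp
  show "continuous_on M (pd i (pd j f))" using *(2) by simp
  show "z \<in> M \<Longrightarrow> lorentz (f z) (f z) = 1"
    using assms unfolding cmc1_face_def by (metis de_sitter_lorentz image_subset_iff)
  show "z \<in> M \<Longrightarrow> pd 1 (pd 2 f) z = pd 2 (pd 1 f) z"
    using pd_commute[OF op] d d2 by blast
qed

lemma ds2_nth: "ds2 f z $ i $ j = lorentz (pd i f z) (pd j f z)"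
  by (simp add: ds2_def induced_def pd_def)

lemma pos_def_det_nonzero: "pos_def A \<Longrightarrow> det A \<noteq> 0"
proof
  assume A: "pos_def A" "det A = 0"
  then obtain v where "v \<noteq> 0" "A *v v = 0"
    by (metis invertible_det_nz invertible_left_inverse matrix_left_invertible_ker)
  then show False using A(1) unfolding pos_def_def by (metis inner_zero_right less_irrefl)
qed

lemma matrix_inv_mat2: "c \<noteq> 0 \<Longrightarrow> matrix_inv (mat c :: real^2^2) = mat (1 / c)"
  unfolding matrix_inv_def
proof (rule some_equality)
  assume c: "c \<noteq> 0"
  have "(mat c :: real^2^2) ** mat (1 / c) = mat 1" "mat (1 / c) ** (mat c :: real^2^2) = mat 1"
    using c by (simp_all add: mat2_defs)
  then show "(mat c :: real^2^2) ** mat (1 / c) = mat 1 \<and> mat (1 / c) ** (mat c :: real^2^2)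
    = mat 1" by simp
  fix A' :: "real^2^2" assume "mat c ** A' = mat 1 \<and> A' ** mat c = mat 1"
  then show "A' = mat (1 / c)" using c by (simp add: mat2_defs field_simps)
qed

text \<open>Tangency holds everywhere because f maps into de Sitter space. On the dense set
  \<open>W\<close> conformality makes the Laplacian orthogonal to both first derivatives, tangency
  determines its product with f, and mean curvature one its product with the normal; these four
  products determine it. The resulting equations contain neither the normal nor a quotient, so both
  sides are continuous on \<open>M\<close>.\<close>

lemma cmc1_face_pde:
  assumes face: "cmc1_face M f" and z: "z \<in> M"
  defines "u \<equiv> pd 1 f" and "v \<equiv> pd 2 f"
  shows "lorentz (u z) (f z) = 0" "lorentz (v z) (f z) = 0"
    "lorentz (u z) (v z) = 0" "lorentz (u z) (u z) = lorentz (v z) (v z)"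
    "pd 1 u z + pd 2 v z = (- 2 * lorentz (u z) (u z)) *\<^sub>R f z
      + 2 *\<^sub>R lorentz_cross (u z) (v z) (f z)"
proof -
  note sm = cmc1_face_smooth[OF face]
  obtain W where W: "open W" "W \<subseteq> M" "M \<subseteq> closure W" "spacelike_cmc1_on W f"
    and conf: "\<And>z. z \<in> M - singular_set M f \<Longrightarrow> \<exists>c>0. ds2 f z = mat c"
    using face unfolding cmc1_face_def by blast
  have df: "(f has_derivative (\<lambda>h. Re h *\<^sub>R u z + Im h *\<^sub>R v z)) (at z)" if "z \<in> M" for z
    unfolding u_def v_def by (rule has_derivative_pd[OF sm(2)[OF that]])
  have du: "(u has_derivative (\<lambda>h. Re h *\<^sub>R pd 1 u z + Im h *\<^sub>R pd 2 u z)) (at z)"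
    and dv: "(v has_derivative (\<lambda>h. Re h *\<^sub>R pd 1 v z + Im h *\<^sub>R pd 2 v z)) (at z)" if "z \<in> M" for z
    unfolding u_def v_def by (rule has_derivative_pd[OF sm(3)[OF that]])+
  have tan: "lorentz (u z) (f z) = 0" "lorentz (v z) (f z) = 0" if "z \<in> M" for z
  proof -
    have "lorentz (f z) (Re h *\<^sub>R u z + Im h *\<^sub>R v z) + lorentz (Re h *\<^sub>R u z
      + Im h *\<^sub>R v z) (f z) = 0" for h
      by (rule has_derivative_const_open_zero[OF sm(1) that _
        has_derivative_lorentz[OF df[OF that] df[OF that]]])
         (use sm(7) in auto)
    from this[of 1] this[of \<i>] show "lorentz (u z) (f z) = 0" "lorentz (v z) (f z) = 0"
      by (simp_all add: lorentz_commute[of "f z"])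
  qed
  then show "lorentz (u z) (f z) = 0" "lorentz (v z) (f z) = 0" using z by auto
  have confW: "ds2 f w = mat (lorentz (u w) (u w))" "lorentz (u w) (u w) > 0" if "w \<in> W" for w
  proof -
    have "w \<in> M - singular_set M f"
      using that W pos_def_det_nonzero unfolding spacelike_cmc1_on_def singular_set_def by auto
    then obtain c where c: "c > 0" "ds2 f w = mat c" using conf by blast
    then have "lorentz (u w) (u w) = c" unfolding u_def ds2_nth[symmetric] by (simp add: mat_def)
    then show "ds2 f w = mat (lorentz (u w) (u w))" "lorentz (u w) (u w) > 0" using c by auto
  qed
  have uvW: "lorentz (u w) (v w) = 0" "lorentz (u w) (u w) = lorentz (v w) (v w)" if "w \<in> W" for w
    using confW(1)[OF that] ds2_nth[of f w 1 2] ds2_nth[of f w 2 2]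
    unfolding u_def v_def by (simp_all add: mat_def)
  note cl = bounded_bilinear.continuous_on[OF bounded_bilinear_lorentz]
  have cont: "continuous_on M u" "continuous_on M v" unfolding u_def v_def by (rule sm(5))+
  show "lorentz (u z) (v z) = 0"
    by (rule continuous_on_dense_eq[OF cl[OF cont] continuous_on_const W(2,3) _ z]) (use uvW in
      auto)
  show "lorentz (u z) (u z) = lorentz (v z) (v z)"
    by (rule continuous_on_dense_eq[OF cl[OF cont(1,1)] cl[OF cont(2,2)] W(2,3) _ z]) (use uvW in
      auto)
  have pdeW: "pd 1 u w + pd 2 v w = (- 2 * lorentz (u w) (u w)) *\<^sub>R f w
    + 2 *\<^sub>R lorentz_cross (u w) (v w) (f w)"
    if w: "w \<in> W" for w
  proof -
    have wM: "w \<in> M" using w W by auto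
    define c where "c = lorentz (u w) (u w)"
    have c: "lorentz (u w) (u w) = c" "lorentz (v w) (v w) = c" "lorentz (u w) (v w) = 0" "c > 0"
      using uvW[OF w] confW[OF w] by (auto simp: c_def)
    have mixed: "pd 1 v w = pd 2 u w" unfolding u_def v_def by (rule sm(8)[OF wM])
    \<comment> \<open>\<open>e1\<close> to \<open>e4\<close> are the derivatives of <u,v> = 0, <u,u>
      - <v,v> = 0, <u,f> = 0 and <v,f> = 0 in the direction \<open>h\<close>; below, h = 1 and h =
      \<open>\<i>\<close> give the two partial derivatives.\<close>
    have e1: "lorentz (u w) (Re h *\<^sub>R pd 1 v w + Im h *\<^sub>R pd 2 v w) + lorentz (Re h *\<^sub>R pd 1 u w
      + Im h *\<^sub>R pd 2 u w) (v w) = 0" for h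
      by (rule has_derivative_const_open_zero[OF W(1) w _
        has_derivative_lorentz[OF du[OF wM] dv[OF wM]]])
         (use uvW in auto)
    have e2: "lorentz (u w) (Re h *\<^sub>R pd 1 u w + Im h *\<^sub>R pd 2 u w) + lorentz (Re h *\<^sub>R pd 1 u w
      + Im h *\<^sub>R pd 2 u w) (u w)
       - (lorentz (v w) (Re h *\<^sub>R pd 1 v w + Im h *\<^sub>R pd 2 v w) + lorentz (Re h *\<^sub>R pd 1 v w
         + Im h *\<^sub>R pd 2 v w) (v w)) = 0" for h
      by (rule has_derivative_const_open_zero[OF W(1) w _ has_derivative_diff[OF
        has_derivative_lorentz[OF du[OF wM] du[OF wM]]
            has_derivative_lorentz[OF dv[OF wM] dv[OF wM]]]])
         (use uvW in auto)
    have e3: "lorentz (u w) (Re h *\<^sub>R u w + Im h *\<^sub>R v w) + lorentz (Re h *\<^sub>R pd 1 u w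
      + Im h *\<^sub>R pd 2 u w) (f w) = 0" for h
      by (rule has_derivative_const_open_zero[OF sm(1) wM _
        has_derivative_lorentz[OF du[OF wM] df[OF wM]]])
         (use tan in auto)
    have e4: "lorentz (v w) (Re h *\<^sub>R u w + Im h *\<^sub>R v w) + lorentz (Re h *\<^sub>R pd 1 v w
      + Im h *\<^sub>R pd 2 v w) (f w) = 0" for h
      by (rule has_derivative_const_open_zero[OF sm(1) wM _
        has_derivative_lorentz[OF dv[OF wM] df[OF wM]]])
         (use tan in auto)
    define L where "L = pd 1 u w + pd 2 v w"
    have Lu: "lorentz L (u w) = 0"
      using e1[of \<i>] e2[of 1] mixed by (simp add: L_def lorentz_simps lorentz_commute[of "u w"]
        lorentz_commute[of "v w"])
    have Lv: "lorentz L (v w) = 0"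
      using e1[of 1] e2[of \<i>] mixed by (simp add: L_def lorentz_simps lorentz_commute[of "u w"]
        lorentz_commute[of "v w"])
    have Lf: "lorentz L (f w) = - 2 * c"
      using e3[of 1] e4[of \<i>] c by (simp add: L_def lorentz_simps)
    obtain n where n: "unit_normal f w n" "mean_curvature f w n = 1"
      using W(4) w unfolding spacelike_cmc1_on_def by blast
    \<comment> \<open>The metric is \<open>c\<close> times the identity, so the trace reduces to the
      Laplacian divided by \<open>c\<close>.\<close>
    have "mean_curvature f w n = lorentz L n / c / 2"
      unfolding mean_curvature_def confW(1)[OF w] c(1) matrix_inv_mat2[OF less_imp_neq[OF c(4),
        symmetric]]
      using c(4)
      by (simp add: trace_def mat2_defs second_form_def L_def lorentz_simps u_def v_def field_simps)
    then have Ln: "lorentz L n = 2 * c" using n(2) c(4) by (simp add: field_simps)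
    show ?thesis unfolding L_def[symmetric] c(1)
      by (rule cmc1_laplacian[of n])
         (use n(1) Lu Lv Lf Ln c tan[OF wM] sm(7)[OF wM] in \<open>auto simp: unit_normal_def u_def
           v_def\<close>)
  qed
  have cc: "continuous_on M (\<lambda>z. lorentz_cross (u z) (v z) (f z))"
  proof -
    have nth: "continuous_on M (\<lambda>z. u z $ i)" "continuous_on M (\<lambda>z. v z $ i)" "continuous_on M
      (\<lambda>z. f z $ i)" for i
      using cont sm(4) by (auto intro!: continuous_intros)
    have "continuous_on M (\<lambda>z. lorentz_cross (u z) (v z) (f z) $ i)" for i
      using exhaust_4[of i] unfolding lorentz_cross_def Let_def
      by (elim disjE; simp only: vector_4; intro continuous_on_minus continuous_on_add
        continuous_on_diff continuous_on_mult nth)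
    then have "continuous_on M (\<lambda>z. \<chi> i. lorentz_cross (u z) (v z) (f z) $ i)"
      by (rule continuous_on_vec_lambda)
    then show ?thesis by simp
  qed
  show "pd 1 u z + pd 2 v z = (- 2 * lorentz (u z) (u z)) *\<^sub>R f z
    + 2 *\<^sub>R lorentz_cross (u z) (v z) (f z)"
  proof (rule continuous_on_dense_eq[OF _ _ W(2,3) pdeW z])
    show "continuous_on M (\<lambda>z. pd 1 u z + pd 2 v z)"
      unfolding u_def v_def by (intro continuous_intros sm(6))
    show "continuous_on M (\<lambda>z. (- 2 * lorentz (u z) (u z)) *\<^sub>R f z
      + 2 *\<^sub>R lorentz_cross (u z) (v z) (f z))"
      by (intro continuous_intros cl cont sm(4) cc)
  qed
qed

lemma has_field_derivative_of_has_derivative: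
  fixes \<phi> :: "complex \<Rightarrow> complex"
  assumes "(\<phi> has_derivative D) (at z)" "D \<i> = \<i> * D 1"
  shows "(\<phi> has_field_derivative D 1) (at z)"
proof -
  have lin: "linear D" using assms(1) has_derivative_linear by blast
  have Dh: "D h = D 1 * h" for h
  proof -
    have "D h = D (Re h *\<^sub>R 1 + Im h *\<^sub>R \<i>)" by (rule arg_cong[of _ _ D]) (simp add: complex_eq_iff)
    also have "\<dots> = of_real (Re h) * D 1 + of_real (Im h) * D \<i>"
      unfolding linear_add[OF lin] linear_scale[OF lin] by (simp add: scaleR_conv_of_real)
    also have "\<dots> = (of_real (Re h) + \<i> * of_real (Im h)) * D 1"
      unfolding assms(2) by (simp add: algebra_simps)
    finally show ?thesis by (simp add: complex_eq[symmetric] mult.commute)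
  qed
  have "D = (*) (D 1)" by (rule ext) (rule Dh)
  with assms(1) have "(\<phi> has_derivative (*) (D 1)) (at z)" by metis
  then show ?thesis unfolding has_field_derivative_def .
qed

text \<open>In matrix form this is \<open>X\<^sub>z X\<^sup>-\<^sup>1\<close> with \<open>X = herm \<circ> f\<close>; the inverse of \<open>X\<close> is minus its adjugate.\<close>

definition log_deriv :: "(complex \<Rightarrow> real^4) \<Rightarrow> complex \<Rightarrow> complex^2^2" where
  "log_deriv f z = cscale (- (1 / 2)) ((herm (pd 1 f z)
    - cscale \<i> (herm (pd 2 f z))) ** adjugate (herm (f z)))"

text \<open>\<open>D 1 + cscale \<i> (D \<i>)\<close> is twice the derivative with respect to cnj z.
  The mixed second derivatives cancel by symmetry, and what remains is a multiple of the left side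
  of \<open>dbar_identity\<close>.\<close>

lemma log_deriv_holomorphic:
  assumes face: "cmc1_face M f"
  shows "(\<lambda>z. log_deriv f z $ i $ j) holomorphic_on M"
proof -
  note sm = cmc1_face_smooth[OF face]
  define u v where "u = pd 1 f" and "v = pd 2 f"
  have "\<exists>D. ((\<lambda>z. log_deriv f z $ i $ j) has_field_derivative D) (at z)" if z: "z \<in> M" for z
  proof -
    have df: "(f has_derivative (\<lambda>h. Re h *\<^sub>R u z + Im h *\<^sub>R v z)) (at z)"
      unfolding u_def v_def by (rule has_derivative_pd[OF sm(2)[OF z]])
    have du: "(u has_derivative (\<lambda>h. Re h *\<^sub>R pd 1 u z + Im h *\<^sub>R pd 2 u z)) (at z)"
      and dv: "(v has_derivative (\<lambda>h. Re h *\<^sub>R pd 1 v z + Im h *\<^sub>R pd 2 v z)) (at z)"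
      unfolding u_def v_def by (rule has_derivative_pd[OF sm(3)[OF z]])+
    define D where "D = (\<lambda>h. cscale (- (1 / 2)) ((herm (u z)
      - cscale \<i> (herm (v z))) ** adjugate (herm (Re h *\<^sub>R u z + Im h *\<^sub>R v z))
       + (herm (Re h *\<^sub>R pd 1 u z + Im h *\<^sub>R pd 2 u z) - cscale \<i> (herm (Re h *\<^sub>R pd 1 v z
         + Im h *\<^sub>R pd 2 v z))) ** adjugate (herm (f z))))"
    have "(log_deriv f has_derivative D) (at z)"
      unfolding log_deriv_def[abs_def] D_def u_def[symmetric] v_def[symmetric]
      by (intro derivative_intros has_derivative_matrix_mult2 df du dv)
    then have dij: "((\<lambda>z. log_deriv f z $ i $ j) has_derivative (\<lambda>h. D h $ i $ j)) (at z)"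
      by (intro bounded_linear.has_derivative[OF bounded_linear_vec_nth])
    have mixed: "pd 1 v z = pd 2 u z" unfolding u_def v_def by (rule sm(8)[OF z])
    have id: "herm (pd 1 u z + pd 2 v z) ** adjugate (herm (f z)) + (herm (u z)
      - cscale \<i> (herm (v z))) ** adjugate (herm (u z) + cscale \<i> (herm (v z))) = 0"
      using cmc1_face_pde[OF face z] sm(7)[OF z]
      by (intro dbar_identity[of _ _ _ "lorentz (u z) (u z)"]) (auto simp: u_def v_def)
    have "D 1 + cscale \<i> (D \<i>) = cscale (- (1 / 2)) (herm (pd 1 u z
      + pd 2 v z) ** adjugate (herm (f z)) + (herm (u z)
      - cscale \<i> (herm (v z))) ** adjugate (herm (u z) + cscale \<i> (herm (v z))))"
      unfolding D_def mixed by (simp add: mat2_mult_simps cscale_simps adjugate_simps herm_simps)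
    then have "D 1 + cscale \<i> (D \<i>) = 0" unfolding id by (simp add: cscale_simps)
    then have "D 1 $ i $ j + \<i> * D \<i> $ i $ j = 0" by (simp add: vec_eq_iff cscale_def)
    then have "\<i> * (D 1 $ i $ j + \<i> * D \<i> $ i $ j) = 0" by simp
    then have "D \<i> $ i $ j = \<i> * D 1 $ i $ j" by (simp add: algebra_simps)
    from has_field_derivative_of_has_derivative[OF dij this] show ?thesis by blast
  qed
  then show ?thesis using sm(1)
    by (simp add: holomorphic_on_open)
qed

text \<open>The first equation says that the trace vanishes and comes from tangency; the determinant
  vanishes by conformality; the matrix is nonzero because df is. The last equation undoes the
  multiplication by the adjugate, using \<open>det X = -1\<close>.\<close>

lemma log_deriv_props:
  assumes face: "cmc1_face M f" and z: "z \<in> M"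
  shows "adjugate (log_deriv f z) = - log_deriv f z" "det (log_deriv f z) = 0" "log_deriv f z \<noteq> 0"
    "cscale 2 (log_deriv f z ** herm (f z)) = herm (pd 1 f z) - cscale \<i> (herm (pd 2 f z))"
proof -
  note sm = cmc1_face_smooth[OF face] and pde = cmc1_face_pde[OF face z]
  define X U V where "X = herm (f z)" and "U = herm (pd 1 f z)" and "V = herm (pd 2 f z)"
  define P where "P = U - cscale \<i> V"
  have B: "log_deriv f z = cscale (- (1 / 2)) (P ** adjugate X)"
    by (simp add: log_deriv_def P_def X_def U_def V_def)
  have dX: "det X = -1" unfolding X_def det_herm sm(7)[OF z] by simp
  have UX: "U ** adjugate X = - (X ** adjugate U)" and VX: "V ** adjugate X = - (X ** adjugate V)"
    using herm_adjugate_polar[of "pd 1 f z" "f z"] herm_adjugate_polar[of "pd 2 f z" "f z"] pde(1,2)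
    by (auto simp: X_def U_def V_def eq_neg_iff_add_eq_0 mat_0)
  have PX: "P ** adjugate X = - (X ** adjugate P)"
    unfolding P_def by (simp add: mat2_mult_simps cscale_simps adjugate_simps UX VX)
  have adjadj: "adjugate (adjugate X) = X" by (simp add: mat2_defs)
  show "adjugate (log_deriv f z) = - log_deriv f z"
    unfolding B adjugate_simps adjadj by (simp add: PX cscale_simps)
  have dP: "det P = 0"
  \<comment> \<open>The real part and the coefficient of i in det (U - i V) correspond to <v,v> -
    <u,u> and <u,v>, the two conformality relations.\<close>
  proof -
    have "det P = det U - det V - \<i> * (U$1$1 * V$2$2 + U$2$2 * V$1$1 - U$1$2 * V$2$1
      - U$2$1 * V$1$2)"
      unfolding P_def by (simp add: mat2_defs algebra_simps)
    moreover have "det U = det V" unfolding U_def V_def det_herm pde(4) ..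
    moreover have "U$1$1 * V$2$2 + U$2$2 * V$1$1 - U$1$2 * V$2$1 - U$2$1 * V$1$2
      = of_real (- 2 * lorentz (pd 1 f z) (pd 2 f z))"
      unfolding U_def V_def lorentz_def by (simp add: mat2_defs complex_eq_iff algebra_simps)
    ultimately show ?thesis using pde(3) by simp
  qed
  have "det (log_deriv f z) = (1 / 4) * (det P * det (adjugate X))"
    unfolding B det_mul[symmetric] by (simp add: mat2_defs algebra_simps)
  then show "det (log_deriv f z) = 0" by (simp add: dP)
  have BX: "cscale 2 (log_deriv f z ** X) = P"
  proof -
    have "cscale 2 (log_deriv f z ** X) = cscale (-1) (P ** (adjugate X ** X))"
      unfolding B by (simp add: mat2_mult_simps cscale_simps)
    then show ?thesis unfolding adjugate_mult dX by (simp add: mat2_mult_simps cscale_simps)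
  qed
  then show "cscale 2 (log_deriv f z ** herm (f z)) = herm (pd 1 f z) - cscale \<i> (herm (pd 2 f z))"
    by (simp add: X_def P_def U_def V_def)
  show "log_deriv f z \<noteq> 0"
  proof
    assume "log_deriv f z = 0"
    then have "P = 0" using BX by (simp add: cscale_simps)
    then have "pd 1 f z = 0 \<and> pd 2 f z = 0"
      unfolding P_def U_def V_def by (auto simp: mat2_defs complex_eq_iff forall_4)
    then have "frechet_derivative f (at z) = (\<lambda>_. 0)"
      using has_derivative_pd[OF sm(2)[OF z]] frechet_derivative_at by fastforce
    then show False using face z unfolding cmc1_face_def by blast
  qed
qed

section \<open>Null frames\<close>

text \<open>Provides the initial value of the differential equation for the frame. For a nonzero
  upper left entry this is a triangular factorisation with that entry as pivot, the two columns
  exchanged if the pivot is negative. If the pivot is 0, the off-diagonal entry has modulus 1 and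
  its square root is used.\<close>

lemma hermitian_frame_exists:
  assumes "lorentz x x = 1"
  shows "\<exists>F. det F = 1 \<and> F ** e3 ** hconj F = herm x"
proof -
  define \<alpha> \<delta> where "\<alpha> = x$1 + x$4" and "\<delta> = x$1 - x$4"
  define \<beta> where "\<beta> = of_real (x$2) + \<i> * of_real (x$3)"
  have X: "herm x = vector [vector [of_real \<alpha>, \<beta>], vector [cnj \<beta>, of_real \<delta>]]"
    by (simp add: mat2_defs \<alpha>_def \<beta>_def \<delta>_def)
  have "\<beta> * cnj \<beta> = of_real ((cmod \<beta>)\<^sup>2)" by (rule complex_norm_square[symmetric])
  moreover have "(cmod \<beta>)\<^sup>2 = 1 + \<alpha> * \<delta>"
    using assms unfolding lorentz_def \<alpha>_def \<beta>_def \<delta>_def cmod_power2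
      by (simp add: algebra_simps power2_eq_square)
  ultimately have \<beta>: "\<beta> * cnj \<beta> = 1 + of_real \<alpha> * of_real \<delta>" by simp
  consider "\<alpha> > 0" | "\<alpha> < 0" | "\<alpha> = 0" by linarith
  then show ?thesis
  proof cases
    case 1
    define s where "s = complex_of_real (sqrt \<alpha>)"
    have s: "s * s = of_real \<alpha>" "cnj s = s" "s \<noteq> 0" using 1
      by (auto simp: s_def simp flip: of_real_mult)
    have a0: "complex_of_real \<alpha> \<noteq> 0" using 1 by simp
    define F where "F = (vector [vector [s, 0], vector [cnj \<beta> / s, 1 / s]] :: complex^2^2)"
    have "cnj \<beta> / s * (\<beta> / s) - 1 / s * (1 / s) = (\<beta> * cnj \<beta> - 1) / (s * s)"
      using s(3) by (simp add: field_simps)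
    also have "\<dots> = of_real \<delta>" unfolding s \<beta> using a0 by simp
    finally have "cnj \<beta> / s * (\<beta> / s) - 1 / s * (1 / s) = of_real \<delta>" .
    then have "F ** e3 ** hconj F = herm x" unfolding X F_def using s by (simp add: mat2_defs)
    moreover have "det F = 1" using s(3) by (simp add: F_def det_2)
    ultimately show ?thesis by blast
  next
    case 2
    define s where "s = complex_of_real (sqrt (- \<alpha>))"
    have s: "s * s = - of_real \<alpha>" "cnj s = s" "s \<noteq> 0" using 2
      by (auto simp: s_def simp flip: of_real_mult)
    have a0: "complex_of_real \<alpha> \<noteq> 0" using 2 by simp
    define F where "F = (vector [vector [0, s], vector [- 1 / s, - cnj \<beta> / s]] :: complex^2^2)"
    have "1 / s * (1 / s) - cnj \<beta> / s * (\<beta> / s) = (1 - \<beta> * cnj \<beta>) / (s * s)"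
      using s(3) by (simp add: field_simps)
    also have "\<dots> = of_real \<delta>" unfolding s \<beta> using a0 by simp
    finally have "1 / s * (1 / s) - cnj \<beta> / s * (\<beta> / s) = of_real \<delta>" .
    then have "F ** e3 ** hconj F = herm x" unfolding X F_def using s by (simp add: mat2_defs)
    moreover have "det F = 1" using s(3) by (simp add: F_def det_2)
    ultimately show ?thesis by blast
  next
    case 3
    then have b1: "\<beta> * cnj \<beta> = 1" using \<beta> by simp
    define s where "s = csqrt (- \<beta>)"
    have ss: "s * s = - \<beta>" unfolding s_def by (metis power2_csqrt power2_eq_square)
    have "(cmod \<beta>)\<^sup>2 = 1" using b1 complex_norm_square[of \<beta>] by (metis of_real_1 of_real_eq_iff)
    then have "cmod \<beta> = 1" using norm_ge_zero[of \<beta>] by (simp add: power2_eq_1_iff)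
    then have "cmod s * cmod s = 1" using ss by (metis norm_minus_cancel norm_mult)
    then have "cmod s = 1" by (metis abs_norm_cancel abs_square_eq_1 power2_eq_square)
    then have sc: "s * cnj s = 1" by (simp add: complex_norm_square[symmetric])
    have s0: "s \<noteq> 0" using sc by auto
    \<comment> \<open>\<open>r\<close> and \<open>t\<close> must satisfy t - r = cnj s and |r|^2 -
      |t|^2 = \<delta>; the latter is ((\<delta> + 1) / 2)^2 - ((\<delta> - 1) / 2)^2 = \<delta>,
      since |s| = 1.\<close>
    define r where "r = of_real ((\<delta> + 1) / 2) * (- cnj s)"
    define t where "t = of_real ((\<delta> - 1) / 2) * (- cnj s)"
    define F where "F = (vector [vector [s, s], vector [r, t]] :: complex^2^2)"
    have rt: "t - r = cnj s" by (simp add: r_def t_def field_simps)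
    have "det F = s * (t - r)" by (simp add: F_def det_2 algebra_simps)
    then have dF: "det F = 1" using rt sc by simp
    have "r * cnj r - t * cnj t = (of_real ((\<delta> + 1) / 2) * of_real ((\<delta> + 1) / 2) - of_real ((\<delta>
      - 1) / 2) * of_real ((\<delta> - 1) / 2)) * (s * cnj s)"
      by (simp add: r_def t_def algebra_simps)
    also have "\<dots> = of_real (((\<delta> + 1) / 2) * ((\<delta> + 1) / 2) - ((\<delta> - 1) / 2) * ((\<delta> - 1) / 2))"
      unfolding sc by simp
    also have "((\<delta> + 1) / 2) * ((\<delta> + 1) / 2) - ((\<delta> - 1) / 2) * ((\<delta> - 1) / 2) = \<delta>"
      by (simp add: field_simps)
    finally have 22: "r * cnj r - t * cnj t = of_real \<delta>" .
    have 12: "s * cnj r - s * cnj t = \<beta>"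
    proof -
      have "s * cnj r - s * cnj t = - (s * cnj (t - r))" by (simp add: algebra_simps)
      then show ?thesis unfolding rt using ss by simp
    qed
    have 21: "r * cnj s - t * cnj s = cnj \<beta>"
    proof -
      have "r * cnj s - t * cnj s = cnj (s * cnj r - s * cnj t)" by (simp add: mult.commute)
      then show ?thesis unfolding 12 .
    qed
    have "F ** e3 ** hconj F = herm x" unfolding X F_def using 12 21 22 3 by (simp add: mat2_defs)
    then show ?thesis using dF by blast
  qed
qed

text \<open>
  Here \<open>N = F\<^sup>-\<^sup>1 F'\<close>; the last two conditions say that it is nilpotent.
\<close>

definition null_frame ::
  "(complex \<Rightarrow> real^4) \<Rightarrow> (complex \<Rightarrow> complex^2^2) \<Rightarrow> (complex \<Rightarrow> complex^2^2) \<Rightarrow> bool" where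
  "null_frame f F N \<longleftrightarrow>
     (\<forall>i j. (\<lambda>w. N w $ i $ j) holomorphic_on left_half_plane) \<and>
     (\<forall>w\<in>left_half_plane.
        (\<forall>i j. ((\<lambda>u. F u $ i $ j) has_field_derivative (F w ** N w) $ i $ j) (at w)) \<and>
        det (F w) = 1 \<and> herm (f (exp w)) = F w ** e3 ** hconj (F w) \<and>
        N w $ 2 $ 2 = - N w $ 1 $ 1 \<and> det (N w) = 0)"

lemma has_derivative_cscale:
  assumes "\<And>i j. ((\<lambda>u. F u $ i $ j) has_field_derivative D $ i $ j) (at w)"
  shows "(F has_derivative (\<lambda>h. cscale h D)) (at w)"
proof (intro has_derivative_vecI)
  fix i j
  show "((\<lambda>w. F w $ i $ j) has_derivative (\<lambda>h. cscale h D $ i $ j)) (at w)"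
  proof -
    have "(\<lambda>h. cscale h D $ i $ j) = (*) (D $ i $ j)" by (auto simp: cscale_def)
    then show ?thesis using assms[of i j] unfolding has_field_derivative_def by simp
  qed
qed

lemma det_cscale: "det (cscale k A) = k\<^sup>2 * det A"
  by (simp add: det_2 cscale_def algebra_simps power2_eq_square)

lemma open_left_half_plane: "open left_half_plane" "convex left_half_plane"
  unfolding left_half_plane_def by (auto simp: open_halfspace_Re_lt convex_halfspace_Re_lt)

lemma exp_in_punctured_disk: "w \<in> left_half_plane \<Longrightarrow> exp w \<in> punctured_disk 1"
  by (simp add: left_half_plane_def punctured_disk_def)

text \<open>Everything follows from three matrix functions with vanishing derivative:
  \<open>K w ** F w\<close>, which gives determinant 1, \<open>K w ** X w ** hconj (K w)\<close>,
  which gives the representation of f, and K(w) F(w + 2 \<pi> i), whose constant value is the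
  monodromy. Here K is the adjugate of F.\<close>

lemma null_frame_exists:
  assumes face: "cmc1_face (punctured_disk 1) f"
  obtains F N \<rho> where "null_frame f F N" "\<And>w. w \<in> left_half_plane \<Longrightarrow> N w \<noteq> 0"
    "\<rho> \<in> SU11" "\<And>w. w \<in> left_half_plane \<Longrightarrow> F (w + 2 * of_real pi * \<i>) = F w ** \<rho>"
proof -
  note sm = cmc1_face_smooth[OF face] and H = open_left_half_plane
  define B where "B = log_deriv f"
  \<comment> \<open>The logarithmic derivative in the coordinate w; the factor \<open>exp w\<close>
    comes from dz = exp(w) dw. It is periodic although the frame is not.\<close>
  define A where "A = (\<lambda>w. cscale (exp w) (B (exp w)))"
  have Ahol: "(\<lambda>w. A w $ i $ j) holomorphic_on left_half_plane" for i j
  proof -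
    have "(\<lambda>z. B z $ i $ j) \<circ> exp holomorphic_on left_half_plane"
      unfolding B_def
      by (rule holomorphic_on_compose_gen[OF _ log_deriv_holomorphic[OF face]])
         (auto intro!: holomorphic_intros exp_in_punctured_disk)
    then show ?thesis by (auto simp: A_def cscale_def o_def intro!: holomorphic_intros)
  qed
  have Aper: "A (w + 2 * of_real pi * \<i>) = A w" for w
    by (simp add: A_def exp_add exp_two_pi_i)
  define w0 where "w0 = complex_of_real (-1)"
  have w0: "w0 \<in> left_half_plane" by (simp add: w0_def left_half_plane_def)
  obtain F0 where F0: "det F0 = 1" "F0 ** e3 ** hconj F0 = herm (f (exp w0))"
    using hermitian_frame_exists sm(7)[OF exp_in_punctured_disk[OF w0]] by blast
  have "\<exists>y. (\<forall>i. \<forall>w\<in>left_half_plane. (y i has_field_derivative (\<Sum>j\<in>UNIV. A w $ i $ j * y j w)) (at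
    w))
      \<and> (\<forall>i. y i w0 = F0 $ i $ k)" for k :: 2
    using holomorphic_linear_ode[OF H w0, of "\<lambda>i j w. A w $ i $ j" "\<lambda>i. F0 $ i $ k"] Ahol by metis
  then obtain y where y: "\<And>k i w. w \<in> left_half_plane \<Longrightarrow> (y k i
    has_field_derivative (\<Sum>j\<in>UNIV. A w $ i $ j * y k j w)) (at w)"
    "\<And>k i. y k i w0 = F0 $ i $ k" by metis
  define F where "F = (\<lambda>w. (\<chi> i k. y k i w) :: complex^2^2)"
  have Fd: "((\<lambda>u. F u $ i $ j) has_field_derivative (A w ** F w) $ i $ j) (at w)"
    if "w \<in> left_half_plane" for w i j
    using y(1)[OF that, of j i] by (simp add: F_def matrix_matrix_mult_def)
  have Fw0: "F w0 = F0" by (simp add: F_def y vec_eq_iff)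
  \<comment> \<open>Being the adjugate, \<open>K\<close> is differentiable without knowing that F is
    invertible, and it solves K' = - K A because \<open>A\<close> has trace zero.\<close>
  define K where "K = (\<lambda>w. adjugate (F w))"
  define X where "X = (\<lambda>w. herm (f (exp w)))"
  have dF: "(F has_derivative (\<lambda>h. cscale h (A w ** F w))) (at w)" if "w \<in> left_half_plane" for w
    by (rule has_derivative_cscale[OF Fd[OF that]])
  have adjA: "adjugate (A w) = - A w" if "w \<in> left_half_plane" for w
    using log_deriv_props(1)[OF face exp_in_punctured_disk[OF that]]
    by (simp add: A_def B_def adjugate_simps cscale_simps)
  have dK: "(K has_derivative (\<lambda>h. - cscale h (K w ** A w))) (at w)" if "w \<in> left_half_plane" for w
  proof -
    have "(K has_derivative (\<lambda>h. adjugate (cscale h (A w ** F w)))) (at w)"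
      unfolding K_def by (intro derivative_intros dF that)
    then show ?thesis by (simp add: adjugate_simps adjA[OF that] K_def mat2_mult_simps cscale_simps)
  qed
  have const: "\<phi> w = \<phi> w0" if "\<And>w. w \<in> left_half_plane \<Longrightarrow> (\<phi>
    has_derivative (\<lambda>h. 0)) (at w)" "w \<in> left_half_plane"
    for \<phi> :: "complex \<Rightarrow> complex^2^2" and w
    using has_derivative_zero_unique_connected[OF H(1) convex_connected[OF H(2)] that(1) that(2)
      w0] by blast
  have KF: "K w ** F w = mat 1" if "w \<in> left_half_plane" for w
  proof -
    have "K w ** F w = K w0 ** F w0"
    proof (rule const[OF _ that])
      fix w assume w: "w \<in> left_half_plane"
      show "((\<lambda>w. K w ** F w) has_derivative (\<lambda>h. 0)) (at w)"
        using has_derivative_matrix_mult2[OF dK[OF w] dF[OF w]]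
        by (simp add: mat2_mult_simps cscale_simps)
    qed
    then show ?thesis unfolding K_def Fw0 adjugate_mult F0 .
  qed
  have detF: "det (F w) = 1" if "w \<in> left_half_plane" for w
    using KF[OF that] unfolding K_def adjugate_mult by (simp add: mat2_defs)
  have FK: "F w ** K w = mat 1" if "w \<in> left_half_plane" for w
    unfolding K_def adjugate_mult detF[OF that] ..
  \<comment> \<open>\<open>A w ** X w\<close> is the w-derivative of \<open>X\<close>; as
    \<open>X\<close> is Hermitian, the derivative with respect to cnj w is its adjoint.\<close>
  have dX: "(X has_derivative (\<lambda>h. cscale h (A w ** X w) + hconj (cscale h (A w ** X w)))) (at w)"
    if w: "w \<in> left_half_plane" for w
  proof -
    let ?z = "exp w"
    have z: "?z \<in> punctured_disk 1" by (rule exp_in_punctured_disk[OF w])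
    have 1: "(exp has_derivative (\<lambda>h. ?z * h)) (at w)"
      using DERIV_exp[of w] by (simp add: has_field_derivative_def)
    have "((\<lambda>w. f (exp w)) has_derivative (\<lambda>h. Re (?z * h) *\<^sub>R pd 1 f ?z
      + Im (?z * h) *\<^sub>R pd 2 f ?z)) (at w)"
      using diff_chain_at[OF 1 has_derivative_pd[OF sm(2)[OF z]]] by (simp add: o_def)
    then have 2: "(X has_derivative (\<lambda>h. herm (Re (?z * h) *\<^sub>R pd 1 f ?z
      + Im (?z * h) *\<^sub>R pd 2 f ?z))) (at w)"
      unfolding X_def by (intro derivative_intros)
    define U V where "U = herm (pd 1 f ?z)" and "V = herm (pd 2 f ?z)"
    have BX: "B ?z ** herm (f ?z) = cscale (1 / 2) (U - cscale \<i> V)"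
    proof -
      have "cscale (1 / 2) (cscale 2 (B ?z ** herm (f ?z))) = cscale (1 / 2) (U - cscale \<i> V)"
        using log_deriv_props(4)[OF face z] by (simp add: B_def U_def V_def)
      then show ?thesis by (simp add: cscale_simps)
    qed
    have hU: "hconj U = U" "hconj V = V" unfolding U_def V_def by (simp_all add: hconj_simps)
    have AX: "cscale h (A w ** X w) = cscale (?z * h / 2) (U - cscale \<i> V)" for h
      unfolding A_def X_def cscale_simps(1) BX by (simp add: cscale_simps mult_ac)
    have "cscale (k / 2) (U - cscale \<i> V) + hconj (cscale (k / 2) (U - cscale \<i> V))
      = cscale (of_real (Re k)) U + cscale (of_real (Im k)) V" for k
    proof -
      have "hconj (U - cscale \<i> V) = U + cscale \<i> V"
        using hU by (simp add: mat2_defs)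
      then have "cscale (k / 2) (U - cscale \<i> V) + hconj (cscale (k / 2) (U - cscale \<i> V)) =
        cscale (k / 2) (U - cscale \<i> V) + cscale (cnj (k / 2)) (U + cscale \<i> V)"
          unfolding hconj_simps by simp
      also have "\<dots> = cscale ((k + cnj k) / 2) U + cscale (- \<i> * (k - cnj k) / 2) V"
        by (simp add: vec_eq_iff cscale_def field_simps)
      also have "(k + cnj k) / 2 = of_real (Re k)" by (simp add: complex_eq_iff)
      also have "- \<i> * (k - cnj k) / 2 = of_real (Im k)" by (simp add: complex_eq_iff)
      finally show ?thesis .
    qed
    then show ?thesis using 2 unfolding AX by (simp add: herm_simps U_def V_def)
  qed
  have KXK: "K w ** X w ** hconj (K w) = e3" if "w \<in> left_half_plane" for w
  proof -
    have "K w ** X w ** hconj (K w) = K w0 ** X w0 ** hconj (K w0)"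
    proof (rule const[OF _ that])
      fix w assume w: "w \<in> left_half_plane"
      have hX: "hconj (X w) = X w" by (simp add: X_def hconj_simps)
      have "((\<lambda>w. K w ** X w ** hconj (K w)) has_derivative
        (\<lambda>h. K w ** X w ** hconj (- cscale h (K w ** A w))
          + (K w ** (cscale h (A w ** X w) + hconj (cscale h (A w ** X w)))
            + (- cscale h (K w ** A w)) ** X w) ** hconj (K w))) (at w)"
        by (intro has_derivative_matrix_mult2 derivative_intros dK[OF w] dX[OF w])
      then show "((\<lambda>w. K w ** X w ** hconj (K w)) has_derivative (\<lambda>h. 0)) (at w)"
        by (simp add: mat2_mult_simps cscale_simps hconj_simps hX)
    qed
    also have "\<dots> = (K w0 ** F w0) ** e3 ** hconj (K w0 ** F w0)"
      unfolding X_def F0(2)[symmetric] Fw0 by (simp add: hconj_simps mat2_mult_simps)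
    also have "\<dots> = e3" unfolding KF[OF w0] by (simp add: mat2_defs)
    finally show ?thesis .
  qed
  have FeF: "X w = F w ** e3 ** hconj (F w)" if "w \<in> left_half_plane" for w
  proof -
    have "F w ** e3 ** hconj (F w) = (F w ** K w) ** X w ** hconj (F w ** K w)"
      unfolding KXK[OF that, symmetric] by (simp add: hconj_simps mat2_mult_simps)
    also have "\<dots> = X w" unfolding FK[OF that] by (simp add: mat2_defs)
    finally show ?thesis ..
  qed
  define N where "N = (\<lambda>w. K w ** A w ** F w)"
  have FN: "F w ** N w = A w ** F w" if "w \<in> left_half_plane" for w
  proof -
    have "F w ** N w = (F w ** K w) ** A w ** F w" by (simp add: N_def matrix_mul_assoc)
    then show ?thesis unfolding FK[OF that] by simp
  qed
  have Fhol: "(\<lambda>w. F w $ i $ j) holomorphic_on left_half_plane" for i j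
    using Fd H(1) by (metis holomorphic_on_open)
  have frame: "null_frame f F N"
    unfolding null_frame_def
  proof (intro conjI ballI allI)
    fix i j :: 2
    have Khol: "(\<lambda>w. K w $ i $ j) holomorphic_on left_half_plane" for i j
      using exhaust_2[of i] exhaust_2[of j] Fhol unfolding K_def adjugate_def
      by (auto intro!: holomorphic_intros)
    show "(\<lambda>w. N w $ i $ j) holomorphic_on left_half_plane"
      unfolding N_def matrix_matrix_mult_def by (simp, intro holomorphic_intros Khol Fhol Ahol)
  next
    fix w and i j :: 2 assume w: "w \<in> left_half_plane"
    show "((\<lambda>u. F u $ i $ j) has_field_derivative (F w ** N w) $ i $ j) (at w)"
      unfolding FN[OF w] by (rule Fd[OF w])
    show "det (F w) = 1" by (rule detF[OF w])
    show "herm (f (exp w)) = F w ** e3 ** hconj (F w)" using FeF[OF w] by (simp add: X_def)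
    have "adjugate (N w) = - N w"
    proof -
      have KK: "adjugate (K w) = F w" by (simp add: K_def mat2_defs)
      have "adjugate (N w) = K w ** adjugate (A w) ** F w"
        unfolding N_def adjugate_simps KK by (simp add: K_def matrix_mul_assoc)
      then show ?thesis unfolding adjA[OF w] by (simp add: N_def mat2_mult_simps)
    qed
    then have "adjugate (N w) $ 1 $ 1 = (- N w) $ 1 $ 1" by simp
    then show "N w $ 2 $ 2 = - N w $ 1 $ 1" by (simp add: adjugate_def)
    have "det (A w) = (exp w)\<^sup>2 * det (B (exp w))"
      unfolding A_def by (rule det_cscale)
    then have "det (A w) = 0" using log_deriv_props(2)[OF face exp_in_punctured_disk[OF w]]
      by (simp add: B_def)
    then show "det (N w) = 0" by (simp add: N_def det_mul)
  qed
  have N0: "N w \<noteq> 0" if w: "w \<in> left_half_plane" for w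
  proof
    assume "N w = 0"
    then have AF: "A w ** F w = 0" using FN[OF w] by (simp add: mat2_defs)
    have "A w ** (F w ** K w) = (A w ** F w) ** K w" by (rule matrix_mul_assoc)
    also have "\<dots> = 0" unfolding AF by (simp add: mat2_defs)
    finally have "A w = 0" unfolding FK[OF w] by simp
    then have "B (exp w) = 0" by (simp add: A_def mat2_defs)
    then show False using log_deriv_props(3)[OF face exp_in_punctured_disk[OF w]]
      by (simp add: B_def)
  qed
  define \<tau> where "\<tau> = 2 * complex_of_real pi * \<i>"
  have Hper: "w + \<tau> \<in> left_half_plane" if "w \<in> left_half_plane" for w
    using that by (simp add: left_half_plane_def \<tau>_def)
  define \<rho> where "\<rho> = K w0 ** F (w0 + \<tau>)"
  have KFper: "K w ** F (w + \<tau>) = \<rho>" if "w \<in> left_half_plane" for w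
    unfolding \<rho>_def
  proof (rule const[OF _ that])
    fix w assume w: "w \<in> left_half_plane"
    have "(F \<circ> (\<lambda>w. w + \<tau>) has_derivative (\<lambda>h. cscale h (A (w + \<tau>) ** F (w + \<tau>))) \<circ> (\<lambda>h. h)) (at w)"
      by (intro diff_chain_at dF Hper w) (auto intro!: derivative_eq_intros)
    then have 1: "((\<lambda>w. F (w + \<tau>)) has_derivative (\<lambda>h. cscale h (A w ** F (w + \<tau>)))) (at w)"
      using Aper[of w] by (simp add: o_def \<tau>_def)
    show "((\<lambda>w. K w ** F (w + \<tau>)) has_derivative (\<lambda>h. 0)) (at w)"
      using has_derivative_matrix_mult2[OF dK[OF w] 1] by (simp add: mat2_mult_simps cscale_simps)
  qed
  have mono: "F (w + \<tau>) = F w ** \<rho>" if "w \<in> left_half_plane" for w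
  proof -
    have "F w ** \<rho> = (F w ** K w) ** F (w + \<tau>)"
      unfolding KFper[OF that, symmetric] by (simp add: matrix_mul_assoc)
    then show ?thesis unfolding FK[OF that] by simp
  qed
  have "\<rho> \<in> SU11"
  proof -
    have "det (K w0) = 1"
      by (metis detF[OF w0] KF[OF w0] det_mul det_I mult.right_neutral)
    then have "det \<rho> = 1" unfolding \<rho>_def det_mul using detF Hper w0 by simp
    moreover have "\<rho> ** e3 ** hconj \<rho> = K w0 ** (F (w0 + \<tau>) ** e3 ** hconj (F (w0
      + \<tau>))) ** hconj (K w0)"
      unfolding \<rho>_def by (simp add: hconj_simps mat2_mult_simps)
    moreover have "X (w0 + \<tau>) = X w0" by (simp add: X_def \<tau>_def exp_add exp_two_pi_i)
    ultimately show ?thesis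
      using FeF[OF Hper[OF w0]] KXK[OF w0] by (simp add: SU11_def SL2C_def)
  qed
  then show thesis using that frame N0 mono unfolding \<tau>_def by blast
qed

text \<open>Differentiating \<open>F ** e3 ** hconj F\<close> gives F Q F^H with F^H the conjugate
  transpose, so the metric is - det Q. The terms in h^2 and its conjugate carry the factor a^2 + b c
  = 0, and |a|^2 = |b| |c| completes the square.\<close>

lemma null_frame_metric:
  assumes fr: "null_frame f F N" and w: "w \<in> left_half_plane" and f: "f differentiable (at (exp w))"
  shows "ds2 f (exp w) = mat (((cmod (N w $ 1 $ 2) - cmod (N w $ 2 $ 1)) / cmod (exp w))\<^sup>2)"
proof -
  note H = open_left_half_plane
  have Fd: "\<And>i j. ((\<lambda>u. F u $ i $ j) has_field_derivative (F w ** N w) $ i $ j) (at w)"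
    and detF: "det (F w) = 1" and X: "\<And>w. w \<in> left_half_plane \<Longrightarrow> herm (f (exp w))
      = F w ** e3 ** hconj (F w)"
    and N22: "N w $ 2 $ 2 = - N w $ 1 $ 1" and detN: "det (N w) = 0"
    using fr w unfolding null_frame_def by blast+
  define D where "D = frechet_derivative f (at (exp w))"
  have D: "(f has_derivative D) (at (exp w))" unfolding D_def
    by (rule frechet_derivative_works[THEN iffD1, OF f])
  have lin: "linear D" using D has_derivative_linear by blast
  have dF: "(F has_derivative (\<lambda>h. cscale h (F w ** N w))) (at w)"
    by (rule has_derivative_cscale[OF Fd])
  have 1: "(exp has_derivative (\<lambda>h. exp w * h)) (at w)"
    using DERIV_exp[of w] by (simp add: has_field_derivative_def)
  have "((\<lambda>w. f (exp w)) has_derivative (\<lambda>h. D (exp w * h))) (at w)"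
    using diff_chain_at[OF 1 D] by (simp add: o_def)
  then have d1: "((\<lambda>w. herm (f (exp w))) has_derivative (\<lambda>h. herm (D (exp w * h)))) (at w)"
    by (intro derivative_intros)
  have "((\<lambda>w. F w ** e3 ** hconj (F w)) has_derivative
     (\<lambda>h. F w ** e3 ** hconj (cscale h (F w ** N w)) + (F w ** 0
       + cscale h (F w ** N w) ** e3) ** hconj (F w))) (at w)"
    by (intro has_derivative_matrix_mult2 derivative_intros dF)
  then have d2: "((\<lambda>w. herm (f (exp w))) has_derivative
     (\<lambda>h. F w ** e3 ** hconj (cscale h (F w ** N w)) + (F w ** 0
       + cscale h (F w ** N w) ** e3) ** hconj (F w))) (at w)"
    by (rule has_derivative_transform_within_open[OF _ H(1) w]) (simp add: X)
  define a b c where "a = N w $ 1 $ 1" and "b = N w $ 1 $ 2" and "c = N w $ 2 $ 1"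
  have abc: "a * a = - (b * c)" using detN N22
    by (simp add: det_2 a_def b_def c_def eq_neg_iff_add_eq_0 neg_eq_iff_add_eq_0 algebra_simps)
  have nabc: "(cmod a)\<^sup>2 = cmod b * cmod c"
    using arg_cong[OF abc, of cmod] by (simp add: norm_mult power2_eq_square)
  have metric: "lorentz (D (exp w * h)) (D (exp w * h)) = (cmod h * (cmod b - cmod c))\<^sup>2" for h
  proof -
    define Q where "Q = cscale h (N w ** e3) + cscale (cnj h) (e3 ** hconj (N w))"
    have "herm (D (exp w * h)) = F w ** e3 ** hconj (cscale h (F w ** N w)) + (F w ** 0
      + cscale h (F w ** N w) ** e3) ** hconj (F w)"
      using has_derivative_unique[OF d1 d2] by (rule fun_cong)
    also have "\<dots> = F w ** Q ** hconj (F w)"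
      unfolding Q_def by (simp add: hconj_simps mat2_mult_simps cscale_simps)
    finally have "det (herm (D (exp w * h))) = det Q"
      by (simp add: det_mul detF hconj_simps)
    moreover have "det Q = 2 * (h * a * cnj (h * a)) - h * b * cnj (h * b) - h * c * cnj (h * c)"
    proof -
      have "det Q = (h * a + cnj (h * a)) * (h * a + cnj (h * a)) - (- (h * b)
        + cnj (h * c)) * (h * c - cnj (h * b))"
        unfolding Q_def using N22 by (simp add: mat2_defs a_def b_def c_def algebra_simps)
      also have "\<dots> = 2 * (h * a * cnj (h * a)) - h * b * cnj (h * b) - h * c * cnj (h * c)
          + h * h * (a * a + b * c) + cnj (h * h * (a * a + b * c))"
        by (simp add: algebra_simps)
      finally show ?thesis unfolding abc by simp
    qed
    also have "\<dots> = of_real (2 * (cmod (h * a))\<^sup>2 - (cmod (h * b))\<^sup>2 - (cmod (h * c))\<^sup>2)"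
      by (simp only: complex_norm_square[symmetric] of_real_mult of_real_diff of_real_numeral)
    ultimately have "of_real (- lorentz (D (exp w * h)) (D (exp w * h))) =
        complex_of_real (2 * (cmod (h * a))\<^sup>2 - (cmod (h * b))\<^sup>2 - (cmod (h * c))\<^sup>2)"
      unfolding det_herm by simp
    then have "- lorentz (D (exp w * h)) (D (exp w * h))
      = 2 * (cmod (h * a))\<^sup>2 - (cmod (h * b))\<^sup>2 - (cmod (h * c))\<^sup>2"
      using of_real_eq_iff by blast
    then have "lorentz (D (exp w * h)) (D (exp w * h))
      = (cmod h)\<^sup>2 * ((cmod b)\<^sup>2 + (cmod c)\<^sup>2 - 2 * (cmod a)\<^sup>2)"
      by (simp add: norm_mult power_mult_distrib algebra_simps)
    moreover have "(cmod b)\<^sup>2 + (cmod c)\<^sup>2 - 2 * (cmod b * cmod c) = (cmod b - cmod c)\<^sup>2"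
      by (simp add: power2_diff)
    ultimately show ?thesis unfolding nabc power_mult_distrib by simp
  qed
  define k where "k = ((cmod b - cmod c) / cmod (exp w))\<^sup>2"
  have mk: "lorentz (D v) (D v) = (cmod v)\<^sup>2 * k" for v
    using metric[of "v / exp w"] by (simp add: k_def norm_divide power_mult_distrib power_divide)
  \<comment> \<open>The scale factor \<open>k\<close> is the same in all directions, so comparing
    the direction 1 + i with 1 and i forces the mixed entry to vanish.\<close>
  have m12: "lorentz (D 1) (D \<i>) = 0"
  proof -
    have "D (1 + \<i>) = D 1 + D \<i>" by (rule linear_add[OF lin])
    then have "lorentz (D (1 + \<i>)) (D (1 + \<i>))
      = lorentz (D 1) (D 1) + lorentz (D \<i>) (D \<i>) + 2 * lorentz (D 1) (D \<i>)"
      using lorentz_commute[of "D \<i>" "D 1"] by (simp add: lorentz_simps)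
    moreover have "(cmod (1 + \<i>))\<^sup>2 = 2" by (simp add: cmod_power2)
    ultimately show ?thesis using mk[of "1 + \<i>"] mk[of 1] mk[of \<i>] by simp
  qed
  have "ds2 f (exp w) = mat k"
    using mk[of 1] mk[of \<i>] m12 lorentz_commute[of "D \<i>" "D 1"]
    by (simp add: vec_eq_iff forall_2 ds2_nth pd_def coord_vec_def D_def[symmetric] mat_def)
  then show ?thesis by (simp add: k_def b_def c_def)
qed

section \<open>Passage between null frames and null lifts\<close>

lemma null_frame_abc:
  assumes "null_frame f F N" "w \<in> left_half_plane"
  shows "N w $ 1 $ 1 * N w $ 1 $ 1 = - (N w $ 1 $ 2 * N w $ 2 $ 1)"
    "(cmod (N w $ 1 $ 1))\<^sup>2 = cmod (N w $ 1 $ 2) * cmod (N w $ 2 $ 1)"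
    "N w $ 2 $ 2 = - N w $ 1 $ 1"
proof -
  have "N w $ 2 $ 2 = - N w $ 1 $ 1" and "det (N w) = 0"
    using assms unfolding null_frame_def by blast+
  then show 22: "N w $ 2 $ 2 = - N w $ 1 $ 1"
    and 1: "N w $ 1 $ 1 * N w $ 1 $ 1 = - (N w $ 1 $ 2 * N w $ 2 $ 1)"
    unfolding det_2 by algebra+
  show "(cmod (N w $ 1 $ 1))\<^sup>2 = cmod (N w $ 1 $ 2) * cmod (N w $ 2 $ 1)"
    using arg_cong[OF 1, of cmod] by (simp add: norm_mult power2_eq_square)
qed

lemma null_frame_deriv:
  assumes "null_frame f F N" "w \<in> left_half_plane"
  shows "matrix_deriv F w = F w ** N w" "matrix_inv (F w) ** matrix_deriv F w = N w"
proof -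
  have d: "\<And>i j. ((\<lambda>u. F u $ i $ j) has_field_derivative (F w ** N w) $ i $ j) (at w)"
    and 1: "det (F w) = 1"
    using assms unfolding null_frame_def by blast+
  show *: "matrix_deriv F w = F w ** N w"
    unfolding matrix_deriv_def using DERIV_imp_deriv[OF d] by (simp add: vec_eq_iff)
  show "matrix_inv (F w) ** matrix_deriv F w = N w"
    unfolding * matrix_inv_adjugate[OF 1] matrix_mul_assoc adjugate_mult 1 by simp
qed

text \<open>The data are g = a / c and \<omega> = c. \<open>c0\<close> makes g meromorphic,
  \<open>nd\<close> keeps |g| from being identically 1, and \<open>N0\<close> makes |b| + |c|
  positive, which is the square root of the required metric density.\<close>

lemma null_lift_of_null_frame:
  assumes fr: "null_frame f F N" and N0: "\<And>w. w \<in> left_half_plane \<Longrightarrow> N w \<noteq> 0"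
    and c0: "\<exists>w\<in>left_half_plane. N w $ 2 $ 1 \<noteq> 0"
    and nd: "\<exists>w\<in>left_half_plane. cmod (N w $ 1 $ 2) \<noteq> cmod (N w $ 2 $ 1)"
  shows "null_lift f F"
proof -
  note H = open_left_half_plane and abc = null_frame_abc[OF fr]
  define a b c where "a = (\<lambda>w. N w $ 1 $ 1)" and "b = (\<lambda>w. N w $ 1 $ 2)" and "c = (\<lambda>w. N w $ 2 $ 1)"
  have hol: "a holomorphic_on left_half_plane" "b holomorphic_on left_half_plane" "c
    holomorphic_on left_half_plane"
    using fr unfolding null_frame_def a_def b_def c_def by blast+
  have lim: "(a \<longlongrightarrow> a p) (at p)" "(b \<longlongrightarrow> b p) (at p)" "(c \<longlongrightarrow> c p) (at p)" if "p \<in> left_half_plane" for p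
    using hol[THEN holomorphic_on_imp_continuous_on] H(1) that
    by (auto simp: continuous_on_eq_continuous_at isCont_def)
  have inH: "\<forall>\<^sub>F w in at p. w \<in> left_half_plane" if "p \<in> left_half_plane" for p
    using eventually_at_in_open'[OF H(1) that] .
  \<comment> \<open>By the identity theorem the zeros of \<open>c\<close> are isolated, so every
    statement about \<open>g\<close> can be checked on a punctured neighbourhood.\<close>
  have evc: "\<forall>\<^sub>F w in at p. c w \<noteq> 0" if p: "p \<in> left_half_plane" for p
  proof (cases "c p = 0")
    case True
    obtain \<beta> where \<beta>: "\<beta> \<in> left_half_plane" "c \<beta> \<noteq> 0" using c0 by (auto simp: c_def)
    obtain r where r: "0 < r" "ball p r \<subseteq> left_half_plane" "\<And>z. z \<in> ball p r - {p} \<Longrightarrow> c z \<noteq> 0"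
      using isolated_zeros[OF hol(3) H(1) convex_connected[OF H(2)] p True \<beta>] by metis
    then show ?thesis unfolding eventually_at
      by (intro exI[of _ r]) (auto simp: dist_commute)
  next
    case False
    then show ?thesis using lim(3)[OF p] tendsto_imp_eventually_ne by blast
  qed
  \<comment> \<open>The bare quotient takes the value 0 at every zero of \<open>c\<close>;
    \<open>remove_sings\<close> inserts the limit where \<open>a\<close> compensates the
    zero.\<close>
  define g where "g = remove_sings (\<lambda>w. a w / c w)"
  have an: "a analytic_on left_half_plane" "c analytic_on left_half_plane"
    using hol H(1) by (auto simp: analytic_on_open)
  have g: "g nicely_meromorphic_on left_half_plane"
    unfolding g_def using an
    by (intro remove_sings_nicely_meromorphic meromorphic_on_divide analytic_on_imp_meromorphic_on)
  have g_an: "(\<lambda>w. a w / c w) analytic_on {w}" if "w \<in> left_half_plane" "c w \<noteq> 0" for w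
    using an that by (intro analytic_on_divide) (auto intro: analytic_on_subset)
  have g_eq: "g w = a w / c w" if "w \<in> left_half_plane" "c w \<noteq> 0" for w
    unfolding g_def using g_an[OF that] by simp
  have evg: "\<forall>\<^sub>F w in at p. c w \<noteq> 0 \<and> g w = a w / c w \<and> w \<in> left_half_plane"
    if "p \<in> left_half_plane" for p
    using evc[OF that] inH[OF that] by eventually_elim (auto simp: g_eq)
  have nopole: "\<not> is_pole g w" if "w \<in> left_half_plane" "c w \<noteq> 0" for w
  proof -
    have "((\<lambda>w. a w / c w) \<longlongrightarrow> a w / c w) (at w)"
      using lim[OF that(1)] that(2) by (intro tendsto_divide)
    moreover have "\<forall>\<^sub>F u in at w. a u / c u = g u" using evg[OF that(1)] by eventually_elim auto
    ultimately have "(g \<longlongrightarrow> a w / c w) (at w)" by (rule Lim_transform_eventually)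
    then show ?thesis unfolding is_pole_def using not_tendsto_and_filterlim_at_infinity at_neq_bot
      by blast
  qed
  \<comment> \<open>At a zero of \<open>c\<close> that is not a pole of \<open>g\<close> these
    equations are not cancellations in a fraction; they are obtained as limits.\<close>
  have gc: "g w * c w = a w" "- (g w)\<^sup>2 * c w = b w" if w: "w \<in> left_half_plane" "\<not> is_pole g w"
    for w
  proof -
    have gl: "(g \<longlongrightarrow> g w) (at w)"
      using g w unfolding nicely_meromorphic_on_def by blast
    have "((\<lambda>u. g u * c u) \<longlongrightarrow> g w * c w) (at w)" by (intro tendsto_mult gl lim w)
    moreover have "\<forall>\<^sub>F u in at w. g u * c u = a u" using evg[OF w(1)] by eventually_elim auto
    ultimately have "(a \<longlongrightarrow> g w * c w) (at w)" by (rule Lim_transform_eventually)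
    then show 1: "g w * c w = a w" using lim(1)[OF w(1)] tendsto_unique[OF at_neq_bot] by blast
    have "((\<lambda>u. - (g u * a u)) \<longlongrightarrow> - (g w * a w)) (at w)" by (intro tendsto_intros gl lim w)
    moreover have "\<forall>\<^sub>F u in at w. - (g u * a u) = b u"
      using evg[OF w(1)]
    proof eventually_elim
      case (elim u)
      then have "a u * a u = - (b u * c u)" using abc(1) by (simp add: a_def b_def c_def)
      then show ?case using elim by (simp add: field_simps)
    qed
    ultimately have "(b \<longlongrightarrow> - (g w * a w)) (at w)" by (rule Lim_transform_eventually)
    then have "- (g w * a w) = b w" using lim(2)[OF w(1)] tendsto_unique[OF at_neq_bot] by blast
    then show "- (g w)\<^sup>2 * c w = b w" unfolding 1[symmetric]
      by (simp add: power2_eq_square mult.assoc)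
  qed
  have data: "null_lift_data F g c"
    unfolding null_lift_data_def
  proof (intro conjI ballI allI impI)
    show "g nicely_meromorphic_on left_half_plane" by (rule g)
    show "c holomorphic_on left_half_plane" by (rule hol)
    show "\<exists>w\<in>left_half_plane. \<not> is_pole g w \<and> cmod (g w) \<noteq> 1"
    proof -
      obtain p where p: "p \<in> left_half_plane" "cmod (b p) - cmod (c p) \<noteq> 0"
        using nd by (auto simp: b_def c_def)
      have "((\<lambda>w. cmod (b w) - cmod (c w)) \<longlongrightarrow> cmod (b p) - cmod (c p)) (at p)"
        by (intro tendsto_intros lim p)
      then have "\<forall>\<^sub>F w in at p. cmod (b w) - cmod (c w) \<noteq> 0"
        using p(2) tendsto_imp_eventually_ne by blast
      then have "\<forall>\<^sub>F w in at p. cmod (b w) - cmod (c w) \<noteq> 0 \<and> c w \<noteq> 0 \<and> w \<in> left_half_plane"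
        using evg[OF p(1)] by eventually_elim auto
      then obtain w where w: "cmod (b w) - cmod (c w) \<noteq> 0" "c w \<noteq> 0" "w \<in> left_half_plane"
        using eventually_happens[of _ "at p"] at_neq_bot by blast
      have "cmod (g w) \<noteq> 1"
      proof
        assume "cmod (g w) = 1"
        then have "cmod (a w) = cmod (c w)" using g_eq[OF w(3,2)] w(2) by (simp add: norm_divide)
        then have "cmod (c w) * cmod (c w) = cmod (b w) * cmod (c w)"
          using abc(2)[OF w(3)] by (simp add: a_def b_def c_def power2_eq_square)
        then show False using w by simp
      qed
      then show ?thesis using w nopole by blast
    qed
    show "(\<lambda>w. F w $ i $ j) holomorphic_on left_half_plane" for i j
      using fr H(1) unfolding null_frame_def by (metis holomorphic_on_open)
    show "F ` left_half_plane \<subseteq> SL2C" using fr unfolding null_frame_def SL2C_def by blast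
    fix p assume p: "p \<in> left_half_plane"
    show "\<exists>l>0. ((\<lambda>w. (1 + (cmod (g w))\<^sup>2)\<^sup>2 * (cmod (c w))\<^sup>2) \<longlongrightarrow> l) (at p)"
    proof (intro exI conjI)
      \<comment> \<open>Near p, (1 + |g|^2) |c| equals |c| + |b|, which is continuous even at the
        poles of \<open>g\<close>.\<close>
      show "((\<lambda>w. (1 + (cmod (g w))\<^sup>2)\<^sup>2 * (cmod (c w))\<^sup>2) \<longlongrightarrow> (cmod (c p) + cmod (b p))\<^sup>2) (at p)"
      proof (rule Lim_transform_eventually)
        show "((\<lambda>w. (cmod (c w) + cmod (b w))\<^sup>2) \<longlongrightarrow> (cmod (c p) + cmod (b p))\<^sup>2) (at p)"
          by (intro tendsto_intros lim p)
        show "\<forall>\<^sub>F w in at p. (cmod (c w) + cmod (b w))\<^sup>2 = (1 + (cmod (g w))\<^sup>2)\<^sup>2 * (cmod (c w))\<^sup>2"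
          using evg[OF p]
        proof eventually_elim
          case (elim w)
          then have "(cmod (a w))\<^sup>2 = cmod (b w) * cmod (c w)" using abc(2)
            by (simp add: a_def b_def c_def)
          then have "(cmod (g w))\<^sup>2 = cmod (b w) / cmod (c w)"
            using elim by (simp add: norm_divide power_divide power2_eq_square)
          then have "(1 + (cmod (g w))\<^sup>2) * cmod (c w) = cmod (c w) + cmod (b w)"
            using elim by (simp add: field_simps)
          then show ?case by (metis power_mult_distrib)
        qed
      qed
      have "c p \<noteq> 0 \<or> b p \<noteq> 0"
      proof (rule ccontr)
        assume "\<not> (c p \<noteq> 0 \<or> b p \<noteq> 0)"
        then have "c p = 0" "b p = 0" by auto
        moreover from this have "a p = 0" using abc(1)[OF p] by (simp add: a_def b_def c_def)
        ultimately have "N p = 0" using abc(3)[OF p]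
          by (simp add: a_def b_def c_def vec_eq_iff forall_2)
        then show False using N0 p by blast
      qed
      then have "cmod (c p) + cmod (b p) > 0" by (auto intro: add_pos_nonneg add_nonneg_pos)
      then show "(cmod (c p) + cmod (b p))\<^sup>2 > 0" by simp
    qed
    show "matrix_deriv F p \<noteq> 0"
    proof
      assume "matrix_deriv F p = 0"
      then have "N p = 0" using null_frame_deriv(2)[OF fr p] by (simp add: mat2_defs)
      then show False using N0 p by blast
    qed
    assume "\<not> is_pole g p"
    then show "matrix_inv (F p) ** matrix_deriv F p =
        vector [vector [g p * c p, - (g p)\<^sup>2 * c p], vector [c p, - g p * c p]]"
      using gc[OF p] abc(3)[OF p]
      unfolding null_frame_deriv(2)[OF fr p]
      by (simp add: vec_eq_iff forall_2 a_def b_def c_def)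
  qed
  moreover have "\<forall>w\<in>left_half_plane. herm (f (exp w)) = F w ** e3 ** hconj (F w)"
    using fr unfolding null_frame_def by blast
  ultimately show ?thesis unfolding null_lift_def by blast
qed

text \<open>The type of an end refers to arbitrary null lifts, so excluding the hyperbolic type
  needs frame data for any lift and not only for the constructed one. \<open>N\<close> is built from
  F and its derivative and is therefore holomorphic across the poles of g.\<close>

lemma null_frame_of_null_lift:
  assumes "null_lift f F"
  obtains N where "null_frame f F N"
proof -
  note H = open_left_half_plane
  obtain g \<omega> where d: "null_lift_data F g \<omega>"
    and X: "\<And>w. w \<in> left_half_plane \<Longrightarrow> herm (f (exp w)) = F w ** e3 ** hconj (F w)"
    using assms unfolding null_lift_def by blast
  have g: "g nicely_meromorphic_on left_half_plane"
    and Fhol: "\<And>i j. (\<lambda>w. F w $ i $ j) holomorphic_on left_half_plane"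
    and F1: "\<And>w. w \<in> left_half_plane \<Longrightarrow> det (F w) = 1"
    and eq: "\<And>w. w \<in> left_half_plane \<Longrightarrow> \<not> is_pole g w \<Longrightarrow> matrix_inv (F w) ** matrix_deriv F w =
        vector [vector [g w * \<omega> w, - (g w)\<^sup>2 * \<omega> w], vector [\<omega> w, - g w * \<omega> w]]"
    using d unfolding null_lift_data_def SL2C_def by blast+
  define N where "N = (\<lambda>w. adjugate (F w) ** matrix_deriv F w)"
  have Nhol: "(\<lambda>w. N w $ i $ j) holomorphic_on left_half_plane" for i j
  proof -
    have "(\<lambda>w. adjugate (F w) $ i $ j) holomorphic_on left_half_plane" for i j
      using exhaust_2[of i] exhaust_2[of j] Fhol unfolding adjugate_def
      by (auto intro!: holomorphic_intros)
    moreover have "(\<lambda>w. matrix_deriv F w $ i $ j) holomorphic_on left_half_plane" for i j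
      unfolding matrix_deriv_def using holomorphic_deriv[OF Fhol H(1)] by simp
    ultimately show ?thesis
      unfolding N_def matrix_matrix_mult_def by (simp, intro holomorphic_intros) blast+
  qed
  \<comment> \<open>The poles of \<open>g\<close> are isolated, so a holomorphic function that
    vanishes away from them vanishes at them by continuity.\<close>
  have zero: "\<phi> w = 0"
    if hol: "\<phi> holomorphic_on left_half_plane" and w: "w \<in> left_half_plane"
      and z: "\<And>w. w \<in> left_half_plane \<Longrightarrow> \<not> is_pole g w \<Longrightarrow> \<phi> w = 0" for \<phi> :: "complex \<Rightarrow> complex" and w
  proof -
    have "isolated_singularity_at g w"
      using g w meromorphic_on_isolated_singularity meromorphic_on_subset
      unfolding nicely_meromorphic_on_def by (metis empty_subsetI insert_subset)
    then have "\<forall>\<^sub>F u in at w. \<not> is_pole g u" by (rule eventually_not_pole)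
    moreover have "\<forall>\<^sub>F u in at w. u \<in> left_half_plane" using eventually_at_in_open'[OF H(1) w] .
    ultimately have "\<forall>\<^sub>F u in at w. \<phi> u = 0" by eventually_elim (use z in auto)
    moreover have "(\<phi> \<longlongrightarrow> \<phi> w) (at w)"
      using holomorphic_on_imp_continuous_on[OF hol] H(1) w
      by (auto simp: continuous_on_eq_continuous_at isCont_def)
    ultimately have "((\<lambda>_. 0) \<longlongrightarrow> \<phi> w) (at w)" by (rule Lim_transform_eventually[rotated])
    then show ?thesis using tendsto_unique[OF at_neq_bot tendsto_const] by metis
  qed
  have Neq: "N w = vector [vector [g w * \<omega> w, - (g w)\<^sup>2 * \<omega> w], vector [\<omega> w, - g w * \<omega> w]]"
    if "w \<in> left_half_plane" "\<not> is_pole g w" for w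
    unfolding N_def using eq[OF that] matrix_inv_adjugate[OF F1[OF that(1)]] by simp
  have "null_frame f F N"
    unfolding null_frame_def
  proof (intro conjI ballI allI)
    show "(\<lambda>w. N w $ i $ j) holomorphic_on left_half_plane" for i j by (rule Nhol)
    fix w assume w: "w \<in> left_half_plane"
    have "F w ** N w = matrix_deriv F w"
      unfolding N_def matrix_mul_assoc adjugate_mult F1[OF w] by simp
    then show "((\<lambda>u. F u $ i $ j) has_field_derivative (F w ** N w) $ i $ j) (at w)" for i j
      using holomorphic_derivI[OF Fhol H(1) w] by (simp add: matrix_deriv_def)
    show "det (F w) = 1" by (rule F1[OF w])
    show "herm (f (exp w)) = F w ** e3 ** hconj (F w)" by (rule X[OF w])
    have "N w $ 2 $ 2 + N w $ 1 $ 1 = 0"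
      by (rule zero[of "\<lambda>w. N w $ 2 $ 2 + N w $ 1 $ 1", OF _ w])
         (auto intro!: holomorphic_intros Nhol simp: Neq)
    then show "N w $ 2 $ 2 = - N w $ 1 $ 1" by (simp add: eq_neg_iff_add_eq_0)
    show "det (N w) = 0"
      unfolding det_2
      by (rule zero[of "\<lambda>w. N w $ 1 $ 1 * N w $ 2 $ 2 - N w $ 1 $ 2 * N w $ 2 $ 1", OF _ w])
         (auto intro!: holomorphic_intros Nhol simp: Neq power2_eq_square)
  qed
  then show thesis using that by blast
qed

text \<open>The factor \<open>P\<close> preserves \<open>e3\<close> and hence the surface;
  \<open>N\<close> is conjugated, which moves g by a Moebius map of the disk.\<close>

lemma null_frame_right_mult:
  assumes fr: "null_frame f F N" and P: "P \<in> SU11"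
  shows "null_frame f (\<lambda>w. F w ** P) (\<lambda>w. adjugate P ** N w ** P)"
proof -
  have dP: "det P = 1" and PeP: "P ** e3 ** hconj P = e3" using P by (auto simp: SU11_def SL2C_def)
  show ?thesis unfolding null_frame_def
  proof (intro conjI ballI allI)
    have Nhol: "\<And>i j. (\<lambda>w. N w $ i $ j) holomorphic_on left_half_plane"
      using fr unfolding null_frame_def by blast
    show "(\<lambda>w. (adjugate P ** N w ** P) $ i $ j) holomorphic_on left_half_plane" for i j
      unfolding matrix_matrix_mult_def by (simp, intro holomorphic_intros Nhol)
    fix w assume w: "w \<in> left_half_plane"
    have Fd: "\<And>i j. ((\<lambda>u. F u $ i $ j) has_field_derivative (F w ** N w) $ i $ j) (at w)"
      and F1: "det (F w) = 1" and X: "herm (f (exp w)) = F w ** e3 ** hconj (F w)"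
      and N22: "N w $ 2 $ 2 = - N w $ 1 $ 1" and N0: "det (N w) = 0"
      using fr w unfolding null_frame_def by blast+
    have "F w ** P ** (adjugate P ** N w ** P) = F w ** (P ** adjugate P) ** N w ** P"
      by (simp only: matrix_mul_assoc)
    also have "\<dots> = F w ** N w ** P" unfolding adjugate_mult dP by simp
    finally have *: "F w ** P ** (adjugate P ** N w ** P) = F w ** N w ** P" .
    show "((\<lambda>u. (F u ** P) $ i $ j) has_field_derivative (F w ** P ** (adjugate P ** N w ** P)) $
      i $ j) (at w)" for i j
    proof -
      have "((\<lambda>u. F u $ i $ 1 * P $ 1 $ j + F u $ i $ 2 * P $ 2 $ j) has_field_derivative
        ((F w ** N w) $ i $ 1 * P $ 1 $ j + (F w ** N w) $ i $ 2 * P $ 2 $ j)) (at w)"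
        by (intro DERIV_add DERIV_cmult_right Fd)
      moreover have "(A ** P) $ i $ j = A $ i $ 1 * P $ 1 $ j + A $ i $ 2 * P $ 2 $ j"
        for A :: "complex^2^2"
        by (simp add: matrix_matrix_mult_def sum_2)
      ultimately show ?thesis unfolding * by simp
    qed
    show "det (F w ** P) = 1" by (simp add: det_mul F1 dP)
    have "F w ** P ** e3 ** hconj (F w ** P) = F w ** (P ** e3 ** hconj P) ** hconj (F w)"
      by (simp add: hconj_simps matrix_mul_assoc)
    then show "herm (f (exp w)) = F w ** P ** e3 ** hconj (F w ** P)" unfolding PeP X ..
    have "adjugate (N w) = - N w" using N22 by (simp add: mat2_defs)
    moreover have "adjugate (adjugate P ** N w ** P) = adjugate P ** adjugate (N w) ** P"
      by (simp add: adjugate_simps matrix_mul_assoc) (simp add: adjugate_def mat2_defs)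
    ultimately have "adjugate (adjugate P ** N w ** P) = - (adjugate P ** N w ** P)"
      by (simp add: mat2_mult_simps)
    then have "adjugate (adjugate P ** N w ** P) $ 1 $ 1 = (- (adjugate P ** N w ** P)) $ 1 $ 1"
      by simp
    then show "(adjugate P ** N w ** P) $ 2 $ 2 = - (adjugate P ** N w ** P) $ 1 $ 1"
      unfolding adjugate_def[of "adjugate P ** N w ** P"] by simp
    show "det (adjugate P ** N w ** P) = 0" by (simp add: det_mul N0)
  qed
qed

section \<open>The group SU(1,1)\<close>

definition su11 :: "complex \<Rightarrow> complex \<Rightarrow> complex^2^2" where
  "su11 p q = vector [vector [p, q], vector [cnj q, cnj p]]"

lemma su11_in_SU11:
  assumes "(cmod p)\<^sup>2 - (cmod q)\<^sup>2 = 1"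
  shows "su11 p q \<in> SU11"
proof -
  have "p * cnj p - q * cnj q = 1"
    using assms by (simp only: complex_norm_square[symmetric] of_real_diff[symmetric]) simp
  then show ?thesis
    unfolding SU11_def SL2C_def su11_def by (auto simp: mat2_defs algebra_simps)
qed

lemma SU11_E:
  assumes "\<rho> \<in> SU11"
  obtains p q where "\<rho> = su11 p q" "(cmod p)\<^sup>2 - (cmod q)\<^sup>2 = 1"
proof -
  define p q r s where "p = \<rho>$1$1" and "q = \<rho>$1$2" and "r = \<rho>$2$1" and "s = \<rho>$2$2"
  have d: "p * s - q * r = 1"
    using assms by (simp add: SU11_def SL2C_def det_2 p_def q_def r_def s_def)
  have "\<rho> ** e3 ** hconj \<rho> = e3" using assms by (simp add: SU11_def)
  then have 1: "p * cnj p - q * cnj q = 1" and 2: "r * cnj p = s * cnj q"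
    by (simp_all add: mat2_defs p_def q_def r_def s_def)
  have "cnj p = cnj p * (p * s - q * r)" using d by simp
  also have "\<dots> = p * cnj p * s - q * (r * cnj p)" by (simp add: algebra_simps)
  also have "\<dots> = (p * cnj p - q * cnj q) * s" unfolding 2 by (simp add: algebra_simps)
  finally have s: "s = cnj p" using 1 by simp
  have "cnj q = cnj q * (p * s - q * r)" using d by simp
  also have "\<dots> = p * (s * cnj q) - q * cnj q * r" by (simp add: algebra_simps)
  also have "\<dots> = (p * cnj p - q * cnj q) * r" unfolding 2[symmetric] by (simp add: algebra_simps)
  finally have r: "r = cnj q" using 1 by simp
  have "complex_of_real ((cmod p)\<^sup>2 - (cmod q)\<^sup>2) = of_real 1"
    unfolding of_real_diff complex_norm_square 1 by simp
  then have "(cmod p)\<^sup>2 - (cmod q)\<^sup>2 = 1" using of_real_eq_iff by blast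
  moreover have "\<rho> = su11 p q"
    using r s unfolding su11_def p_def q_def r_def s_def by (simp add: vec_eq_iff forall_2)
  ultimately show thesis using that by blast
qed

text \<open>An intertwiner of positive determinant suffices: dividing by the square root of the
  determinant puts it into SU(1,1) and does not affect the equation.\<close>

lemma conj_SU11I:
  assumes d: "(cmod \<alpha>)\<^sup>2 - (cmod \<beta>)\<^sup>2 > 0" and eq: "A ** su11 \<alpha> \<beta> = su11 \<alpha> \<beta> ** B"
  shows "conj_SU11 A B"
proof -
  define m where "m = (cmod \<alpha>)\<^sup>2 - (cmod \<beta>)\<^sup>2"
  define k where "k = 1 / sqrt m"
  define P where "P = su11 (of_real k * \<alpha>) (of_real k * \<beta>)"
  have k2: "k\<^sup>2 * ((cmod \<alpha>)\<^sup>2 - (cmod \<beta>)\<^sup>2) = 1"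
    using d unfolding m_def[symmetric] by (simp add: k_def power_divide)
  have P: "P \<in> SU11" unfolding P_def
    by (rule su11_in_SU11) (use k2 in \<open>simp add: norm_mult power_mult_distrib algebra_simps\<close>)
  then have dP: "det P = 1" by (simp add: SU11_def SL2C_def)
  have Pk: "P = cscale (of_real k) (su11 \<alpha> \<beta>)" by (simp add: P_def su11_def mat2_defs)
  have "A ** P = P ** B" unfolding Pk cscale_simps eq ..
  then have "P ** B ** adjugate P = A ** (P ** adjugate P)" by (simp add: matrix_mul_assoc)
  also have "\<dots> = A" unfolding adjugate_mult dP by simp
  finally show ?thesis
    using P matrix_inv_adjugate[OF dP] unfolding conj_SU11_def by metis
qed

text \<open>The trace is 2 Re p. If |Re p| < 1, the eigenvalues are unimodular and not real, and
  eigenvectors diagonalise the matrix. If |Re p| = 1, the matrix is plus or minus the identity,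
  which counts as elliptic, or a diagonal conjugation rotates \<open>q\<close> into the normal form
  of a parabolic element.\<close>

lemma su11_elliptic_or_parabolic:
  assumes pq: "(cmod p)\<^sup>2 - (cmod q)\<^sup>2 = 1" and tr: "\<bar>Re p\<bar> \<le> 1"
  shows "elliptic (su11 p q) \<or> parabolic (su11 p q)"
proof -
  define \<tau> \<sigma> where "\<tau> = Re p" and "\<sigma> = Im p"
  have p: "p = of_real \<tau> + \<i> * of_real \<sigma>" by (simp add: \<tau>_def \<sigma>_def complex_eq_iff)
  have q2: "(cmod q)\<^sup>2 = \<tau>\<^sup>2 + \<sigma>\<^sup>2 - 1" using pq by (simp add: cmod_power2[of p] \<tau>_def \<sigma>_def)
  then have qq: "q * cnj q = of_real (\<tau>\<^sup>2 + \<sigma>\<^sup>2 - 1)" by (metis complex_norm_square)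
  show ?thesis
  proof (cases "\<bar>\<tau>\<bar> < 1")
    case True
    then have t1: "\<tau>\<^sup>2 < 1" by (simp add: abs_square_less_1)
    have s0: "\<sigma> \<noteq> 0" using q2 t1 zero_le_power2[of "cmod q"] by auto
    \<comment> \<open>Of the two eigenvalues \<tau> + i \<kappa> and \<tau> - i \<kappa>, the one
      whose imaginary part has the sign of \<open>\<sigma>\<close> is taken; this makes the
      intertwiner below have positive determinant.\<close>
    define \<kappa> where "\<kappa> = sgn \<sigma> * sqrt (1 - \<tau>\<^sup>2)"
    have k2: "\<kappa>\<^sup>2 = 1 - \<tau>\<^sup>2" using t1 s0 by (simp add: \<kappa>_def power_mult_distrib
      power2_eq_square[of "sgn \<sigma>"] sgn_if)
    have ks: "\<kappa> * \<sigma> > 0" using t1 s0 by (simp add: \<kappa>_def sgn_if zero_less_mult_iff mult_less_0_iff)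
    define e where "e = Complex \<tau> \<kappa>"
    have "cmod e = 1" using k2 by (simp add: e_def cmod_def)
    moreover from this have "e \<noteq> 0" by force
    ultimately have e: "cis (Arg e) = e" using cis_Arg[of e] by (simp add: sgn_div_norm)
    \<comment> \<open>The column (\<alpha>, cnj \<beta>) is an eigenvector for \<open>e\<close>,
      because \<sigma>^2 - \<kappa>^2 = |q|^2. The second column of the intertwiner belongs to
      \<open>cnj e\<close>.\<close>
    define \<alpha> \<beta> where "\<alpha> = \<i> * of_real (\<kappa> + \<sigma>)" and "\<beta> = q"
    have "(cmod \<alpha>)\<^sup>2 - (cmod \<beta>)\<^sup>2 = (\<kappa> + \<sigma>)\<^sup>2 - (\<tau>\<^sup>2 + \<sigma>\<^sup>2 - 1)"
      unfolding \<alpha>_def \<beta>_def q2 norm_mult norm_of_real by simp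
    also have "\<dots> = 2 * \<kappa>\<^sup>2 + 2 * (\<kappa> * \<sigma>)" using k2 by (simp add: power2_sum algebra_simps)
    also have "\<dots> > 0" using ks zero_le_power2[of \<kappa>] by linarith
    finally have d: "(cmod \<alpha>)\<^sup>2 - (cmod \<beta>)\<^sup>2 > 0" .
    have e': "e = of_real \<tau> + \<i> * of_real \<kappa>" by (simp add: e_def complex_eq_iff)
    have kk: "complex_of_real \<kappa> * of_real \<kappa> = 1 - of_real \<tau> * of_real \<tau>"
      using arg_cong[OF k2, of complex_of_real] by (simp add: power2_eq_square)
    have m11: "p * \<alpha> + q * cnj \<beta> = \<alpha> * e"
    proof -
      have "p * \<alpha> + q * cnj \<beta> - \<alpha> * e = (of_real \<kappa> * of_real \<kappa> - 1 + of_real \<tau> * of_real \<tau>)"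
        unfolding \<alpha>_def \<beta>_def qq p e' by (simp add: algebra_simps power2_eq_square)
      then show ?thesis unfolding kk by simp
    qed
    have m21: "cnj q * \<alpha> + cnj p * cnj \<beta> = cnj \<beta> * e"
      unfolding \<alpha>_def \<beta>_def p e' by (simp add: algebra_simps)
    have "su11 p q ** su11 \<alpha> \<beta> = su11 \<alpha> \<beta> ** Lambda_e (Arg e)"
    proof -
      have ce: "cis (- Arg e) = cnj e" by (metis cis_cnj e)
      have "q * cnj \<alpha> + p * \<beta> = \<beta> * cnj e" "cnj p * cnj \<alpha> + cnj q * \<beta> = cnj \<alpha> * cnj e"
        using arg_cong[OF m21, of cnj] arg_cong[OF m11, of cnj]
        by (simp_all only: complex_cnj_add complex_cnj_mult complex_cnj_cnj)
      then show ?thesis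
        using m11 m21 by (simp add: su11_def Lambda_e_def mat2_defs e ce add.commute)
    qed
    from conj_SU11I[OF d this] have "elliptic (su11 p q)"
      unfolding elliptic_def using Arg_bounded[of e] by auto
    then show ?thesis ..
  next
    case False
    then have t: "\<tau> = 1 \<or> \<tau> = -1" using tr by (auto simp: \<tau>_def)
    then have q2': "(cmod q)\<^sup>2 = \<sigma>\<^sup>2" using q2 by auto
    show ?thesis
    proof (cases "\<sigma> = 0")
      case True
      then have "q = 0" "p = of_real \<tau>" using q2' p by auto
      then have "su11 p q ** su11 1 0 = su11 1 0 ** Lambda_e (if \<tau> = 1 then 0 else pi)"
        using t by (auto simp: su11_def Lambda_e_def mat2_defs cis_pi simp flip: cis_cnj)
      then have "conj_SU11 (su11 p q) (Lambda_e (if \<tau> = 1 then 0 else pi))"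
        by (intro conj_SU11I[of 1 0]) auto
      moreover have "- pi < (if \<tau> = 1 then 0 else pi)" "(if \<tau> = 1 then 0 else pi) \<le> pi"
        using pi_gt_zero by auto
      ultimately show ?thesis unfolding elliptic_def by blast
    next
      case False
      \<comment> \<open>Unimodular because |q| = |\<sigma>|; conjugation by diag(\<alpha>, cnj
        \<alpha>) turns the off-diagonal entry \<open>q\<close> into - i \<sigma>.\<close>
      define \<alpha> where "\<alpha> = csqrt (\<i> * q / of_real \<sigma>)"
      have aa: "\<alpha> * \<alpha> = \<i> * q / of_real \<sigma>" unfolding \<alpha>_def by (metis power2_csqrt power2_eq_square)
      have "cmod q = \<bar>\<sigma>\<bar>" using q2' by (metis abs_norm_cancel real_sqrt_abs)
      then have "cmod (\<alpha> * \<alpha>) = 1" unfolding aa using False by (simp add: norm_divide norm_mult)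
      then have "cmod \<alpha> = 1" by (metis abs_norm_cancel abs_square_eq_1 norm_mult power2_eq_square)
      then have ac: "\<alpha> * cnj \<alpha> = 1" by (simp add: complex_norm_square[symmetric])
      have "q = - \<i> * of_real \<sigma> * (\<alpha> * \<alpha>)" unfolding aa using False by simp
      then have qa: "q * cnj \<alpha> = - \<i> * of_real \<sigma> * \<alpha>"
        using ac by (metis (no_types, opaque_lifting) mult.assoc mult.right_neutral)
      have qa': "cnj q * \<alpha> = \<i> * of_real \<sigma> * cnj \<alpha>"
        using arg_cong[OF qa, of cnj]
        by (simp only: complex_cnj_mult complex_cnj_cnj complex_cnj_minus complex_cnj_i
            complex_cnj_complex_of_real minus_minus)
      have d: "(cmod \<alpha>)\<^sup>2 - (cmod 0)\<^sup>2 > 0" using \<open>cmod \<alpha> = 1\<close> by simp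
      show ?thesis
      proof (cases "\<tau> = 1")
        case True
        then have "su11 p q ** su11 \<alpha> 0 = su11 \<alpha> 0 ** Lambda_p \<sigma>"
          using qa qa' by (simp add: su11_def Lambda_p_def mat2_defs p algebra_simps)
        from conj_SU11I[OF d this] show ?thesis unfolding parabolic_def using False by blast
      next
        case tm: False
        then have "\<tau> = -1" using t by simp
        then have "su11 p q ** su11 \<alpha> 0 = su11 \<alpha> 0 ** (- Lambda_p (- \<sigma>))"
          using qa qa' by (simp add: su11_def Lambda_p_def mat2_defs p algebra_simps)
        from conj_SU11I[OF d this] show ?thesis unfolding parabolic_def using False
          by (metis neg_equal_0_iff_equal)
      qed
    qed
  qed
qed

lemma cosh_real_gt_1: "cosh t > 1" if "t > 0" for t :: real
proof -
  have "cosh t * cosh t = 1 + sinh t * sinh t"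
    using cosh_square_eq[of t] by (simp add: power2_eq_square)
  moreover have "sinh t * sinh t > 0" using that by simp
  ultimately have "cosh t * cosh t > 1" by linarith
  then show ?thesis using cosh_real_pos[of t] by (smt (verit) mult_le_one)
qed

text \<open>The trace is invariant under conjugation, equals 2 Re p on the left and plus or minus 2
  cosh t for the normal forms.\<close>

lemma hyperbolic_trace:
  assumes "hyperbolic (su11 p q)"
  shows "\<bar>Re p\<bar> > 1"
proof -
  obtain t where t: "t > 0" "conj_SU11 (su11 p q) (Lambda_h t) \<or> conj_SU11 (su11 p q) (- Lambda_h
    t)"
    using assms unfolding hyperbolic_def by blast
  have tr: "trace (su11 p q) = trace B" if conj: "conj_SU11 (su11 p q) B" for B
  proof -
    obtain P where P: "P \<in> SU11" "su11 p q = P ** B ** matrix_inv P" using conj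
      unfolding conj_SU11_def by blast
    have dP: "det P = 1" using P by (simp add: SU11_def SL2C_def)
    have "trace (su11 p q) = trace (adjugate P ** (P ** B))"
      unfolding P(2) matrix_inv_adjugate[OF dP] by (rule trace_mul_sym)
    also have "adjugate P ** (P ** B) = B"
      unfolding matrix_mul_assoc adjugate_mult dP by simp
    finally show ?thesis .
  qed
  have "trace (su11 p q) = of_real (2 * Re p)"
    by (simp add: trace_def sum_2 su11_def complex_eq_iff)
  moreover have "trace (Lambda_h t) = of_real (2 * cosh t)" "trace (- Lambda_h t)
    = of_real (- 2 * cosh t)"
    by (simp_all add: trace_def sum_2 Lambda_h_def)
  ultimately have "2 * Re p = 2 * cosh t \<or> 2 * Re p = - 2 * cosh t"
    using t(2) tr of_real_eq_iff by metis
  then show ?thesis using cosh_real_gt_1[OF t(1)] by auto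
qed

section \<open>The Gauss map near the end\<close>

text \<open>Differentiate the monodromy relation of F and cancel F and \<open>\<rho>\<close>, both
  of determinant 1, with their adjugates.\<close>

lemma null_frame_monodromy_N:
  assumes fr: "null_frame f F N" and mono: "\<And>w. w \<in> left_half_plane \<Longrightarrow> F (w + 2 * of_real pi * \<i>)
    = F w ** \<rho>"
    and \<rho>: "det \<rho> = 1" and w: "w \<in> left_half_plane"
  shows "N (w + 2 * of_real pi * \<i>) = adjugate \<rho> ** N w ** \<rho>"
proof -
  define \<tau> where "\<tau> = 2 * complex_of_real pi * \<i>"
  note H = open_left_half_plane
  have w': "w + \<tau> \<in> left_half_plane" using w by (simp add: left_half_plane_def \<tau>_def)
  have Fd: "\<And>w i j. w \<in> left_half_plane \<Longrightarrow> ((\<lambda>u. F u $ i $ j)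
    has_field_derivative (F w ** N w) $ i $ j) (at w)"
    and F1: "\<And>w. w \<in> left_half_plane \<Longrightarrow> det (F w) = 1"
    using fr unfolding null_frame_def by blast+
  have "(F w ** N w ** \<rho>) $ i $ j = (F (w + \<tau>) ** N (w + \<tau>)) $ i $ j" for i j
  proof -
    have 1: "((\<lambda>u. F (u + \<tau>) $ i $ j) has_field_derivative (F (w + \<tau>) ** N (w + \<tau>)) $ i $ j) (at w)"
      using Fd[OF w', of i j] by (simp add: DERIV_shift)
    have "((\<lambda>u. F u $ i $ 1 * \<rho> $ 1 $ j + F u $ i $ 2 * \<rho> $ 2 $ j) has_field_derivative
        ((F w ** N w) $ i $ 1 * \<rho> $ 1 $ j + (F w ** N w) $ i $ 2 * \<rho> $ 2 $ j)) (at w)"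
      by (intro DERIV_add DERIV_cmult_right Fd w)
    then have "((\<lambda>u. (F u ** \<rho>) $ i $ j) has_field_derivative (F w ** N w ** \<rho>) $ i $ j) (at w)"
      unfolding matrix_matrix_mult_def[of _ \<rho>] by (simp add: sum_2)
    then have "((\<lambda>u. F (u + \<tau>) $ i $ j) has_field_derivative (F w ** N w ** \<rho>) $ i $ j) (at w)"
      by (rule DERIV_cong_ev[THEN iffD1, rotated 3, OF _ refl _ refl])
         (use eventually_nhds_in_open[OF H(1) w] mono in \<open>auto elim!: eventually_mono simp: \<tau>_def\<close>)
    then show ?thesis using DERIV_unique[OF _ 1] by blast
  qed
  then have eq: "F w ** N w ** \<rho> = F (w + \<tau>) ** N (w + \<tau>)" by (simp add: vec_eq_iff)
  have Ft: "F (w + \<tau>) = F w ** \<rho>" using mono[OF w] by (simp add: \<tau>_def)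
  have "adjugate (F w ** \<rho>) ** (F w ** N w ** \<rho>) = adjugate (F w ** \<rho>) ** (F w ** \<rho>) ** N (w + \<tau>)"
    unfolding eq Ft by (simp only: matrix_mul_assoc)
  also have "\<dots> = N (w + \<tau>)" unfolding adjugate_mult det_mul F1[OF w] \<rho> by simp
  also have "adjugate (F w ** \<rho>) ** (F w ** N w ** \<rho>)
    = adjugate \<rho> ** (adjugate (F w) ** F w) ** N w ** \<rho>"
    by (simp only: adjugate_simps matrix_mul_assoc)
  also have "\<dots> = adjugate \<rho> ** N w ** \<rho>" unfolding adjugate_mult F1[OF w] by simp
  finally show ?thesis by (simp add: \<tau>_def)
qed

text \<open>\<open>k\<close> is c or b, the larger of the two in modulus; nullity makes the other
  two entries monomials in \<open>k\<close> and \<open>G\<close>, so |b| - |c| is |k| (1 - |G|^2) up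
  to sign. The coefficients of the Moebius map depend on the case, hence the existential
  \<open>p'\<close> and \<open>q'\<close>; what later matters is the half trace Re p.\<close>

lemma null_frame_end_data:
  assumes fr: "null_frame f F N" and r: "r \<le> 0"
    and nd: "\<And>w. Re w < r \<Longrightarrow> cmod (N w $ 1 $ 2) \<noteq> cmod (N w $ 2 $ 1)"
  obtains G k where "G holomorphic_on {w. Re w < r}" "k holomorphic_on {w. Re w < r}"
    "\<And>w. Re w < r \<Longrightarrow> cmod (G w) < 1" "\<And>w. Re w < r \<Longrightarrow> k w \<noteq> 0"
    "\<And>w. Re w < r \<Longrightarrow> (cmod (N w $ 1 $ 2) - cmod (N w $ 2 $ 1))\<^sup>2
      = (cmod (k w) * (1 - (cmod (G w))\<^sup>2))\<^sup>2"
    "\<And>p q. (cmod p)\<^sup>2 - (cmod q)\<^sup>2 = 1 \<Longrightarrow>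
       (\<And>w. w \<in> left_half_plane \<Longrightarrow> F (w + 2 * of_real pi * \<i>) = F w ** su11 p q) \<Longrightarrow>
       \<exists>p' q'. Re p' = Re p \<and> (cmod p')\<^sup>2 - (cmod q')\<^sup>2 = 1 \<and>
         (\<forall>w. Re w < r \<longrightarrow> G (w + 2 * of_real pi * \<i>) * (cnj q' * G w + cnj p') = p' * G w + q')"
proof -
  define S where "S = {w. Re w < r}"
  have S: "open S" "connected S"
    unfolding S_def by (auto simp: open_halfspace_Re_lt intro!: convex_connected
      convex_halfspace_Re_lt)
  have SH: "S \<subseteq> left_half_plane" using r by (auto simp: S_def left_half_plane_def)
  define \<tau> where "\<tau> = 2 * complex_of_real pi * \<i>"
  have S\<tau>: "w + \<tau> \<in> S" if "w \<in> S" for w using that by (simp add: S_def \<tau>_def)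
  define a b c where "a = (\<lambda>w. N w $ 1 $ 1)" and "b = (\<lambda>w. N w $ 1 $ 2)" and "c = (\<lambda>w. N w $ 2 $ 1)"
  have "a holomorphic_on left_half_plane" "b holomorphic_on left_half_plane" "c holomorphic_on
    left_half_plane"
    using fr unfolding null_frame_def a_def b_def c_def by blast+
  then have hol: "a holomorphic_on S" "b holomorphic_on S" "c holomorphic_on S"
    using SH holomorphic_on_subset by blast+
  have abc: "a w * a w = - (b w * c w)" "(cmod (a w))\<^sup>2 = cmod (b w) * cmod (c w)" "N w $ 2 $ 2
    = - a w" if "w \<in> S" for w
    using null_frame_abc[OF fr subsetD[OF SH that]] by (auto simp: a_def b_def c_def)
  have trans: "a (w + \<tau>) = (p * cnj p + q * cnj q) * a w + cnj p * cnj q * b w - p * q * c w"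
      "b (w + \<tau>) = 2 * cnj p * q * a w + cnj p * cnj p * b w - q * q * c w"
      "c (w + \<tau>) = - 2 * p * cnj q * a w - cnj q * cnj q * b w + p * p * c w"
    if pq: "(cmod p)\<^sup>2 - (cmod q)\<^sup>2 = 1" and w: "w \<in> S"
      and mono: "\<forall>w\<in>left_half_plane. F (w + 2 * of_real pi * \<i>) = F w ** su11 p q" for p q w
  proof -
    have "det (su11 p q) = 1" using su11_in_SU11[OF pq] by (simp add: SU11_def SL2C_def)
    then have N\<tau>: "N (w + \<tau>) = adjugate (su11 p q) ** N w ** su11 p q"
      unfolding \<tau>_def using null_frame_monodromy_N[OF fr] mono w SH by blast
    show "a (w + \<tau>) = (p * cnj p + q * cnj q) * a w + cnj p * cnj q * b w - p * q * c w"
      "b (w + \<tau>) = 2 * cnj p * q * a w + cnj p * cnj p * b w - q * q * c w"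
      "c (w + \<tau>) = - 2 * p * cnj q * a w - cnj q * cnj q * b w + p * p * c w"
      unfolding a_def b_def c_def N\<tau> using abc(3)[OF w]
      by (simp_all add: su11_def adjugate_def matrix_matrix_mult_def sum_2 a_def b_def c_def
        algebra_simps)
  qed
  define \<phi> where "\<phi> = (\<lambda>w. cmod (b w) - cmod (c w))"
  have "continuous_on S \<phi>"
    unfolding \<phi>_def using hol[THEN holomorphic_on_imp_continuous_on] by (intro continuous_intros)
  then have "connected (\<phi> ` S)" using S(2) connected_continuous_image by blast
  moreover have "0 \<notin> \<phi> ` S" using nd by (auto simp: \<phi>_def S_def b_def c_def)
  ultimately have "(\<forall>w\<in>S. \<phi> w < 0) \<or> (\<forall>w\<in>S. \<phi> w > 0)"
    by (smt (verit) connectedD_interval image_eqI)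
  then show thesis
  proof
    assume neg: "\<forall>w\<in>S. \<phi> w < 0"
    then have bc: "cmod (b w) < cmod (c w)" if "w \<in> S" for w using that by (auto simp: \<phi>_def)
    then have c0: "c w \<noteq> 0" if "w \<in> S" for w using that by (metis norm_not_less_zero norm_zero)
    define G where "G = (\<lambda>w. a w / c w)"
    have G2: "(cmod (G w))\<^sup>2 = cmod (b w) / cmod (c w)" if "w \<in> S" for w
      using abc(2)[OF that] c0[OF that] by (simp add: G_def norm_divide power_divide
        power2_eq_square)
    have aG: "a w = c w * G w" "b w = - (c w * G w * G w)" if "w \<in> S" for w
    proof -
      show 1: "a w = c w * G w" using c0[OF that] by (simp add: G_def)
      have "- (b w * c w) = c w * G w * (c w * G w)" using abc(1)[OF that] unfolding 1 by simp
      then have "c w * (b w + c w * G w * G w) = 0" by algebra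
      then show "b w = - (c w * G w * G w)" using c0[OF that] by (simp add: eq_neg_iff_add_eq_0)
    qed
    show thesis
    proof (rule that[of G c])
      show "G holomorphic_on {w. Re w < r}" "c holomorphic_on {w. Re w < r}"
        unfolding S_def[symmetric] G_def using hol c0 by (auto intro!: holomorphic_intros)
      fix w assume "Re w < r"
      then have w: "w \<in> S" by (simp add: S_def)
      show "c w \<noteq> 0" by (rule c0[OF w])
      have "(cmod (G w))\<^sup>2 < 1" unfolding G2[OF w] using bc[OF w] c0[OF w] by simp
      then show "cmod (G w) < 1" by (simp add: abs_square_less_1)
      have "cmod (c w) * (1 - (cmod (G w))\<^sup>2) = cmod (c w) - cmod (b w)"
        unfolding G2[OF w] using c0[OF w] by (simp add: algebra_simps)
      then show "(cmod (N w $ 1 $ 2) - cmod (N w $ 2 $ 1))\<^sup>2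
        = (cmod (c w) * (1 - (cmod (G w))\<^sup>2))\<^sup>2"
        by (simp add: b_def c_def power2_commute)
    next
      fix p q assume pq: "(cmod p)\<^sup>2 - (cmod q)\<^sup>2 = 1"
        and mono': "\<And>w. w \<in> left_half_plane \<Longrightarrow> F (w + 2 * of_real pi * \<i>) = F w ** su11 p q"
      then have mono: "\<forall>w\<in>left_half_plane. F (w + 2 * of_real pi * \<i>) = F w ** su11 p q" by blast
      \<comment> \<open>Conjugating \<open>N\<close> makes \<open>G\<close> = g transform by the
        inverse of the monodromy matrix, whose first row is \<open>cnj p\<close>,
        \<open>- q\<close>.\<close>
      have "G (w + 2 * of_real pi * \<i>) * (cnj (- q) * G w + cnj (cnj p)) = cnj p * G w + - q"
        if "Re w < r" for w
      proof -
        have w: "w \<in> S" using that by (simp add: S_def)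
        have c': "c (w + \<tau>) = c w * ((p - cnj q * G w) * (p - cnj q * G w))"
          unfolding trans(3)[OF pq w mono] aG[OF w] by (simp add: algebra_simps)
        have a': "a (w + \<tau>) = c w * ((p - cnj q * G w) * (cnj p * G w - q))"
          unfolding trans(1)[OF pq w mono] aG[OF w] by (simp add: algebra_simps)
        have nz: "p - cnj q * G w \<noteq> 0" using c0[OF S\<tau>[OF w]] unfolding c' by auto
        have "G (w + \<tau>) = (cnj p * G w - q) / (p - cnj q * G w)"
          unfolding G_def unfolding a' c' using nz c0[OF w] by (simp add: G_def)
        then have "G (w + \<tau>) * (p - cnj q * G w) = cnj p * G w - q" using nz by simp
        then show ?thesis by (simp add: \<tau>_def algebra_simps)
      qed
      then show "\<exists>p' q'. Re p' = Re p \<and> (cmod p')\<^sup>2 - (cmod q')\<^sup>2 = 1 \<and>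
         (\<forall>w. Re w < r \<longrightarrow> G (w + 2 * of_real pi * \<i>) * (cnj q' * G w + cnj p') = p' * G w + q')"
        using pq by (intro exI[of _ "cnj p"] exI[of _ "- q"]) auto
    qed
  next
    assume pos: "\<forall>w\<in>S. \<phi> w > 0"
    then have bc: "cmod (c w) < cmod (b w)" if "w \<in> S" for w using that by (auto simp: \<phi>_def)
    then have b0: "b w \<noteq> 0" if "w \<in> S" for w using that by (metis norm_not_less_zero norm_zero)
    define G where "G = (\<lambda>w. - a w / b w)"
    have G2: "(cmod (G w))\<^sup>2 = cmod (c w) / cmod (b w)" if "w \<in> S" for w
      using abc(2)[OF that] b0[OF that] by (simp add: G_def norm_divide power_divide
        power2_eq_square)
    have aG: "a w = - (b w * G w)" "c w = - (b w * G w * G w)" if "w \<in> S" for w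
    proof -
      show 1: "a w = - (b w * G w)" using b0[OF that] by (simp add: G_def)
      have "- (b w * c w) = b w * G w * (b w * G w)" using abc(1)[OF that] unfolding 1 by simp
      then have "b w * (c w + b w * G w * G w) = 0" by algebra
      then show "c w = - (b w * G w * G w)" using b0[OF that] by (simp add: eq_neg_iff_add_eq_0)
    qed
    show thesis
    proof (rule that[of G b])
      show "G holomorphic_on {w. Re w < r}" "b holomorphic_on {w. Re w < r}"
        unfolding S_def[symmetric] G_def using hol b0 by (auto intro!: holomorphic_intros)
      fix w assume "Re w < r"
      then have w: "w \<in> S" by (simp add: S_def)
      show "b w \<noteq> 0" by (rule b0[OF w])
      have "(cmod (G w))\<^sup>2 < 1" unfolding G2[OF w] using bc[OF w] b0[OF w] by simp
      then show "cmod (G w) < 1" by (simp add: abs_square_less_1)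
      have "cmod (b w) * (1 - (cmod (G w))\<^sup>2) = cmod (b w) - cmod (c w)"
        unfolding G2[OF w] using b0[OF w] by (simp add: algebra_simps)
      then show "(cmod (N w $ 1 $ 2) - cmod (N w $ 2 $ 1))\<^sup>2
        = (cmod (b w) * (1 - (cmod (G w))\<^sup>2))\<^sup>2"
        by (simp add: b_def c_def)
    next
      fix p q assume pq: "(cmod p)\<^sup>2 - (cmod q)\<^sup>2 = 1"
        and mono': "\<And>w. w \<in> left_half_plane \<Longrightarrow> F (w + 2 * of_real pi * \<i>) = F w ** su11 p q"
      then have mono: "\<forall>w\<in>left_half_plane. F (w + 2 * of_real pi * \<i>) = F w ** su11 p q" by blast
      \<comment> \<open>Here \<open>G\<close> = 1/g, so the rows and columns of the inverse matrix
        are exchanged; this gives the coefficients \<open>p\<close> and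
        \<open>- cnj q\<close>.\<close>
      have "G (w + 2 * of_real pi * \<i>) * (cnj (- cnj q) * G w + cnj p) = p * G w + - cnj q"
        if "Re w < r" for w
      proof -
        have w: "w \<in> S" using that by (simp add: S_def)
        have b': "b (w + \<tau>) = b w * ((cnj p - q * G w) * (cnj p - q * G w))"
          unfolding trans(2)[OF pq w mono] aG[OF w] by (simp add: algebra_simps)
        have a': "a (w + \<tau>) = - (b w * ((cnj p - q * G w) * (p * G w - cnj q)))"
          unfolding trans(1)[OF pq w mono] aG[OF w] by (simp add: algebra_simps)
        have nz: "cnj p - q * G w \<noteq> 0" using b0[OF S\<tau>[OF w]] unfolding b' by auto
        have "G (w + \<tau>) = (p * G w - cnj q) / (cnj p - q * G w)"
          unfolding G_def unfolding a' b' using nz b0[OF w] by (simp add: G_def)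
        then have "G (w + \<tau>) * (cnj p - q * G w) = p * G w - cnj q" using nz by simp
        then show ?thesis by (simp add: \<tau>_def algebra_simps)
      qed
      then show "\<exists>p' q'. Re p' = Re p \<and> (cmod p')\<^sup>2 - (cmod q')\<^sup>2 = 1 \<and>
         (\<forall>w. Re w < r \<longrightarrow> G (w + 2 * of_real pi * \<i>) * (cnj q' * G w + cnj p') = p' * G w + q')"
        using pq by (intro exI[of _ p] exI[of _ "- cnj q"]) auto
    qed
  qed
qed

section \<open>Curvature of conformal metrics\<close>

lemma pd_eqI: "(f has_derivative D) (at z) \<Longrightarrow> pd i f z = D (coord_vec i)"
  unfolding pd_def using frechet_derivative_at by metis

text \<open>Write c = exp(2 \<phi>). By \<open>dc\<close>, (P, Q) is the gradient of \<phi>, and the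
  claim is K dA = - (Laplacian of \<phi>) dx dy. Passing the gradient itself avoids differentiating
  a logarithm.\<close>

lemma gauss_curvature_conformal:
  fixes c P Q :: "complex \<Rightarrow> real"
  assumes S: "open S" "z \<in> S" and h: "\<And>w. w \<in> S \<Longrightarrow> h w = mat (c w)" and c0: "\<And>w. w \<in> S \<Longrightarrow> c w > 0"
    and dc: "\<And>w. w \<in> S \<Longrightarrow> (c has_derivative (\<lambda>t. 2 * c w * (Re t * P w + Im t * Q w))) (at w)"
    and dP: "(P has_derivative DP) (at z)" and dQ: "(Q has_derivative DQ) (at z)"
  shows "gauss_curvature h z * sqrt (det (h z)) = - (DP 1 + DQ \<i>)"
proof -
  define \<delta> where "\<delta> = (\<lambda>(i::2) (j::2). if i = j then 1 else 0 :: real)"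
  define X where "X = (\<lambda>(i::2). if i = 1 then P else Q)"
  have hij: "h w $ i $ j = \<delta> i j * c w" if "w \<in> S" for w i j
    using h[OF that] by (simp add: mat_def \<delta>_def)
  have pdh: "pd l (\<lambda>u. h u $ i $ j) w = \<delta> i j * (2 * c w * X l w)" if w: "w \<in> S" for w l i j
  proof -
    have "((\<lambda>u. \<delta> i j * c u) has_derivative (\<lambda>t. \<delta> i j * (2 * c w * (Re t * P w
      + Im t * Q w)))) (at w)"
      by (intro has_derivative_mult_right dc w)
    then have "((\<lambda>u. h u $ i $ j) has_derivative (\<lambda>t. \<delta> i j * (2 * c w * (Re t * P w
      + Im t * Q w)))) (at w)"
      by (rule has_derivative_transform_within_open[OF _ S(1) w]) (simp add: hij)
    from pd_eqI[OF this, of l] show ?thesis using exhaust_2[of l]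
      by (auto simp: coord_vec_def X_def)
  qed
  have chr: "christoffel h k i j w = \<delta> j k * X i w + \<delta> i k * X j w - \<delta> i j * X k w" if w: "w \<in> S"
    for w k i j
  proof -
    have "matrix_inv (h w) = mat (1 / c w)"
      using matrix_inv_mat2[of "c w"] c0[OF w] h[OF w] by simp
    then have minv: "matrix_inv (h w) $ k $ l = \<delta> k l / c w" for l by (simp add: mat_def \<delta>_def)
    have "christoffel h k i j w = (\<Sum>l\<in>UNIV. \<delta> k l * (\<delta> j l * X i w + \<delta> i l * X j w
      - \<delta> i j * X l w))"
      unfolding christoffel_def pdh[OF w] minv using c0[OF w]
      by (simp add: sum_2 field_simps)
    also have "\<dots> = \<delta> j k * X i w + \<delta> i k * X j w - \<delta> i j * X k w"
      using exhaust_2[of k] exhaust_2[of i] exhaust_2[of j] by (auto simp: sum_2 \<delta>_def)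
    finally show ?thesis .
  qed
  have "((\<lambda>w. - X 1 w) has_derivative (\<lambda>t. - DP t)) (at z)"
    using dP by (auto simp: X_def intro!: derivative_intros)
  then have "(christoffel h 1 2 2 has_derivative (\<lambda>t. - DP t)) (at z)"
    by (rule has_derivative_transform_within_open[OF _ S]) (simp add: chr \<delta>_def)
  then have d1: "pd 1 (christoffel h 1 2 2) z = - DP 1" by (simp add: pd_eqI coord_vec_def)
  have "((\<lambda>w. X 2 w) has_derivative DQ) (at z)" using dQ by (auto simp: X_def)
  then have "(christoffel h 1 1 2 has_derivative DQ) (at z)"
    by (rule has_derivative_transform_within_open[OF _ S]) (simp add: chr \<delta>_def)
  then have d2: "pd 2 (christoffel h 1 1 2) z = DQ \<i>" by (simp add: pd_eqI coord_vec_def)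
  \<comment> \<open>The products of Christoffel symbols cancel, leaving only the two
    derivatives.\<close>
  have R: "riemann h 1 2 1 2 z = - (DP 1 + DQ \<i>)"
    unfolding riemann_def d1 d2 by (simp add: sum_2 chr[OF S(2)] \<delta>_def)
  have cz: "c z > 0" by (rule c0[OF S(2)])
  have det: "det (h z) = c z * c z" unfolding det_2 hij[OF S(2)] by (simp add: \<delta>_def)
  have "gauss_curvature h z = riemann h 1 2 1 2 z / c z"
    unfolding gauss_curvature_def det using cz by (simp add: sum_2 hij[OF S(2)] \<delta>_def)
  then show ?thesis unfolding R det using cz by simp
qed

lemma has_derivative_cmod_power2:
  assumes "(k has_derivative D) (at w)"
  shows "((\<lambda>w. (cmod (k w))\<^sup>2) has_derivative (\<lambda>t. 2 * Re (D t * cnj (k w)))) (at w)"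
proof -
  have "((\<lambda>w. k w \<bullet> k w) has_derivative (\<lambda>t. k w \<bullet> D t + D t \<bullet> k w)) (at w)"
    by (intro has_derivative_inner assms)
  then show ?thesis by (simp add: power2_norm_eq_inner inner_complex_def algebra_simps)
qed

text \<open>Half the logarithm of the conformal factor is ln |k| + ln (1 - |\<gamma>|^2). The first
  summand is harmonic; minus the Laplacian of the second is 4 |\<gamma>'|^2 / (1 - |\<gamma>|^2)^2,
  the area density pulled back from the disk metric of curvature -1.\<close>

lemma gauss_curvature_hyperbolic_pullback:
  fixes k \<gamma> :: "complex \<Rightarrow> complex"
  assumes S: "open S" "z \<in> S" and k: "k holomorphic_on S" "\<And>w. w \<in> S \<Longrightarrow> k w \<noteq> 0"
    and \<gamma>: "\<gamma> holomorphic_on S" "\<And>w. w \<in> S \<Longrightarrow> cmod (\<gamma> w) < 1"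
    and h: "\<And>w. w \<in> S \<Longrightarrow> h w = mat ((cmod (k w) * (1 - (cmod (\<gamma> w))\<^sup>2))\<^sup>2)"
  shows "gauss_curvature h z * sqrt (det (h z)) = (2 * cmod (deriv \<gamma> z) / (1 - (cmod (\<gamma> z))\<^sup>2))\<^sup>2"
proof -
  have Re_complex_of_real_mult: "Re (of_real x * y) = x * Re y" for x y by simp
  define k' \<gamma>' where "k' = deriv k" and "\<gamma>' = deriv \<gamma>"
  have dk: "(k has_derivative (\<lambda>t. k' w * t)) (at w)"
    and d\<gamma>: "(\<gamma> has_derivative (\<lambda>t. \<gamma>' w * t)) (at w)" if "w \<in> S" for w
    using holomorphic_derivI[OF k(1) S(1) that] holomorphic_derivI[OF \<gamma>(1) S(1) that]
    by (auto simp: has_field_derivative_def k'_def \<gamma>'_def)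
  have dk': "(k' has_derivative (\<lambda>t. deriv k' z * t)) (at z)"
    and d\<gamma>': "(\<gamma>' has_derivative (\<lambda>t. deriv \<gamma>' z * t)) (at z)"
    using holomorphic_derivI[OF holomorphic_deriv[OF k(1) S(1)] S]
      holomorphic_derivI[OF holomorphic_deriv[OF \<gamma>(1) S(1)] S]
    by (auto simp: has_field_derivative_def k'_def \<gamma>'_def)
  define m where "m = (\<lambda>w. 1 - (cmod (\<gamma> w))\<^sup>2)"
  have m0: "m w > 0" if "w \<in> S" for w using \<gamma>(2)[OF that] by (simp add: m_def abs_square_less_1)
  have mc: "complex_of_real (m w) = 1 - \<gamma> w * cnj (\<gamma> w)" for w
    unfolding m_def of_real_diff complex_norm_square by simp
  define c where "c = (\<lambda>w. (cmod (k w))\<^sup>2 * (m w)\<^sup>2)"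
  \<comment> \<open>Twice the z-derivative of ln |k| + ln (1 - |\<gamma>|^2), so the partial
    derivatives in x and y are Re \<Phi> and - Im \<Phi>.\<close>
  define \<Phi> where "\<Phi> = (\<lambda>w. k' w / k w - 2 * \<gamma>' w * cnj (\<gamma> w) / (1 - \<gamma> w * cnj (\<gamma> w)))"
  have dm: "(m has_derivative (\<lambda>t. - (2 * Re (\<gamma>' w * t * cnj (\<gamma> w))))) (at w)" if "w \<in> S" for w
    unfolding m_def
    using has_derivative_diff[OF has_derivative_const[of 1]
      has_derivative_cmod_power2[OF d\<gamma>[OF that]]] by simp
  have dc: "(c has_derivative (\<lambda>t. 2 * c w * (Re t * Re (\<Phi> w) + Im t * (- Im (\<Phi> w))))) (at w)"
    if w: "w \<in> S" for w
  proof -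
    have "(c has_derivative (\<lambda>t. (cmod (k w))\<^sup>2 * (of_nat 2 * (- (2 * Re (\<gamma>' w * t * cnj (\<gamma> w))))
      * m w ^ (2 - 1))
        + 2 * Re (k' w * t * cnj (k w)) * (m w)\<^sup>2)) (at w)"
      unfolding c_def
      by (intro has_derivative_mult has_derivative_power dm[OF w]
        has_derivative_cmod_power2[OF dk[OF w]])
    moreover have "(cmod (k w))\<^sup>2 * (of_nat 2 * (- (2 * Re (\<gamma>' w * t * cnj (\<gamma> w)))) * m w ^ (2 - 1))
        + 2 * Re (k' w * t * cnj (k w)) * (m w)\<^sup>2
          = 2 * c w * (Re t * Re (\<Phi> w) + Im t * (- Im (\<Phi> w)))" for t
    proof -
      have 1: "Re (k' w * t * cnj (k w)) = (cmod (k w))\<^sup>2 * Re (t * (k' w / k w))"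
      proof -
        have "k' w * t * cnj (k w) = of_real ((cmod (k w))\<^sup>2) * (t * (k' w / k w))"
          unfolding complex_norm_square using k(2)[OF w] by (simp add: field_simps)
        then show ?thesis by (simp only: Re_complex_of_real_mult)
      qed
      have 2: "2 * Re (\<gamma>' w * t * cnj (\<gamma> w)) = m w * Re (t * (2 * \<gamma>' w * cnj (\<gamma> w) / (1
        - \<gamma> w * cnj (\<gamma> w))))"
      proof -
        have "of_real 2 * (\<gamma>' w * t * cnj (\<gamma> w))
          = of_real (m w) * (t * (2 * \<gamma>' w * cnj (\<gamma> w) / of_real (m w)))"
          using m0[OF w] by (simp add: field_simps)
        then have "Re (of_real 2 * (\<gamma>' w * t * cnj (\<gamma> w)))
          = Re (of_real (m w) * (t * (2 * \<gamma>' w * cnj (\<gamma> w) / of_real (m w))))"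
          by (rule arg_cong)
        then show ?thesis unfolding mc[symmetric] by (simp only: Re_complex_of_real_mult)
      qed
      have "Re t * Re (\<Phi> w) + Im t * (- Im (\<Phi> w)) = Re (t * \<Phi> w)" by simp
      also have "\<dots> = Re (t * (k' w / k w)) - Re (t * (2 * \<gamma>' w * cnj (\<gamma> w) / (1
        - \<gamma> w * cnj (\<gamma> w))))"
        unfolding \<Phi>_def by (simp only: right_diff_distrib minus_complex.sel)
      finally have 3: "Re t * Re (\<Phi> w) + Im t * (- Im (\<Phi> w)) =
        Re (t * (k' w / k w)) - Re (t * (2 * \<gamma>' w * cnj (\<gamma> w) / (1 - \<gamma> w * cnj (\<gamma> w))))" .
      show ?thesis unfolding 1 2 3 c_def by (simp add: algebra_simps power2_eq_square)
    qed
    ultimately show ?thesis by simp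
  qed
  define D\<Phi> where "D\<Phi> = (\<lambda>t. (deriv k' z * t * k z - k' z * (k' z * t)) / (k z * k z)
     - ((2 * \<gamma>' z * cnj (\<gamma>' z * t) + 2 * (deriv \<gamma>' z * t) * cnj (\<gamma> z)) * (1 - \<gamma> z * cnj (\<gamma> z))
         - 2 * \<gamma>' z * cnj (\<gamma> z) * (0 - (\<gamma> z * cnj (\<gamma>' z * t) + \<gamma>' z * t * cnj (\<gamma> z))))
       / ((1 - \<gamma> z * cnj (\<gamma> z)) * (1 - \<gamma> z * cnj (\<gamma> z))))"
  have kz: "k z \<noteq> 0" and mz: "1 - \<gamma> z * cnj (\<gamma> z) \<noteq> 0"
    using k(2)[OF S(2)] m0[OF S(2)] mc[of z] by (auto simp flip: mc)
  have d\<Phi>: "(\<Phi> has_derivative D\<Phi>) (at z)"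
    unfolding \<Phi>_def D\<Phi>_def
    by (intro has_derivative_diff has_derivative_divide' has_derivative_mult
      has_derivative_mult_right
        has_derivative_cnj has_derivative_const dk' d\<gamma>' dk d\<gamma> S kz mz)
  have "gauss_curvature h z * sqrt (det (h z)) = - (Re (D\<Phi> 1) + (- Im (D\<Phi> \<i>)))"
  proof (rule gauss_curvature_conformal[OF S, where c = c and P = "\<lambda>w. Re (\<Phi> w)"
    and Q = "\<lambda>w. - Im (\<Phi> w)"])
    show "h w = mat (c w)" if "w \<in> S" for w using h[OF that]
      by (simp add: c_def m_def power_mult_distrib)
    show "c w > 0" if "w \<in> S" for w using k(2)[OF that] m0[OF that] by (simp add: c_def)
    show "((\<lambda>w. Re (\<Phi> w)) has_derivative (\<lambda>t. Re (D\<Phi> t))) (at z)" by (intro has_derivative_Re d\<Phi>)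
    show "((\<lambda>w. - Im (\<Phi> w)) has_derivative (\<lambda>t. - Im (D\<Phi> t))) (at z)"
      by (intro has_derivative_minus has_derivative_Im d\<Phi>)
  qed (rule dc)
  also have "\<dots> = - Re (D\<Phi> 1 + \<i> * D\<Phi> \<i>)" by simp
  \<comment> \<open>This is twice the derivative of \<Phi> with respect to cnj z, hence the
    Laplacian; the holomorphic quotient k'/k drops out.\<close>
  also have "D\<Phi> 1 + \<i> * D\<Phi> \<i> = - (4 * (\<gamma>' z * cnj (\<gamma>' z)) / ((1 - \<gamma> z * cnj (\<gamma> z)) * (1
    - \<gamma> z * cnj (\<gamma> z))))"
    unfolding D\<Phi>_def using kz mz by (simp add: divide_simps) (simp add: algebra_simps)
  also have "\<dots> = of_real (- (4 * (cmod (\<gamma>' z))\<^sup>2 / (m z * m z)))"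
    unfolding mc[symmetric] unfolding complex_norm_square[symmetric] by simp
  also have "- Re (of_real (- (4 * (cmod (\<gamma>' z))\<^sup>2 / (m z * m z)))) = (2 * cmod (\<gamma>' z) / m z)\<^sup>2"
    by (simp add: power_divide power_mult_distrib power2_eq_square[of "m z"])
  finally show ?thesis by (simp add: \<gamma>'_def m_def)
qed

text \<open>The bound is the area density of the hyperbolic metric of the punctured disk of radius
  \<open>\<delta>\<close>, whose cusp has finite area. On the shells m + 1 <= ln (\<delta> / |z|) <
  m + 2 the exponential growth of the bound is offset by the area of \<open>B m\<close>, which
  leaves a multiple of 1 / (m + 1)^2. The condition on \<open>r\<close> places every point in some
  shell.\<close>

lemma set_integrable_cusp:
  fixes T :: "complex \<Rightarrow> real"
  assumes \<delta>: "\<delta> > 0" and r: "r \<le> \<delta> * exp (-1)"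
    and cont: "continuous_on (punctured_disk r) T"
    and bd: "\<And>z. z \<in> punctured_disk r \<Longrightarrow> \<bar>T z\<bar> \<le> (1 / (cmod z * (ln \<delta> - ln (cmod z))))\<^sup>2"
  shows "set_integrable lborel (punctured_disk r) T"
  unfolding set_integrable_def
proof (rule integrableI_bounded)
  let ?A = "punctured_disk r"
  have "open ?A"
  proof -
    have "?A = ball 0 r - {0}" by (auto simp: punctured_disk_def)
    then show ?thesis by auto
  qed
  then have A: "?A \<in> sets borel" by auto
  show "(\<lambda>x. indicator ?A x *\<^sub>R T x) \<in> borel_measurable lborel"
    using borel_measurable_continuous_on_indicator[OF A cont] by simp
  define V where "V = unit_ball_vol (real DIM(complex))"
  \<comment> \<open>Upper bound on shell m, where |z| > \<delta> exp(-(m + 2)) and the logarithm is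
    at least m + 1. The whole disk \<open>B m\<close> may replace the shell, since its area has the
    same order.\<close>
  define c where "c = (\<lambda>m. exp (2 * real (Suc m) + 2) / (\<delta>\<^sup>2 * (real (Suc m))\<^sup>2))"
  define B where "B = (\<lambda>m. cball (0::complex) (\<delta> * exp (- real (Suc m))))"
  have pt: "ennreal (norm (indicator ?A z *\<^sub>R T z)) \<le> (\<Sum>m. ennreal (c m) * indicator (B m) z)" for z
  proof (cases "z \<in> ?A")
    case True
    define x where "x = ln \<delta> - ln (cmod z)"
    have z0: "cmod z > 0" and zr: "cmod z < r" using True by (auto simp: punctured_disk_def)
    have "ln (cmod z) < ln (\<delta> * exp (-1))" using z0 zr r \<delta> by simp
    then have x1: "x > 1" using \<delta> by (simp add: x_def ln_mult)
    have zx: "cmod z = \<delta> * exp (- x)" using z0 \<delta> by (simp add: x_def exp_diff)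
    define m where "m = nat \<lfloor>x\<rfloor> - 1"
    have "\<lfloor>x\<rfloor> \<ge> 1" using x1 by linarith
    then have Sm: "real (Suc m) = of_int \<lfloor>x\<rfloor>" by (simp add: m_def of_nat_diff)
    have mx: "real (Suc m) \<le> x" "x < real (Suc m) + 1" unfolding Sm by linarith+
    have "z \<in> B m" using zx mx(1) \<delta> by (simp add: B_def)
    have "\<bar>T z\<bar> \<le> (1 / (cmod z * x))\<^sup>2" using bd[OF True] by (simp add: x_def)
    also have "\<dots> \<le> c m"
    proof -
      have "\<delta> * exp (- (real (Suc m) + 1)) \<le> cmod z" unfolding zx using \<delta> mx(2) by simp
      then have "\<delta> * exp (- (real (Suc m) + 1)) * real (Suc m) \<le> cmod z * x"
        using mx(1) \<delta> by (intro mult_mono) auto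
      moreover have p: "\<delta> * exp (- (real (Suc m) + 1)) * real (Suc m) > 0" using \<delta> by simp
      ultimately have "1 / (cmod z * x) \<le> 1 / (\<delta> * exp (- (real (Suc m) + 1)) * real (Suc m))"
        using z0 x1 \<delta> by (intro divide_left_mono mult_pos_pos) auto
      moreover have "0 \<le> 1 / (cmod z * x)" using x1 by simp
      ultimately have "(1 / (cmod z * x))\<^sup>2 \<le> (1 / (\<delta> * exp (- (real (Suc m)
        + 1)) * real (Suc m)))\<^sup>2"
        by (rule power_mono)
      also have "\<dots> = c m"
      proof -
        have "(exp (- (real (Suc m) + 1)))\<^sup>2 * exp (2 * real (Suc m) + 2) = 1"
          by (simp add: power2_eq_square flip: exp_add)
        then have e: "1 / (exp (- (real (Suc m) + 1)))\<^sup>2 = exp (2 * real (Suc m) + 2)"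
          by (simp add: field_simps)
        have "(1 / (\<delta> * exp (- (real (Suc m) + 1)) * real (Suc m)))\<^sup>2
            = (1 / (exp (- (real (Suc m) + 1)))\<^sup>2) * (1 / (\<delta>\<^sup>2 * (real (Suc m))\<^sup>2))"
          unfolding power_divide power_mult_distrib by simp
        then show ?thesis unfolding e c_def by simp
      qed
      finally show ?thesis .
    qed
    finally have "ennreal (norm (indicator ?A z *\<^sub>R T z)) \<le> ennreal (c m) * indicator (B m) z"
      using True \<open>z \<in> B m\<close> by (simp add: ennreal_leI)
    also have "\<dots> \<le> (\<Sum>m. ennreal (c m) * indicator (B m) z)"
    proof -
      have "g m \<le> suminf g" for g :: "nat \<Rightarrow> ennreal"
        using sum_le_suminf[OF summableI, of "{m}" g] by simp
      then show ?thesis .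
    qed
    finally show ?thesis .
  qed simp
  have "(\<integral>\<^sup>+ z. ennreal (norm (indicator ?A z *\<^sub>R T z)) \<partial>lborel)
      \<le> (\<integral>\<^sup>+ z. (\<Sum>m. ennreal (c m) * indicator (B m) z) \<partial>lborel)"
    by (intro nn_integral_mono pt)
  also have "\<dots> = (\<Sum>m. \<integral>\<^sup>+ z. ennreal (c m) * indicator (B m) z \<partial>lborel)"
    by (intro nn_integral_suminf borel_measurable_times_ennreal borel_measurable_const
        borel_measurable_indicator) (auto simp: B_def)
  also have "\<dots> = (\<Sum>m. ennreal (V * exp 2 * (1 / (real (Suc m))\<^sup>2)))"
  proof (intro suminf_cong)
    fix m
    have "(\<integral>\<^sup>+ z. ennreal (c m) * indicator (B m) z \<partial>lborel)
      = ennreal (c m) * emeasure lborel (B m)"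
      by (intro nn_integral_cmult_indicator) (auto simp: B_def)
    also have "emeasure lborel (B m) = ennreal (V * (\<delta> * exp (- real (Suc m))) ^ 2)"
      unfolding B_def V_def using emeasure_cball[of "\<delta> * exp (- real (Suc m))" "0::complex"] \<delta>
        by simp
    also have "ennreal (c m) * \<dots> = ennreal (c m * (V * (\<delta> * exp (- real (Suc m))) ^ 2))"
      by (intro ennreal_mult[symmetric]) (auto simp: c_def V_def)
    also have "c m * (V * (\<delta> * exp (- real (Suc m))) ^ 2) = V * exp 2 * (1 / (real (Suc m))\<^sup>2)"
    proof -
      have e: "exp (2 * real (Suc m) + 2) * (exp (- real (Suc m)))\<^sup>2 = exp 2"
        by (simp add: power2_eq_square flip: exp_add)
      have "c m * (V * (\<delta> * exp (- real (Suc m))) ^ 2) =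
        V * (exp (2 * real (Suc m) + 2) * (exp (- real (Suc m)))\<^sup>2) * (\<delta>\<^sup>2 / (\<delta>\<^sup>2 * (real (Suc
          m))\<^sup>2))"
        unfolding c_def power_mult_distrib by (simp only: times_divide_eq_left
          times_divide_eq_right mult_ac)
      then show ?thesis unfolding e using \<delta> by simp
    qed
    finally show "(\<integral>\<^sup>+ z. ennreal (c m) * indicator (B m) z \<partial>lborel)
      = ennreal (V * exp 2 * (1 / (real (Suc m))\<^sup>2))" .
  qed
  also have "\<dots> < \<infinity>"
  proof -
    have "summable (\<lambda>m. 1 / (real (Suc m))\<^sup>2)"
      using inverse_squares_sums by (simp add: sums_iff)
    then have "summable (\<lambda>m. V * exp 2 * (1 / (real (Suc m))\<^sup>2))" by (rule summable_mult)
    then show ?thesis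
      by (subst suminf_ennreal2) (auto simp: V_def)
  qed
  finally show "(\<integral>\<^sup>+ z. ennreal (norm (indicator ?A z *\<^sub>R T z)) \<partial>lborel) < \<infinity>" .
qed

section \<open>Monodromy and total curvature of complete ends\<close>

lemma SU11_mult: "P \<in> SU11 \<Longrightarrow> Q \<in> SU11 \<Longrightarrow> P ** Q \<in> SU11"
proof -
  assume P: "P \<in> SU11" and Q: "Q \<in> SU11"
  have "P ** Q ** e3 ** hconj (P ** Q) = P ** (Q ** e3 ** hconj Q) ** hconj P"
    by (simp add: hconj_simps matrix_mul_assoc)
  then show ?thesis using P Q by (simp add: SU11_def SL2C_def det_mul)
qed

lemma SU11_adjugate: "P \<in> SU11 \<Longrightarrow> adjugate P \<in> SU11"
proof (erule SU11_E)
  fix p q assume "P = su11 p q" "(cmod p)\<^sup>2 - (cmod q)\<^sup>2 = 1"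
  moreover have "adjugate (su11 p q) = su11 (cnj p) (- q)" by (simp add: su11_def mat2_defs)
  ultimately show "adjugate P \<in> SU11" using su11_in_SU11[of "cnj p" "- q"] by simp
qed

text \<open>
  If \<open>c\<close> vanishes identically then \<open>g\<close> is constantly infinite; a boost in \<open>SU(1,1)\<close> moves this
  constant to a finite one.
\<close>

lemma null_frame_exists_nondegenerate:
  assumes face: "cmc1_face (punctured_disk 1) f"
  obtains F N \<rho> where "null_frame f F N" "\<And>w. w \<in> left_half_plane \<Longrightarrow> N w \<noteq> 0"
    "\<exists>w\<in>left_half_plane. N w $ 2 $ 1 \<noteq> 0"
    "\<rho> \<in> SU11" "\<And>w. w \<in> left_half_plane \<Longrightarrow> F (w + 2 * of_real pi * \<i>) = F w ** \<rho>"
proof -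
  obtain F N \<rho> where fr: "null_frame f F N" and N0: "\<And>w. w \<in> left_half_plane \<Longrightarrow> N w \<noteq> 0"
    and \<rho>: "\<rho> \<in> SU11" and mono: "\<And>w. w \<in> left_half_plane \<Longrightarrow> F (w + 2 * of_real pi * \<i>) = F w ** \<rho>"
    by (rule null_frame_exists[OF face]) blast
  show thesis
  proof (cases "\<exists>w\<in>left_half_plane. N w $ 2 $ 1 \<noteq> 0")
    case True
    then show ?thesis using that fr N0 \<rho> mono by blast
  next
    case False
    \<comment> \<open>Any boost with s nonzero serves: with a = c = 0 the new lower left entry is -
      s^2 b.\<close>
    define C s where "C = cosh (1::real)" and "s = sinh (1::real)"
    define P where "P = su11 (of_real C) (of_real s)"
    have "C\<^sup>2 - s\<^sup>2 = 1" using cosh_square_eq[of "1::real"] by (simp add: C_def s_def)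
    then have P: "P \<in> SU11" unfolding P_def by (intro su11_in_SU11) simp
    then have dP: "det P = 1" by (simp add: SU11_def SL2C_def)
    have s0: "s \<noteq> 0" by (simp add: s_def)
    have PP: "P ** adjugate P = mat 1" unfolding adjugate_mult dP ..
    show ?thesis
    proof (rule that[of "\<lambda>w. F w ** P" "\<lambda>w. adjugate P ** N w ** P" "adjugate P ** \<rho> ** P"])
      show "null_frame f (\<lambda>w. F w ** P) (\<lambda>w. adjugate P ** N w ** P)"
        by (rule null_frame_right_mult[OF fr P])
      show "adjugate P ** \<rho> ** P \<in> SU11" by (intro SU11_mult SU11_adjugate P \<rho>)
      fix w assume w: "w \<in> left_half_plane"
      have "F w ** P ** (adjugate P ** \<rho> ** P) = F w ** (P ** adjugate P) ** \<rho> ** P"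
        by (simp only: matrix_mul_assoc)
      then show "F (w + 2 * of_real pi * \<i>) ** P = F w ** P ** (adjugate P ** \<rho> ** P)"
        unfolding PP mono[OF w] by simp
      show "adjugate P ** N w ** P \<noteq> 0"
      proof
        assume 0: "adjugate P ** N w ** P = 0"
        have "P ** (adjugate P ** N w ** P) ** adjugate P
          = (P ** adjugate P) ** N w ** (P ** adjugate P)"
          by (simp only: matrix_mul_assoc)
        then have "N w = 0" unfolding PP 0 by (simp add: mat2_defs)
        then show False using N0 w by blast
      qed
    next
      define w where "w = complex_of_real (-1)"
      have w: "w \<in> left_half_plane" by (simp add: w_def left_half_plane_def)
      have c: "N w $ 2 $ 1 = 0" using False w by blast
      have a: "N w $ 1 $ 1 = 0" "N w $ 2 $ 2 = 0" using null_frame_abc[OF fr w] c by auto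
      then have b: "N w $ 1 $ 2 \<noteq> 0" using N0[OF w] c by (auto simp: vec_eq_iff forall_2)
      have "(adjugate P ** N w ** P) $ 2 $ 1 = - of_real s * N w $ 1 $ 2 * of_real s"
        using a c by (simp add: P_def su11_def adjugate_def matrix_matrix_mult_def sum_2)
      then have "(adjugate P ** N w ** P) $ 2 $ 1 \<noteq> 0" using b s0 by simp
      then show "\<exists>w\<in>left_half_plane. (adjugate P ** N w ** P) $ 2 $ 1 \<noteq> 0" using w by blast
    qed
  qed
qed

text \<open>\<open>G\<close> and \<open>k\<close> live in the coordinate w and need not be periodic,
  so they are brought down to z by a local branch of the logarithm around each point. The curvature
  density and its bound do not depend on the branch.\<close>

lemma end_curvature_integrable:
  fixes f :: "complex \<Rightarrow> real^4"
  assumes \<delta>: "0 < \<delta>" "\<delta> \<le> 1" and fr: "null_frame f F N"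
    and f: "\<And>z. z \<in> punctured_disk 1 \<Longrightarrow> f differentiable (at z)"
    and G: "G holomorphic_on {w. Re w < ln \<delta>}" "\<And>w. Re w < ln \<delta> \<Longrightarrow> cmod (G w) < 1"
    and k: "k holomorphic_on {w. Re w < ln \<delta>}" "\<And>w. Re w < ln \<delta> \<Longrightarrow> k w \<noteq> 0"
    and Gk: "\<And>w. Re w < ln \<delta> \<Longrightarrow> (cmod (N w $ 1 $ 2) - cmod (N w $ 2 $ 1))\<^sup>2
      = (cmod (k w) * (1 - (cmod (G w))\<^sup>2))\<^sup>2"
    and r: "r \<le> \<delta> * exp (-1)"
  shows "finite_total_curvature f (punctured_disk r)"
proof -
  define T where "T = (\<lambda>z. gauss_curvature (ds2 f) z * sqrt (det (ds2 f z)))"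
  have opr: "open (punctured_disk r)" for r
  proof -
    have "punctured_disk r = ball 0 r - {0}" by (auto simp: punctured_disk_def)
    then show ?thesis by auto
  qed
  have op: "open {w. Re w < ln \<delta>}" by (rule open_halfspace_Re_lt)
  have loc: "isCont T z0 \<and> \<bar>T z0\<bar> \<le> (1 / (cmod z0 * (ln \<delta> - ln (cmod z0))))\<^sup>2"
    if z0: "z0 \<in> punctured_disk \<delta>" for z0
  proof -
    have nz: "z0 \<noteq> 0" and z\<delta>: "cmod z0 < \<delta>" using z0 by (auto simp: punctured_disk_def)
    \<comment> \<open>On this ball z / z0 has positive real part, so \<open>Ln (z / z0)\<close> is
      holomorphic even when z0 lies on the branch cut of \<open>Ln\<close>.\<close>
    define S where "S = ball z0 (cmod z0) \<inter> punctured_disk \<delta>"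
    have S: "open S" "z0 \<in> S" using nz z0 opr by (auto simp: S_def)
    define l where "l = (\<lambda>z. Ln (z / z0) + Ln z0)"
    have half: "Re (z / z0) > 0" if "z \<in> S" for z
    proof -
      have "cmod (z / z0 - 1) = cmod (z - z0) / cmod z0" using nz
        by (simp add: diff_divide_distrib flip: norm_divide)
      also have "\<dots> < 1" using that nz by (simp add: S_def dist_norm norm_minus_commute)
      finally show ?thesis using abs_Re_le_cmod[of "z / z0 - 1"] by simp
    qed
    have npos: "z / z0 \<notin> \<real>\<^sub>\<le>\<^sub>0" if "z \<in> S" for z
      using half[OF that] by (auto simp: complex_nonpos_Reals_iff)
    have zne: "z \<noteq> 0" if "z \<in> S" for z using that by (auto simp: S_def punctured_disk_def)
    have dl: "(l has_field_derivative 1 / z) (at z)" if "z \<in> S" for z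
    proof -
      have "((\<lambda>z. Ln (z / z0)) has_field_derivative 1 / z0 * inverse (z / z0)) (at z)"
        using npos[OF that] by (auto intro!: derivative_eq_intros)
      then have "(l has_field_derivative 1 / z0 * inverse (z / z0) + 0) (at z)"
        unfolding l_def by (intro DERIV_add DERIV_const)
      then show ?thesis using nz zne[OF that] by (simp add: field_simps)
    qed
    have el: "exp (l z) = z" if "z \<in> S" for z
      using zne[OF that] nz by (simp add: l_def exp_add)
    have Rel: "Re (l z) = ln (cmod z)" if "z \<in> S" for z
    proof -
      have "cmod z = exp (Re (l z))" using el[OF that] norm_exp_eq_Re by metis
      then show ?thesis by simp
    qed
    have lS: "Re (l z) < ln \<delta>" if "z \<in> S" for z
      using that \<delta> zne[OF that] unfolding Rel[OF that] by (auto simp: S_def punctured_disk_def)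
    have lhol: "l holomorphic_on S" using dl S(1) by (metis holomorphic_on_open)
    define \<gamma> where "\<gamma> = (\<lambda>z. G (l z))"
    \<comment> \<open>The division by \<open>z\<close> accounts for dw = dz / z in the
      metric.\<close>
    define \<kappa> where "\<kappa> = (\<lambda>z. k (l z) / z)"
    have \<gamma>hol: "\<gamma> holomorphic_on S"
      unfolding \<gamma>_def using holomorphic_on_compose_gen[OF lhol G(1)] lS by (auto simp: o_def)
    have \<kappa>hol: "\<kappa> holomorphic_on S"
      unfolding \<kappa>_def using holomorphic_on_compose_gen[OF lhol k(1)] lS zne
      by (auto simp: o_def intro!: holomorphic_intros)
    have \<gamma>1: "cmod (\<gamma> z) < 1" if "z \<in> S" for z unfolding \<gamma>_def by (rule G(2)[OF lS[OF that]])
    have \<kappa>0: "\<kappa> z \<noteq> 0" if "z \<in> S" for z unfolding \<kappa>_def using k(2)[OF lS[OF that]] zne[OF that]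
      by simp
    have h: "ds2 f z = mat ((cmod (\<kappa> z) * (1 - (cmod (\<gamma> z))\<^sup>2))\<^sup>2)" if z: "z \<in> S" for z
    proof -
      have "ln \<delta> \<le> 0" using \<delta> by simp
      then have lz: "l z \<in> left_half_plane" using lS[OF z] by (simp add: left_half_plane_def)
      have "z \<in> punctured_disk 1" using exp_in_punctured_disk[OF lz] el[OF z] by simp
      then have "ds2 f z = mat (((cmod (N (l z) $ 1 $ 2) - cmod (N (l z) $ 2 $ 1)) / cmod z)\<^sup>2)"
        using null_frame_metric[OF fr lz] f el[OF z] by simp
      also have "((cmod (N (l z) $ 1 $ 2) - cmod (N (l z) $ 2 $ 1)) / cmod z)\<^sup>2
        = (cmod (\<kappa> z) * (1 - (cmod (\<gamma> z))\<^sup>2))\<^sup>2"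
        unfolding power_divide Gk[OF lS[OF z]] \<kappa>_def \<gamma>_def norm_divide power_mult_distrib by simp
      finally show ?thesis .
    qed
    have Teq: "T z = (2 * cmod (deriv \<gamma> z) / (1 - (cmod (\<gamma> z))\<^sup>2))\<^sup>2" if "z \<in> S" for z
      unfolding T_def by (rule gauss_curvature_hyperbolic_pullback[OF S(1) that \<kappa>hol \<kappa>0 \<gamma>hol \<gamma>1 h])
    have c1: "continuous_on S \<gamma>" "continuous_on S (deriv \<gamma>)"
      using \<gamma>hol holomorphic_deriv[OF \<gamma>hol S(1)] holomorphic_on_imp_continuous_on by blast+
    have "1 - (cmod (\<gamma> z))\<^sup>2 \<noteq> 0" if "z \<in> S" for z
    proof -
      have "(cmod (\<gamma> z))\<^sup>2 < 1" using \<gamma>1[OF that] by (simp add: abs_square_less_1)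
      then show ?thesis by simp
    qed
    then have "continuous_on S (\<lambda>z. (2 * cmod (deriv \<gamma> z) / (1 - (cmod (\<gamma> z))\<^sup>2))\<^sup>2)"
      using c1 by (intro continuous_intros) auto
    then have "continuous_on S T" using Teq by (metis (no_types, lifting) continuous_on_cong)
    then have "isCont T z0" using S continuous_on_eq_continuous_at by blast
    moreover have "\<bar>T z0\<bar> \<le> (1 / (cmod z0 * (ln \<delta> - ln (cmod z0))))\<^sup>2"
    proof -
      define w0 where "w0 = l z0"
      have w0: "Re w0 < ln \<delta>" unfolding w0_def by (rule lS[OF S(2)])
      have "(G has_field_derivative deriv G w0) (at w0)" using holomorphic_derivI[OF G(1) op] w0
        by simp
      then have "(\<gamma> has_field_derivative deriv G w0 * (1 / z0)) (at z0)"
        unfolding \<gamma>_def using DERIV_chain2[OF _ dl[OF S(2)], of G] by (simp add: w0_def)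
      then have d\<gamma>: "deriv \<gamma> z0 = deriv G w0 / z0" using DERIV_imp_deriv by fastforce
      define m where "m = 1 - (cmod (G w0))\<^sup>2"
      have m0: "m > 0" using G(2)[OF w0] by (simp add: m_def abs_square_less_1)
      define x where "x = ln \<delta> - ln (cmod z0)"
      have xw: "x = ln \<delta> - Re w0" using Rel[OF S(2)] by (simp add: x_def w0_def)
      then have x0: "x > 0" using w0 by simp
      \<comment> \<open>Here Schwarz--Pick compares with the hyperbolic metric of the half plane Re
        w < ln \<delta>; division by |z0| turns it into that of the punctured disk.\<close>
      have "cmod (deriv G w0) * (2 * x) \<le> m"
        unfolding xw m_def by (rule Schwarz_Pick_half_plane_deriv[OF G w0])
      then have "2 * cmod (deriv G w0) / m \<le> 1 / x" using m0 x0 by (simp add: field_simps)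
      then have "2 * cmod (deriv G w0) / m / cmod z0 \<le> 1 / x / cmod z0"
        by (intro divide_right_mono) auto
      then have "(2 * cmod (deriv G w0) / m / cmod z0)\<^sup>2 \<le> (1 / x / cmod z0)\<^sup>2"
        using m0 by (intro power_mono) auto
      moreover have "T z0 = (2 * cmod (deriv G w0) / m / cmod z0)\<^sup>2"
        unfolding Teq[OF S(2)] d\<gamma> norm_divide by (simp add: m_def \<gamma>_def w0_def mult.commute)
      ultimately show ?thesis by (simp add: x_def mult.commute)
    qed
    ultimately show ?thesis by blast
  qed
  have sub: "punctured_disk r \<subseteq> punctured_disk \<delta>"
  proof -
    have "\<delta> * exp (-1) \<le> \<delta> * 1" using \<delta> by (intro mult_left_mono) auto
    then show ?thesis using r by (auto simp: punctured_disk_def)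
  qed
  have "set_integrable lborel (punctured_disk r) T"
    by (rule set_integrable_cusp[OF \<delta>(1) r])
       (use loc sub in \<open>auto intro!: continuous_at_imp_continuous_on\<close>)
  then show ?thesis unfolding finite_total_curvature_def T_def .
qed

theorem theorem1:
  fixes f :: "complex \<Rightarrow> real^4"
  assumes "complete_end f"
  shows "\<not> hyperbolic_end f \<and> (elliptic_end f \<or> parabolic_end f) \<and>
         (\<forall>\<^sub>F r in at_right 0. finite_total_curvature f (punctured_disk r))"
proof -
  have face: "cmc1_face (punctured_disk 1) f"
    and acc: "\<not> 0 islimpt singular_set (punctured_disk 1) f"
    using assms by (auto simp: complete_end_def)
  note sm = cmc1_face_smooth[OF face]
  \<comment> \<open>Within radius \<open>e\<close> every point other than 0 is regular. Capping by 1
    below keeps the half plane Re w < ln \<delta> inside the domain of the frames.\<close>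
  obtain e where e: "e > 0" "\<And>z. z \<in> singular_set (punctured_disk 1) f \<Longrightarrow> z \<noteq> 0 \<Longrightarrow> dist z 0 \<ge> e"
    using acc unfolding islimpt_approachable by (metis linorder_not_less)
  define \<delta> where "\<delta> = min e 1"
  have \<delta>: "0 < \<delta>" "\<delta> \<le> 1" using e by (auto simp: \<delta>_def)
  have ln\<delta>: "ln \<delta> \<le> 0" using \<delta> by simp
  have nd: "cmod (N w $ 1 $ 2) \<noteq> cmod (N w $ 2 $ 1)" if fr: "null_frame f F N"
    and w: "Re w < ln \<delta>" for F N w
  proof
    assume eq: "cmod (N w $ 1 $ 2) = cmod (N w $ 2 $ 1)"
    have wl: "w \<in> left_half_plane" using w ln\<delta> by (simp add: left_half_plane_def)
    have z1: "exp w \<in> punctured_disk 1" by (rule exp_in_punctured_disk[OF wl])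
    have "cmod (exp w) < \<delta>" using w \<delta> by (metis exp_less_mono exp_ln norm_exp_eq_Re)
    moreover have "ds2 f (exp w) = mat 0"
      using null_frame_metric[OF fr wl sm(2)[OF z1]] eq by simp
    then have "exp w \<in> singular_set (punctured_disk 1) f"
      using z1 by (simp add: singular_set_def det_2 mat_def)
    ultimately show False using e(2)[of "exp w"] by (auto simp: \<delta>_def)
  qed
  \<comment> \<open>Stated for every frame: the exclusion of the hyperbolic type applies it to an
    arbitrary lift, the classification to the constructed one.\<close>
  have trace: "\<bar>Re p\<bar> \<le> 1"
    if fr: "null_frame f F N" and pq: "(cmod p)\<^sup>2 - (cmod q)\<^sup>2 = 1"
      and mono: "\<forall>w\<in>left_half_plane. F (w + 2 * of_real pi * \<i>) = F w ** su11 p q" for F N p q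
  proof -
    show ?thesis
    proof (rule null_frame_end_data[OF fr ln\<delta>])
      show "cmod (N w $ 1 $ 2) \<noteq> cmod (N w $ 2 $ 1)" if "Re w < ln \<delta>" for w
        by (rule nd[OF fr that])
    next
      fix G k assume G: "G holomorphic_on {w. Re w < ln \<delta>}" "\<And>w. Re w < ln \<delta> \<Longrightarrow> cmod (G w) < 1"
        and tr: "\<And>p q. (cmod p)\<^sup>2 - (cmod q)\<^sup>2 = 1 \<Longrightarrow>
         (\<And>w. w \<in> left_half_plane \<Longrightarrow> F (w + 2 * of_real pi * \<i>) = F w ** su11 p q) \<Longrightarrow>
         \<exists>p' q'. Re p' = Re p \<and> (cmod p')\<^sup>2 - (cmod q')\<^sup>2 = 1 \<and>
           (\<forall>w. Re w < ln \<delta> \<longrightarrow> G (w + 2 * of_real pi * \<i>) * (cnj q' * G w + cnj p') = p' * G w + q')"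
      obtain p' q' where p': "Re p' = Re p" "(cmod p')\<^sup>2 - (cmod q')\<^sup>2 = 1"
        "\<And>w. Re w < ln \<delta> \<Longrightarrow> G (w + 2 * of_real pi * \<i>) * (cnj q' * G w + cnj p') = p' * G w + q'"
        using tr[OF pq] mono by blast
      have "\<bar>Re p'\<bar> \<le> 1"
        by (rule moebius_monodromy_trace_bound[OF G(1) _ p'(2)]) (use G(2) p'(3) in auto)
      then show ?thesis using p'(1) by simp
    qed
  qed
  have "\<not> hyperbolic_end f"
  proof
    assume "hyperbolic_end f"
    then obtain \<rho> F where \<rho>: "\<rho> \<in> SU11" "hyperbolic \<rho>" and F: "null_lift f F"
      "\<forall>w\<in>left_half_plane. F (w + 2 * of_real pi * \<i>) = F w ** \<rho>"
      unfolding hyperbolic_end_def end_monodromy_def by blast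
    obtain p q where pq: "\<rho> = su11 p q" "(cmod p)\<^sup>2 - (cmod q)\<^sup>2 = 1" using SU11_E[OF \<rho>(1)] .
    obtain N where "null_frame f F N" using null_frame_of_null_lift[OF F(1)] .
    then have "\<bar>Re p\<bar> \<le> 1" using trace pq F(2) by blast
    then show False using hyperbolic_trace \<rho>(2) pq(1) by force
  qed
  obtain F N \<rho> where fr: "null_frame f F N" and N0: "\<And>w. w \<in> left_half_plane \<Longrightarrow> N w \<noteq> 0"
    and c0: "\<exists>w\<in>left_half_plane. N w $ 2 $ 1 \<noteq> 0"
    and \<rho>: "\<rho> \<in> SU11" and mono: "\<And>w. w \<in> left_half_plane \<Longrightarrow> F (w + 2 * of_real pi * \<i>) = F w ** \<rho>"
    by (rule null_frame_exists_nondegenerate[OF face]) blast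
  have "elliptic_end f \<or> parabolic_end f"
  proof -
    \<comment> \<open>A sample point near the end, where |b| and |c| differ; it shows that |g| is
      not identically 1.\<close>
    define w where "w = complex_of_real (ln \<delta> - 1)"
    have "Re w < ln \<delta>" "w \<in> left_half_plane" using ln\<delta> by (auto simp: w_def left_half_plane_def)
    then have "null_lift f F" using null_lift_of_null_frame[OF fr N0 c0] nd[OF fr] by blast
    then have em: "end_monodromy f \<rho>" unfolding end_monodromy_def using \<rho> mono by blast
    obtain p q where pq: "\<rho> = su11 p q" "(cmod p)\<^sup>2 - (cmod q)\<^sup>2 = 1" using SU11_E[OF \<rho>] .
    have "\<bar>Re p\<bar> \<le> 1" using trace[OF fr pq(2)] mono pq(1) by blast
    then show ?thesis
      using su11_elliptic_or_parabolic[OF pq(2)] em pq(1)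
      unfolding elliptic_end_def parabolic_end_def by blast
  qed
  moreover have "\<forall>\<^sub>F r in at_right 0. finite_total_curvature f (punctured_disk r)"
  proof -
    have "finite_total_curvature f (punctured_disk r)" if r: "r \<le> \<delta> * exp (-1)" for r
    proof (rule null_frame_end_data[OF fr ln\<delta>])
      show "cmod (N w $ 1 $ 2) \<noteq> cmod (N w $ 2 $ 1)" if "Re w < ln \<delta>" for w
        by (rule nd[OF fr that])
    next
      fix G k assume "G holomorphic_on {w. Re w < ln \<delta>}" "k holomorphic_on {w. Re w < ln \<delta>}"
        "\<And>w. Re w < ln \<delta> \<Longrightarrow> cmod (G w) < 1" "\<And>w. Re w < ln \<delta> \<Longrightarrow> k w \<noteq> 0"
        "\<And>w. Re w < ln \<delta> \<Longrightarrow>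
          (cmod (N w $ 1 $ 2) - cmod (N w $ 2 $ 1))\<^sup>2 = (cmod (k w) * (1 - (cmod (G w))\<^sup>2))\<^sup>2"
      then show ?thesis
        by (intro end_curvature_integrable[OF \<delta> fr sm(2) _ _ _ _ _ r, of G k]) auto
    qed
    moreover have "0 < \<delta> * exp (-1)" using \<delta> by simp
    ultimately show ?thesis
      unfolding eventually_at_right_field by (intro exI[of _ "\<delta> * exp (-1)"]) auto
  qed
  ultimately show ?thesis using \<open>\<not> hyperbolic_end f\<close> by blast
qed

end
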